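(* Let $K$ be a compact Hausdorff space and let $\mathcal{S}\subset\mathcal{L}(C(K))$ be a right amenable semigroup of Markov operators. For each support $L\subset K$ of an $\mathcal{S}$-ideal and any right ergodic operator net $(T_\alpha)_{\alpha\in A}$ for $\mathcal{S}$, $$\mathrm{rad}_{\mathcal{S}}(I_L)=\Big\{f\in C(K): \lim_\alpha\int_L T_\alpha|f|\,d\mu=0\text{ for each }\mu\in C(L)'\Big\}=\Big\{f\in C(K): \lim_\alpha (T_\alpha|f|)|_L=0\text{ in the norm of }C(L)\Big\}.$$ In particular, if $(T_\alpha)_{\alpha\in A}$ is any right ergodic operator net for $\mathcal{S}$, then an $\mathcal{S}$-ideal $I_L$ is a radical $\mathcal{S}$-ideal if and only if every $f\in C(K)$ satisfying $\lim_\alpha (T_\alpha|f|)|_L=0$ (in the norm of $C(L)$) vanishes on $L$.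
   Context: $C(K)$ is the Banach lattice of continuous complex-valued functions on $K$; its dual $C(K)'$ is identified with the complex regular Borel measures on $K$, with $\langle f,\mu\rangle=\int_K f\,d\mu$ (similarly for $C(L)$). $\mathcal{L}(C(K))$ denotes the bounded linear operators on $C(K)$; $T\in\mathcal{L}(C(K))$ is Markov if it is positive and $T\mathbf{1}=\mathbf{1}$. A semigroup $\mathcal{S}\subset\mathcal{L}(C(K))$ (under composition, with the strong operator topology) is right amenable if there is a positive $m\in C_b(\mathcal{S})'$ with $m(\mathbf{1})=1$ and $m(R_Sf)=m(f)$ for all $f\in C_b(\mathcal{S})$, $S\in\mathcal{S}$, where $(R_Sf)(T)=f(TS)$. An $\mathcal{S}$-ideal is a closed proper ideal $I\subset C(K)$ with $SI\subset I$ for all $S\in\mathcal{S}$. Every closed ideal of $C(K)$ is of the form $I_L=\{f\in C(K): f|_L=0\}$ for a unique closed $L\subset K$; if $I=I_L$ is an $\mathcal{S}$-ideal, $L=\mathrm{supp}\,I$ is called its support. $P_{\mathcal{S}}(K)$ is the set of probability measures $\mu\in C(K)'$ with $S'\mu=\mu$ for all $S\in\mathcal{S}$. For $\mu\in P_{\mathcal{S}}(K)$, let $I_\mu=\{f\in C(K): \langle |f|,\mu\rangle=0\}$ (an $\mathcal{S}$-ideal); every $S\in\mathcal{S}$ induces (uniquely, by continuous extension) a bounded operator $S_\mu$ on $L^1(K,\mu)$, and $\mu$ is ergodic if the common fixed space of all $S_\mu$ ($S\in\mathcal{S}$) in $L^1(K,\mu)$ is one-dimensional. A primitive $\mathcal{S}$-ideal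 is an ideal of the form $I_\mu$ with $\mu\in P_{\mathcal{S}}(K)$ ergodic; $\mathrm{Prim}(\mathcal{S})$ is the set of primitive $\mathcal{S}$-ideals. For $I\subset C(K)$, the $\mathcal{S}$-radical is $\mathrm{rad}_{\mathcal{S}}(I)=\bigcap\{p\in\mathrm{Prim}(\mathcal{S}): I\subset p\}$. An $\mathcal{S}$-ideal $I$ is radical if $I=\mathrm{rad}_{\mathcal{S}}(I)$. Let $\overline{\mathrm{co}}\,\mathcal{S}$ be the closed convex hull of $\mathcal{S}$ in the strong operator topology. A net $(T_\alpha)_{\alpha\in A}\subset\overline{\mathrm{co}}\,\mathcal{S}$ is right ergodic (for $\mathcal{S}$) if $\lim_\alpha T_\alpha(\mathrm{Id}-S)=0$ in the strong operator topology for each $S\in\mathcal{S}$. *)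

theory Defs
  imports "HOL-Analysis.Analysis" "HOL-Probability.Probability_Measure"
begin

text \<open>
  The compact Hausdorff space \<open>K\<close> is a type of class \<open>t2_space\<close> whose \<open>UNIV\<close> is compact. Then
  every continuous function is bounded, and \<open>C(K)\<close> with its supremum norm is the
  library's type of bounded continuous functions. As \<open>blinfun\<close> only knows real scalars,
  complex linearity of the operators on \<open>C(K)\<close> is required explicitly in \<open>markov\<close>.
\<close>

type_synonym 'a CK = "'a \<Rightarrow>\<^sub>C complex"
type_synonym 'a CKop = "('a \<Rightarrow>\<^sub>C complex) \<Rightarrow>\<^sub>L ('a \<Rightarrow>\<^sub>C complex)"

definition cmul :: "complex \<Rightarrow> ('a::topological_space) CK \<Rightarrow> 'a CK" where
  "cmul c f = Bcontfun (\<lambda>x. c * apply_bcontfun f x)"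

definition cabs :: "('a::topological_space) CK \<Rightarrow> 'a CK" where
  "cabs f = Bcontfun (\<lambda>x. complex_of_real (norm (apply_bcontfun f x)))"

lemma apply_cmul [simp]: "apply_bcontfun (cmul c f) x = c * apply_bcontfun f x"
proof -
  have "(\<lambda>x. c * apply_bcontfun f x) \<in> bcontfun"
    using norm_bounded[of f]
    by (intro bcontfun_normI[where b = "norm c * norm f"] continuous_intros)
       (auto simp: norm_mult mult_left_mono)
  then show ?thesis by (simp add: cmul_def Bcontfun_inverse)
qed

lemma apply_cabs [simp]: "apply_bcontfun (cabs f) x = complex_of_real (norm (apply_bcontfun f x))"
proof -
  have "(\<lambda>x. complex_of_real (norm (apply_bcontfun f x))) \<in> bcontfun"
    using norm_bounded[of f]
    by (intro bcontfun_normI[where b = "norm f"] continuous_intros) auto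
  then show ?thesis by (simp add: cabs_def Bcontfun_inverse)
qed

definition complex_linear :: "('a::topological_space) CKop \<Rightarrow> bool" where
  "complex_linear T \<longleftrightarrow> (\<forall>c f. T (cmul c f) = cmul c (T f))"

definition positive_op :: "('a::topological_space) CKop \<Rightarrow> bool" where
  "positive_op T \<longleftrightarrow> (\<forall>f. (\<forall>x. apply_bcontfun f x \<in> \<real>\<^sub>\<ge>\<^sub>0) \<longrightarrow> (\<forall>x. apply_bcontfun (T f) x \<in> \<real>\<^sub>\<ge>\<^sub>0))"

definition markov :: "('a::topological_space) CKop \<Rightarrow> bool" where
  "markov T \<longleftrightarrow> complex_linear T \<and> positive_op T \<and> T (const_bcontfun 1) = const_bcontfun 1"

definition op_semigroup :: "('a::topological_space) CKop set \<Rightarrow> bool" where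
  "op_semigroup \<S> \<longleftrightarrow> (\<forall>T\<in>\<S>. \<forall>U\<in>\<S>. T o\<^sub>L U \<in> \<S>)"

text \<open>
  \<open>C\<^sub>b(\<S>)\<close> consists of functions on the set \<open>\<S>\<close>; they are represented by functions on all
  operators of which only the values on \<open>\<S>\<close> matter. Accordingly, a functional on \<open>C\<^sub>b(\<S>)\<close>
  has to respect equality on \<open>\<S>\<close>.
\<close>

definition Cb :: "('a::topological_space) CKop set \<Rightarrow> ('a CKop \<Rightarrow> complex) set" where
  "Cb \<S> = {f. continuous_map (subtopology strong_operator_topology \<S>) euclidean f \<and> bounded (f ` \<S>)}"

definition Cb_dual ::
    "('a::topological_space) CKop set \<Rightarrow> (('a CKop \<Rightarrow> complex) \<Rightarrow> complex) \<Rightarrow> bool" where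
  "Cb_dual \<S> m \<longleftrightarrow>
     (\<forall>f\<in>Cb \<S>. \<forall>g\<in>Cb \<S>. (\<forall>T\<in>\<S>. f T = g T) \<longrightarrow> m f = m g) \<and>
     (\<forall>f\<in>Cb \<S>. \<forall>g\<in>Cb \<S>. m (\<lambda>T. f T + g T) = m f + m g) \<and>
     (\<forall>c. \<forall>f\<in>Cb \<S>. m (\<lambda>T. c * f T) = c * m f) \<and>
     (\<exists>B. \<forall>f\<in>Cb \<S>. norm (m f) \<le> B * (SUP T\<in>\<S>. norm (f T)))"

definition right_amenable :: "('a::topological_space) CKop set \<Rightarrow> bool" where
  "right_amenable \<S> \<longleftrightarrow>
     (\<exists>m. Cb_dual \<S> m \<and>
          (\<forall>f\<in>Cb \<S>. (\<forall>T\<in>\<S>. f T \<in> \<real>\<^sub>\<ge>\<^sub>0) \<longrightarrow> m f \<in> \<real>\<^sub>\<ge>\<^sub>0) \<and>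
          m (\<lambda>T. 1) = 1 \<and>
          (\<forall>f\<in>Cb \<S>. \<forall>S\<in>\<S>. m (\<lambda>T. f (T o\<^sub>L S)) = m f))"

text \<open>
  Ideals are taken in the sense of Banach lattices; for closed subsets of \<open>C(K)\<close> this is the
  same as being an algebra ideal.
\<close>

definition closed_ideal :: "('a::topological_space) CK set \<Rightarrow> bool" where
  "closed_ideal I \<longleftrightarrow> closed I \<and> 0 \<in> I \<and>
     (\<forall>f\<in>I. \<forall>g\<in>I. f + g \<in> I) \<and> (\<forall>c. \<forall>f\<in>I. cmul c f \<in> I) \<and>
     (\<forall>f\<in>I. \<forall>g. (\<forall>x. norm (apply_bcontfun g x) \<le> norm (apply_bcontfun f x)) \<longrightarrow> g \<in> I)"

definition S_ideal :: "('a::topological_space) CKop set \<Rightarrow> 'a CK set \<Rightarrow> bool" where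
  "S_ideal \<S> I \<longleftrightarrow> closed_ideal I \<and> I \<noteq> UNIV \<and> (\<forall>S\<in>\<S>. blinfun_apply S ` I \<subseteq> I)"

definition vanishing_ideal :: "('a::topological_space) set \<Rightarrow> 'a CK set" where
  "vanishing_ideal L = {f. \<forall>x\<in>L. apply_bcontfun f x = 0}"

abbreviation borel_on :: "('a::topological_space) set \<Rightarrow> 'a set set" where
  "borel_on L \<equiv> sets (restrict_space borel L)"

definition regular_on :: "('a::topological_space) set \<Rightarrow> ('a set \<Rightarrow> ennreal) \<Rightarrow> bool" where
  "regular_on L m \<longleftrightarrow> (\<forall>A\<in>borel_on L.
     m A = (INF U\<in>{U. openin (top_of_set L) U \<and> A \<subseteq> U}. m U) \<and>
     m A = (SUP C\<in>{C. compact C \<and> C \<subseteq> A}. m C))"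

definition total_variation ::
    "('a::topological_space) set \<Rightarrow> ('a set \<Rightarrow> complex) \<Rightarrow> 'a set \<Rightarrow> ennreal" where
  "total_variation L \<nu> A =
     (SUP P\<in>{P. finite P \<and> disjoint P \<and> P \<subseteq> borel_on L \<and> \<Union>P = A}.
        \<Sum>B\<in>P. ennreal (norm (\<nu> B)))"

definition complex_regular_measure ::
    "('a::topological_space) set \<Rightarrow> ('a set \<Rightarrow> complex) \<Rightarrow> bool" where
  "complex_regular_measure L \<nu> \<longleftrightarrow>
     (\<forall>A::nat \<Rightarrow> 'a set. range A \<subseteq> borel_on L \<and> disjoint_family A \<longrightarrow>
        (\<lambda>n. \<nu> (A n)) sums \<nu> (\<Union>n. A n)) \<and>
     regular_on L (total_variation L \<nu>)"

text \<open>
  \<open>jordan_pos L r\<close> is the positive part \<open>A \<mapsto> sup {r B | B \<subseteq> A Borel}\<close> of the Jordan decomposition of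
  a finite signed Borel measure \<open>r\<close> on \<open>L\<close> (\<open>ennreal\<close> sends negative numbers to \<open>0 = r {}\<close>);
  the negative part is \<open>jordan_pos L (- r)\<close>.
\<close>

definition jordan_pos :: "('a::topological_space) set \<Rightarrow> ('a set \<Rightarrow> real) \<Rightarrow> 'a measure" where
  "jordan_pos L r =
     measure_of L (borel_on L) (\<lambda>A. SUP B\<in>{B\<in>borel_on L. B \<subseteq> A}. ennreal (r B))"

definition cintegral ::
    "('a::topological_space) set \<Rightarrow> ('a set \<Rightarrow> complex) \<Rightarrow> ('a \<Rightarrow> complex) \<Rightarrow> complex" where
  "cintegral L \<nu> g =
     integral\<^sup>L (jordan_pos L (\<lambda>A. Re (\<nu> A))) g - integral\<^sup>L (jordan_pos L (\<lambda>A. - Re (\<nu> A))) g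
     + \<i> * (integral\<^sup>L (jordan_pos L (\<lambda>A. Im (\<nu> A))) g
           - integral\<^sup>L (jordan_pos L (\<lambda>A. - Im (\<nu> A))) g)"

lemma jordan_pos_measure:
  assumes "finite_measure M" "space M = L" "sets M = borel_on L"
  shows "jordan_pos L (measure M) = M" and "jordan_pos L (\<lambda>A. - measure M A) = null_measure M"
    and "jordan_pos L (\<lambda>A. 0) = null_measure M"
proof -
  interpret finite_measure M by fact
  have *: "(SUP B\<in>{B\<in>sets M. B \<subseteq> A}. ennreal (measure M B)) = emeasure M A"
    if "A \<in> sets M" for A
    using that
    by (intro antisym SUP_least SUP_upper2[of A])
       (auto simp: emeasure_eq_measure intro!: ennreal_leI finite_measure_mono)
  have jp: "jordan_pos L r = measure_of (space M) (sets M)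
      (\<lambda>A. SUP B\<in>{B\<in>sets M. B \<subseteq> A}. ennreal (r B))" for r
    unfolding jordan_pos_def by (simp only: assms)
  have "jordan_pos L (measure M) = measure_of (space M) (sets M) (emeasure M)"
    unfolding jp by (rule measure_of_eq[OF sets.space_closed]) (simp add: sets.sigma_sets_eq *)
  then show "jordan_pos L (measure M) = M" by (simp add: measure_of_of_measure)
  have null: "jordan_pos L r = null_measure M" if "\<And>B. r B \<le> 0" for r
    unfolding jp null_measure_def using that
    by (intro measure_of_eq[OF sets.space_closed] antisym SUP_least) (auto simp: ennreal_neg)
  show "jordan_pos L (\<lambda>A. - measure M A) = null_measure M" "jordan_pos L (\<lambda>A. 0) = null_measure M"
    by (rule null, simp)+
qed

text \<open>For a finite positive measure \<open>cintegral\<close> is the usual integral.\<close>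

lemma cintegral_measure:
  assumes "finite_measure M" "space M = L" "sets M = borel_on L"
  shows "cintegral L (\<lambda>A. complex_of_real (measure M A)) g = integral\<^sup>L M g"
  using jordan_pos_measure[OF assms] by (simp add: cintegral_def)

definition norm_CL :: "('a::topological_space) set \<Rightarrow> ('a \<Rightarrow> complex) \<Rightarrow> real" where
  "norm_CL L g = (SUP x\<in>L. norm (g x))"

text \<open>\<open>S'\<mu> = \<mu>\<close> is an equality of functionals on \<open>C(K)\<close>, that is, \<open>\<langle>Sf, \<mu>\<rangle> = \<langle>f, \<mu>\<rangle>\<close> for all \<open>f\<close>.\<close>

definition invariant_probs :: "('a::topological_space) CKop set \<Rightarrow> 'a measure set" where
  "invariant_probs \<S> = {\<mu>. sets \<mu> = sets borel \<and> prob_space \<mu> \<and> regular_on UNIV (emeasure \<mu>) \<and>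
     (\<forall>S\<in>\<S>. \<forall>f. integral\<^sup>L \<mu> (apply_bcontfun (S f)) = integral\<^sup>L \<mu> (apply_bcontfun f))}"

definition I_mu :: "('a::topological_space) measure \<Rightarrow> 'a CK set" where
  "I_mu \<mu> = {f. integral\<^sup>L \<mu> (apply_bcontfun (cabs f)) = 0}"

text \<open>
  \<open>L1_extension \<mu> S f g\<close> says \<open>S\<^sub>\<mu> f = g\<close> in \<open>L\<^sup>1(K, \<mu>)\<close>, where the elements of \<open>L\<^sup>1\<close> are represented by
  integrable functions: the graph of the extension \<open>S\<^sub>\<mu>\<close> by continuity is the
  closure in \<open>L\<^sup>1 \<times> L\<^sup>1\<close> of the graph of \<open>S\<close> on \<open>C(K)\<close>.
\<close>

definition L1_extension ::
    "('a::topological_space) measure \<Rightarrow> 'a CKop \<Rightarrow> ('a \<Rightarrow> complex) \<Rightarrow> ('a \<Rightarrow> complex) \<Rightarrow> bool" where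
  "L1_extension \<mu> S f g \<longleftrightarrow> integrable \<mu> f \<and> integrable \<mu> g \<and>
     (\<exists>u :: nat \<Rightarrow> 'a CK.
        (\<lambda>n. \<integral>x. norm (apply_bcontfun (u n) x - f x) \<partial>\<mu>) \<longlonglongrightarrow> 0 \<and>
        (\<lambda>n. \<integral>x. norm (apply_bcontfun (S (u n)) x - g x) \<partial>\<mu>) \<longlonglongrightarrow> 0)"

definition L1_fixed_space ::
    "('a::topological_space) CKop set \<Rightarrow> 'a measure \<Rightarrow> ('a \<Rightarrow> complex) set" where
  "L1_fixed_space \<S> \<mu> = {f. integrable \<mu> f \<and> (\<forall>S\<in>\<S>. L1_extension \<mu> S f f)}"

definition ergodic :: "('a::topological_space) CKop set \<Rightarrow> 'a measure \<Rightarrow> bool" where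
  "ergodic \<S> \<mu> \<longleftrightarrow>
     (\<exists>h\<in>L1_fixed_space \<S> \<mu>. \<not> (AE x in \<mu>. h x = 0) \<and>
        (\<forall>f\<in>L1_fixed_space \<S> \<mu>. \<exists>c. AE x in \<mu>. f x = c * h x))"

definition Prim :: "('a::topological_space) CKop set \<Rightarrow> 'a CK set set" where
  "Prim \<S> = {I_mu \<mu> | \<mu>. \<mu> \<in> invariant_probs \<S> \<and> ergodic \<S> \<mu>}"

definition S_radical :: "('a::topological_space) CKop set \<Rightarrow> 'a CK set \<Rightarrow> 'a CK set" where
  "S_radical \<S> I = \<Inter>{p \<in> Prim \<S>. I \<subseteq> p}"

definition radical_S_ideal :: "('a::topological_space) CKop set \<Rightarrow> 'a CK set \<Rightarrow> bool" where
  "radical_S_ideal \<S> I \<longleftrightarrow> S_ideal \<S> I \<and> I = S_radical \<S> I"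

definition directed_set :: "'i set \<Rightarrow> ('i \<Rightarrow> 'i \<Rightarrow> bool) \<Rightarrow> bool" where
  "directed_set A le \<longleftrightarrow> A \<noteq> {} \<and> (\<forall>i\<in>A. le i i) \<and>
     (\<forall>i\<in>A. \<forall>j\<in>A. \<forall>k\<in>A. le i j \<longrightarrow> le j k \<longrightarrow> le i k) \<and>
     (\<forall>i\<in>A. \<forall>j\<in>A. \<exists>k\<in>A. le i k \<and> le j k)"

text \<open>Limits of a net indexed by \<open>A\<close> are limits along its filter of tails.\<close>

definition tails :: "'i set \<Rightarrow> ('i \<Rightarrow> 'i \<Rightarrow> bool) \<Rightarrow> 'i filter" where
  "tails A le = (INF i\<in>A. principal {j\<in>A. le i j})"

lemma eventually_tails:
  assumes "directed_set A le"
  shows "eventually P (tails A le) \<longleftrightarrow> (\<exists>i\<in>A. \<forall>j\<in>A. le i j \<longrightarrow> P j)"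
proof -
  have "eventually P (tails A le) \<longleftrightarrow> (\<exists>i\<in>A. eventually P (principal {j\<in>A. le i j}))"
    unfolding tails_def
  proof (rule eventually_INF_base)
    show "A \<noteq> {}" using assms by (simp add: directed_set_def)
    fix i j assume ij: "i \<in> A" "j \<in> A"
    then obtain k where k: "k \<in> A" "le i k" "le j k"
      using assms unfolding directed_set_def by blast
    have "{l\<in>A. le k l} \<subseteq> {l\<in>A. le i l} \<inter> {l\<in>A. le j l}"
      using assms ij k unfolding directed_set_def by blast
    then show "\<exists>k\<in>A. principal {l\<in>A. le k l}
        \<le> inf (principal {l\<in>A. le i l}) (principal {l\<in>A. le j l})"
      using k(1) by auto
  qed
  then show ?thesis by (auto simp: eventually_principal)
qed

definition right_ergodic_net ::
    "('a::topological_space) CKop set \<Rightarrow> 'i set \<Rightarrow> ('i \<Rightarrow> 'i \<Rightarrow> bool) \<Rightarrow> ('i \<Rightarrow> 'a CKop) \<Rightarrow> bool" where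
  "right_ergodic_net \<S> A le T \<longleftrightarrow> directed_set A le \<and>
     (\<forall>i\<in>A. T i \<in> strong_operator_topology closure_of (convex hull \<S>)) \<and>
     (\<forall>S\<in>\<S>. limitin strong_operator_topology (\<lambda>i. T i o\<^sub>L (id_blinfun - S)) 0 (tails A le))"

end

theory Submission
  imports Defs
begin

text \<open>
  If \<open>\<mu>\<close> is an invariant probability measure supported by \<open>L\<close>, then \<open>\<langle>T\<^sub>\<alpha>\<bar>f\<bar>, \<mu>\<rangle> = \<langle>\<bar>f\<bar>, \<mu>\<rangle>\<close> for all \<open>\<alpha>\<close>, so
  that weak convergence of \<open>T\<^sub>\<alpha>\<bar>f\<bar>\<close> to \<open>0\<close> on \<open>L\<close> forces \<open>f \<in> I\<^sub>\<mu>\<close>. Conversely, if \<open>T\<^sub>\<alpha>\<bar>f\<bar>\<close> does not converge to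
  \<open>0\<close> uniformly on \<open>L\<close>, there are points \<open>x\<^sub>\<alpha> \<in> L\<close> with \<open>T\<^sub>\<alpha>\<bar>f\<bar>(x\<^sub>\<alpha>) \<ge> \<epsilon>\<close> frequently. By right ergodicity, a
  cluster point of the states \<open>g \<mapsto> T\<^sub>\<alpha>g(x\<^sub>\<alpha>)\<close> is an invariant state that vanishes on \<open>I\<^sub>L\<close> and is positive at
  \<open>\<bar>f\<bar>\<close>. The invariant states vanishing on \<open>I\<^sub>L\<close> form a compact convex set, on which evaluation at \<open>\<bar>f\<bar>\<close> attains its
  maximum at an extreme point. The measure representing an extreme invariant state is ergodic, because
  a real function \<open>h\<close> that is fixed in \<open>L\<^sup>1\<close> makes the truncations of \<open>h\<close> invariant densities. Hence \<open>f\<close> lies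
  outside a primitive ideal containing \<open>I\<^sub>L\<close>.
\<close>

section \<open>Positive functionals on \<open>C(K)\<close>\<close>

text \<open>\<open>K\<close> need not be metrizable, and \<open>ergodic\<close> describes the
  operators on L^1 through closures of graphs over C(K). Hence cluster points are taken along
  filters, and an L^1-fixed function \<open>h\<close> enters only through continuous
  \<open>v n\<close> such that both \<open>v n\<close> and \<open>Q (v n)\<close> are close to
  \<open>h\<close>. All estimates concern continuous functions \<open>u\<close> that are almost
  fixed in the mean, with the defect \<Phi> |u - Q u| as the small quantity.

  Two facts make such functions useful. Clamping \<open>u\<close> enlarges the defect at most by a
  constant factor, because \<open>Q\<close> is positive and preserves \<Phi>. And
  \<open>Q (u g)\<close> is close to \<open>u Q g\<close>, because the variance Q(u^2) - 2 u Q u +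
  u^2 has a mean controlled by the defect once \<open>u\<close> is bounded. Together with the
  invariance of \<Phi> this makes \<open>u\<close> an almost invariant density.

  A maximiser is chosen, and not just any extreme point, because the primitive ideal has to miss the
  given \<open>f\<close>: the lower bound at |f| that the cluster point provides must hold for the
  extreme state too.\<close>

text \<open>
  States act on arbitrary real functions; the value \<open>0\<close> off \<open>C(K)\<close> makes a state determined by its
  restriction to \<open>C(K)\<close>.
\<close>

locale state =
  fixes \<Phi> :: "('a::t2_space \<Rightarrow> real) \<Rightarrow> real"
  assumes compact_UNIV: "compact (UNIV :: 'a set)"
    and not_continuous: "\<not> continuous_on UNIV g \<Longrightarrow> \<Phi> g = 0"
    and add: "continuous_on UNIV f \<Longrightarrow> continuous_on UNIV g \<Longrightarrow> \<Phi> (\<lambda>x. f x + g x) = \<Phi> f + \<Phi> g"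
    and scale: "continuous_on UNIV g \<Longrightarrow> \<Phi> (\<lambda>x. c * g x) = c * \<Phi> g"
    and nonneg: "continuous_on UNIV g \<Longrightarrow> (\<And>x. 0 \<le> g x) \<Longrightarrow> 0 \<le> \<Phi> g"
    and one: "\<Phi> (\<lambda>_. 1) = 1"

lemma urysohn_compact:
  fixes C D :: "'a::t2_space set"
  assumes "compact (UNIV :: 'a set)" "closed C" "closed D" "C \<inter> D = {}"
  obtains h :: "'a \<Rightarrow> real" where "continuous_on UNIV h" "\<forall>x. 0 \<le> h x \<and> h x \<le> 1"
    "\<forall>x\<in>C. h x = 1" "\<forall>x\<in>D. h x = 0"
proof -
  have "normal_space (euclidean :: 'a topology)"
    by (rule compact_Hausdorff_or_regular_imp_normal_space)
      (use assms(1) hausdorff in \<open>auto simp: compact_space_def Hausdorff_space_def disjnt_def\<close>)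
  moreover have "disjnt D C" using assms by (auto simp: disjnt_def)
  ultimately obtain f :: "'a \<Rightarrow> real" where f: "continuous_map euclidean (top_of_set {0..1}) f"
      "f ` D \<subseteq> {0}" "f ` C \<subseteq> {1}"
    using Urysohn_lemma[of euclidean D C 0 1] assms by auto
  then have "continuous_on UNIV f" "\<And>x. f x \<in> {0..1}"
    by (auto simp: continuous_map_in_subtopology)
  with f show ?thesis by (intro that[of f]) auto
qed

context state begin

lemma diff:
  assumes f: "continuous_on UNIV f" and g: "continuous_on UNIV g"
  shows "\<Phi> (\<lambda>x. f x - g x) = \<Phi> f - \<Phi> g"
proof -
  have "continuous_on UNIV (\<lambda>x. - 1 * g x)" by (intro continuous_intros g)
  from add[OF f this] scale[OF g, of "-1"] show ?thesis by simp
qed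

lemma mono:
  assumes f: "continuous_on UNIV f" and g: "continuous_on UNIV g" and le: "\<And>x. f x \<le> g x"
  shows "\<Phi> f \<le> \<Phi> g"
proof -
  have "continuous_on UNIV (\<lambda>x. g x - f x)" by (intro continuous_intros f g)
  from nonneg[OF this] le show ?thesis by (simp add: diff[OF g f])
qed

lemma const [simp]: "\<Phi> (\<lambda>_. c) = c"
  using scale[of "\<lambda>_. 1" c] one by simp

lemma sum:
  assumes "finite I" "\<And>i. i \<in> I \<Longrightarrow> continuous_on UNIV (f i)"
  shows "\<Phi> (\<lambda>x. \<Sum>i\<in>I. f i x) = (\<Sum>i\<in>I. \<Phi> (f i))"
  using assms
proof (induction rule: finite_induct)
  case (insert i I)
  then have "continuous_on UNIV (f i)" "continuous_on UNIV (\<lambda>x. \<Sum>i\<in>I. f i x)"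
    by (auto intro: continuous_on_sum)
  from add[OF this] insert show ?case by simp
qed simp

end

section \<open>The Riesz representation theorem\<close>

lemma ennreal_le_plus:
  "a \<le> b + c \<Longrightarrow> 0 \<le> b \<Longrightarrow> 0 \<le> c \<Longrightarrow> ennreal a \<le> ennreal b + ennreal c"
  by (metis ennreal_leI ennreal_plus)

text \<open>The segment from 0 to \<open>t\<close> is cut at the multiples of 1/n; the k-th summand
  is the length of its part in the k-th slice. Applied pointwise, this is a layer-cake decomposition
  into continuous functions.\<close>

lemma clamp_layers:
  fixes t :: real
  assumes "0 \<le> t" "t \<le> 1" "0 < n"
  shows "(\<Sum>k<n. max 0 (min (t - real k / n) (1 / n))) = t"
proof -
  have *: "(\<Sum>k<m. max 0 (min (t - real k / n) (1 / n))) = min t (real m / n)" for m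
  proof (induction m)
    case 0 then show ?case using assms by simp
  next
    case (Suc m)
    have "real (Suc m) / n = real m / n + 1 / n" "0 < 1 / real n"
      using assms by (simp_all add: add_divide_distrib)
    with Suc show ?case unfolding sum.lessThan_Suc by linarith
  qed
  show ?thesis using *[of n] assms by simp
qed

section \<open>Mass of open sets and the outer measure of a state\<close>

context state begin

definition test :: "'a set \<Rightarrow> ('a \<Rightarrow> real) set" where
  "test U = {g. continuous_on UNIV g \<and> (\<forall>x. 0 \<le> g x \<and> g x \<le> 1) \<and> (\<forall>x. x \<notin> U \<longrightarrow> g x = 0)}"

lemma testI:
  assumes "continuous_on UNIV g" "\<And>x. 0 \<le> g x" "\<And>x. g x \<le> 1" "\<And>x. x \<notin> U \<Longrightarrow> g x = 0"
  shows "g \<in> test U"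
  using assms by (simp add: test_def)

lemma testD:
  assumes "g \<in> test U"
  shows "continuous_on UNIV g" "0 \<le> g x" "g x \<le> 1" "x \<notin> U \<Longrightarrow> g x = 0"
  using assms by (simp_all add: test_def)

text \<open>This is the only value that a regular measure representing \<Phi> can give to an open
  set. Extending it from outside to all sets is then forced as well.\<close>

definition open_mass :: "'a set \<Rightarrow> ennreal" where
  "open_mass U = (SUP g\<in>test U. ennreal (\<Phi> g))"

definition outer :: "'a set \<Rightarrow> ennreal" where
  "outer E = (INF U\<in>{U. open U \<and> E \<subseteq> U}. open_mass U)"

lemma test_bounds: assumes "g \<in> test U" shows "0 \<le> \<Phi> g" "\<Phi> g \<le> 1"
  using nonneg[of g] mono[of g "\<lambda>_. 1"] testD[OF assms] by auto

lemma open_mass_upper: "g \<in> test U \<Longrightarrow> ennreal (\<Phi> g) \<le> open_mass U"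
  by (auto simp: open_mass_def intro: SUP_upper)

lemma open_mass_mono: "U \<subseteq> V \<Longrightarrow> open_mass U \<le> open_mass V"
  unfolding open_mass_def by (intro SUP_subset_mono) (auto simp: test_def)

lemma zero_test: "(\<lambda>_. 0) \<in> test U"
  by (auto simp: test_def)

lemma open_mass_empty: "open_mass {} = 0"
proof -
  have "test {} = {\<lambda>_. 0}" by (auto simp: test_def)
  then show ?thesis by (simp add: open_mass_def)
qed

lemma open_mass_UNIV: "open_mass UNIV = 1"
proof (rule antisym)
  show "open_mass UNIV \<le> 1"
    unfolding open_mass_def using test_bounds(2) by (intro SUP_least) (simp add: ennreal_le_1)
  show "1 \<le> open_mass UNIV"
    using open_mass_upper[of "\<lambda>_. 1" UNIV] by (simp add: test_def)
qed

lemma outer_open: "open U \<Longrightarrow> outer U = open_mass U"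
  unfolding outer_def by (intro antisym INF_lower INF_greatest) (auto intro: open_mass_mono)

lemma outer_mono: "E \<subseteq> F \<Longrightarrow> outer E \<le> outer F"
  unfolding outer_def by (intro INF_superset_mono) auto

lemma outer_le_1: "outer E \<le> 1"
  using outer_mono[of E UNIV] outer_open[of UNIV] open_mass_UNIV by simp

text \<open>
  Test functions for \<open>U\<close> need only vanish off \<open>U\<close>. After subtracting \<open>e\<close> their support lies in the
  compact set \<open>{x. e \<le> g x} \<subseteq> U\<close>.
\<close>

lemma shrink:
  assumes g: "g \<in> test U" and e: "0 < e"
  shows "(\<lambda>x. max 0 (g x - e)) \<in> test {x. e < g x}" "\<Phi> g \<le> \<Phi> (\<lambda>x. max 0 (g x - e)) + e"
proof -
  have c: "continuous_on UNIV (\<lambda>x. max 0 (g x - e))"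
    by (intro continuous_intros testD(1)[OF g])
  show "(\<lambda>x. max 0 (g x - e)) \<in> test {x. e < g x}"
  proof (rule testI[OF c])
    show "max 0 (g x - e) \<le> 1" for x using testD(3)[OF g, of x] e by simp
  qed auto
  have "\<Phi> g \<le> \<Phi> (\<lambda>x. max 0 (g x - e) + e)"
    by (intro mono continuous_intros testD(1)[OF g]) auto
  also have "\<dots> = \<Phi> (\<lambda>x. max 0 (g x - e)) + e"
    using c by (subst add) auto
  finally show "\<Phi> g \<le> \<Phi> (\<lambda>x. max 0 (g x - e)) + e" .
qed

lemma test_superlevel:
  assumes "g \<in> test U" "0 < e"
  shows "closed {x. e \<le> g x}" "compact {x. e \<le> g x}" "{x. e \<le> g x} \<subseteq> U" "open {x. e < g x}"
proof -
  show "closed {x. e \<le> g x}" "open {x. e < g x}"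
    by (intro closed_Collect_le open_Collect_less continuous_on_const testD(1)[OF assms(1)])+
  then show "compact {x. e \<le> g x}"
    using compact_Int_closed[OF compact_UNIV] by simp
  show "{x. e \<le> g x} \<subseteq> U" using assms by (auto simp: test_def)
qed

text \<open>A test function for the union, lowered by \<open>e\<close>, lives over the compact set
  \<open>C\<close> where it was at least \<open>e\<close>. A Urysohn function that is 1 on
  \<open>C - V\<close> and 0 off \<open>U\<close> splits it into a test function for
  \<open>U\<close> and one for \<open>V\<close>.\<close>

lemma open_mass_Un:
  assumes "open U" "open V"
  shows "open_mass (U \<union> V) \<le> open_mass U + open_mass V"
  unfolding open_mass_def[of "U \<union> V"]
proof (rule SUP_least, rule ennreal_le_epsilon)
  fix g and e :: real assume g: "g \<in> test (U \<union> V)" and e: "0 < e"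
  define C where "C = {x. e \<le> g x}"
  note lev = test_superlevel[OF g e, folded C_def]
  let ?g = "\<lambda>x. max 0 (g x - e)"
  have cl: "closed (C - V)" "closed (- U)" "(C - V) \<inter> - U = {}"
    using assms lev(1,3) by (auto intro: closed_Diff)
  obtain h :: "'a \<Rightarrow> real" where "continuous_on UNIV h" "\<forall>x. 0 \<le> h x \<and> h x \<le> 1"
    "\<forall>x\<in>C - V. h x = 1" "\<forall>x\<in>- U. h x = 0"
    by (rule urysohn_compact[OF compact_UNIV cl])
  then have h: "continuous_on UNIV h" "\<And>x. 0 \<le> h x" "\<And>x. h x \<le> 1"
    "\<And>x. x \<in> C - V \<Longrightarrow> h x = 1" "\<And>x. x \<in> - U \<Longrightarrow> h x = 0"
    by blast+
  have gt: "?g \<in> test {x. e < g x}" and ge: "\<Phi> g \<le> \<Phi> ?g + e" by (rule shrink[OF g e])+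
  have g01: "continuous_on UNIV ?g" "\<And>x. 0 \<le> ?g x" "\<And>x. ?g x \<le> 1"
    by (rule testD[OF gt])+
  have 1: "(\<lambda>x. ?g x * h x) \<in> test U"
    by (rule testI) (use g01 h in \<open>auto intro!: continuous_on_mult mult_le_one simp del: max.bounded_iff\<close>)
  have z: "?g x * (1 - h x) = 0" if "x \<notin> V" for x
  proof (cases "x \<in> C")
    case True then show ?thesis using h(4)[of x] that by simp
  next
    case False then show ?thesis by (simp add: C_def)
  qed
  have 2: "(\<lambda>x. ?g x * (1 - h x)) \<in> test V"
  proof (rule testI)
    show "continuous_on UNIV (\<lambda>x. ?g x * (1 - h x))" by (intro continuous_intros g01 h testD(1)[OF g])
    show "0 \<le> ?g x * (1 - h x)" for x by (intro mult_nonneg_nonneg g01) (simp add: h)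
    show "?g x * (1 - h x) \<le> 1" for x by (intro mult_le_one g01) (simp_all add: h)
  qed (rule z)
  have "\<Phi> ?g = \<Phi> (\<lambda>x. ?g x * h x + ?g x * (1 - h x))" by (simp add: algebra_simps)
  also have "\<dots> = \<Phi> (\<lambda>x. ?g x * h x) + \<Phi> (\<lambda>x. ?g x * (1 - h x))"
    by (intro add testD(1)[OF 1] testD(1)[OF 2])
  finally have "ennreal (\<Phi> g) \<le> ennreal (\<Phi> (\<lambda>x. ?g x * h x) + \<Phi> (\<lambda>x. ?g x * (1 - h x)) + e)"
    using ge by (intro ennreal_leI) simp
  also have "\<dots> = ennreal (\<Phi> (\<lambda>x. ?g x * h x)) + ennreal (\<Phi> (\<lambda>x. ?g x * (1 - h x))) + ennreal e"
    using test_bounds(1)[OF 1] test_bounds(1)[OF 2] e by simp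
  also have "\<dots> \<le> open_mass U + open_mass V + ennreal e"
    using 1 2 by (intro add_mono open_mass_upper) auto
  finally show "ennreal (\<Phi> g) \<le> open_mass U + open_mass V + ennreal e" .
qed

lemma open_mass_UN_finite:
  assumes "\<And>i::nat. open (U i)"
  shows "open_mass (\<Union>i<n. U i) \<le> (\<Sum>i<n. open_mass (U i))"
proof (induction n)
  case 0 then show ?case by (simp add: open_mass_empty)
next
  case (Suc n)
  have "(\<Union>i<Suc n. U i) = (\<Union>i<n. U i) \<union> U n" by (auto simp: less_Suc_eq)
  then have "open_mass (\<Union>i<Suc n. U i) \<le> open_mass (\<Union>i<n. U i) + open_mass (U n)"
    using open_mass_Un[of "\<Union>i<n. U i" "U n"] assms by (metis open_UN)
  with Suc show ?case by (simp add: add_right_mono order_trans)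
qed

text \<open>The set where a test function is at least \<open>e\<close> is compact, so finitely many
  of the \<open>U i\<close> cover it, and the finite case applies to the lowered function.\<close>

lemma open_mass_UN:
  assumes U: "\<And>i::nat. open (U i)"
  shows "open_mass (\<Union>i. U i) \<le> (\<Sum>i. open_mass (U i))"
  unfolding open_mass_def[of "\<Union>i. U i"]
proof (rule SUP_least, rule ennreal_le_epsilon)
  fix g and e :: real assume g: "g \<in> test (\<Union>i. U i)" and e: "0 < e"
  note lev = test_superlevel[OF g e]
  obtain I where I: "finite I" "{x. e \<le> g x} \<subseteq> (\<Union>i\<in>I. U i)"
    using compactE_image[OF lev(2), of UNIV U] U lev(3) by auto
  then obtain n where n: "I \<subseteq> {..<n}" using finite_nat_iff_bounded by auto
  have gt: "(\<lambda>x. max 0 (g x - e)) \<in> test {x. e < g x}"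
    and ge: "\<Phi> g \<le> \<Phi> (\<lambda>x. max 0 (g x - e)) + e" by (rule shrink[OF g e])+
  have "ennreal (\<Phi> g) \<le> ennreal (\<Phi> (\<lambda>x. max 0 (g x - e))) + ennreal e"
    using ge test_bounds(1)[OF gt] e by (intro ennreal_le_plus) simp_all
  also have "\<dots> \<le> open_mass {x. e < g x} + ennreal e"
    by (intro add_right_mono open_mass_upper gt)
  also have "open_mass {x. e < g x} \<le> open_mass (\<Union>i<n. U i)"
  proof (rule open_mass_mono)
    have "{x. e < g x} \<subseteq> {x. e \<le> g x}" by (simp add: Collect_mono)
    also note I(2)
    also have "(\<Union>i\<in>I. U i) \<subseteq> (\<Union>i<n. U i)" using n by (rule UN_mono) simp
    finally show "{x. e < g x} \<subseteq> (\<Union>i<n. U i)" .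
  qed
  also have "\<dots> \<le> (\<Sum>i<n. open_mass (U i))" by (rule open_mass_UN_finite[OF U])
  also have "\<dots> \<le> (\<Sum>i. open_mass (U i))" by (rule sum_le_suminf) auto
  finally show "ennreal (\<Phi> g) \<le> (\<Sum>i. open_mass (U i)) + ennreal e" by (simp add: add_mono)
qed

lemma outer_approx:
  assumes "0 < e"
  obtains U where "open U" "E \<subseteq> U" "open_mass U \<le> outer E + ennreal e"
proof -
  \<comment> \<open>The value of \<open>outer\<close> is at most 1, hence finite, so that adding
    \<open>e\<close> gives a strict increase.\<close>
  have "outer E < outer E + ennreal e"
    using outer_le_1[of E] assms by (simp add: ennreal_add_left_cancel_less top.not_eq_extremum le_less_trans)
  then show ?thesis
    using that unfolding outer_def[of E] INF_less_iff by (auto intro: less_imp_le)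
qed

lemma outer_measure_space_outer: "outer_measure_space (Pow UNIV) outer"
  unfolding outer_measure_space_def
proof (intro conjI)
  show "positive (Pow UNIV) outer"
    by (simp add: positive_def outer_open open_mass_empty)
  show "increasing (Pow UNIV) outer"
    by (simp add: increasing_def outer_mono)
  show "countably_subadditive (Pow UNIV) outer"
    unfolding countably_subadditive_def
  proof (intro allI impI, rule ennreal_le_epsilon)
    fix E :: "nat \<Rightarrow> 'a set" and e :: real assume e: "0 < e"
    have "\<exists>U. open U \<and> E n \<subseteq> U \<and> open_mass U \<le> outer (E n) + ennreal (e * (1/2) ^ Suc n)" for n
    proof -
      have "0 < e * (1/2) ^ Suc n" using e by simp
      then obtain U where "open U" "E n \<subseteq> U" "open_mass U \<le> outer (E n) + ennreal (e * (1/2) ^ Suc n)"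
        by (rule outer_approx)
      then show ?thesis by blast
    qed
    then obtain U where U: "\<And>n. open (U n)" "\<And>n. E n \<subseteq> U n"
      "\<And>n. open_mass (U n) \<le> outer (E n) + ennreal (e * (1/2) ^ Suc n)" by metis
    have "outer (\<Union>n. E n) \<le> open_mass (\<Union>n. U n)"
      unfolding outer_def using U by (intro INF_lower) auto
    also have "\<dots> \<le> (\<Sum>n. open_mass (U n))" by (rule open_mass_UN[OF U(1)])
    also have "\<dots> \<le> (\<Sum>n. outer (E n) + ennreal (e * (1/2) ^ Suc n))"
      by (intro suminf_le U summableI)
    also have "\<dots> = (\<Sum>n. outer (E n)) + (\<Sum>n. ennreal (e * (1/2) ^ Suc n))"
      by (rule suminf_add[symmetric]) (rule summableI)+
    also have "(\<Sum>n. ennreal (e * (1/2) ^ Suc n)) = ennreal e"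
      using sums_mult[OF power_half_series, of e] e by (intro suminf_ennreal_eq) auto
    finally show "outer (\<Union>n. E n) \<le> (\<Sum>n. outer (E n)) + ennreal e" .
  qed
qed

lemma open_lambda_system:
  assumes U: "open U"
  shows "U \<in> lambda_system UNIV (Pow UNIV) outer"
  unfolding lambda_system_def
proof safe
  fix E :: "'a set"
  have sub: "outer E \<le> outer (U \<inter> E) + outer ((UNIV - U) \<inter> E)"
  proof -
    have "countably_subadditive (Pow UNIV) outer" "positive (Pow UNIV) outer"
      using outer_measure_space_outer by (auto simp: outer_measure_space_def)
    then have "subadditive (Pow UNIV) outer"
      by (intro ring_of_sets.countably_subadditive_subadditive) (rule ring_of_sets_Pow)
    from subadditiveD[OF this, of "U \<inter> E" "(UNIV - U) \<inter> E"] show ?thesis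
      by (auto simp: Int_Un_distrib2[symmetric])
  qed
  have "outer (U \<inter> E) + outer ((UNIV - U) \<inter> E) \<le> outer E"
    unfolding outer_def[of E]
  proof (rule INF_greatest, rule ennreal_le_epsilon)
    fix W and e :: real assume "W \<in> {U. open U \<and> E \<subseteq> U}" and e: "0 < e"
    then have W: "open W" "E \<subseteq> W" by auto
    have "outer (U \<inter> E) \<le> outer (W \<inter> U)" using W by (intro outer_mono) auto
    also have "\<dots> = open_mass (W \<inter> U)" using W U by (intro outer_open) auto
    finally have le1: "outer (U \<inter> E) \<le> open_mass (W \<inter> U)" .
    txt \<open>If \<open>g\<close> is a test function for \<open>W \<inter> U\<close> and \<open>h\<close> one for \<open>W - {x. e \<le> g x}\<close>, then
      \<open>max 0 (g - e) + h\<close> is a test function for \<open>W\<close>.\<close>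
    have "open_mass (W \<inter> U) + outer ((UNIV - U) \<inter> E)
        = (SUP g\<in>test (W \<inter> U). ennreal (\<Phi> g) + outer ((UNIV - U) \<inter> E))"
      unfolding open_mass_def using zero_test by (subst ennreal_SUP_add_left) auto
    also have "\<dots> \<le> open_mass W + ennreal e"
    proof (rule SUP_least)
      fix g assume g: "g \<in> test (W \<inter> U)"
      define V where "V = W - {x. e \<le> g x}"
      note lev = test_superlevel[OF g e]
      have gt: "(\<lambda>x. max 0 (g x - e)) \<in> test {x. e < g x}" (is "?g \<in> _")
        and ge: "\<Phi> g \<le> \<Phi> (\<lambda>x. max 0 (g x - e)) + e" by (rule shrink[OF g e])+
      have oV: "open V" using W lev by (auto simp: V_def)
      have "outer ((UNIV - U) \<inter> E) \<le> outer V" using W lev by (intro outer_mono) (auto simp: V_def)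
      also have "\<dots> = open_mass V" by (rule outer_open[OF oV])
      finally have "ennreal (\<Phi> g) + outer ((UNIV - U) \<inter> E) \<le> ennreal (\<Phi> g) + open_mass V"
        by (rule add_left_mono)
      also have "\<dots> = (SUP h\<in>test V. ennreal (\<Phi> g) + ennreal (\<Phi> h))"
        unfolding open_mass_def using zero_test by (subst ennreal_SUP_add_right) auto
      also have "\<dots> \<le> open_mass W + ennreal e"
      proof (rule SUP_least)
        fix h assume h: "h \<in> test V"
        have t: "(\<lambda>x. ?g x + h x) \<in> test W"
        proof (rule testI)
          show "continuous_on UNIV (\<lambda>x. ?g x + h x)"
            by (intro continuous_on_add testD(1)[OF gt] testD(1)[OF h])
          fix x
          have h': "0 \<le> h x" "h x \<le> 1" "x \<notin> V \<Longrightarrow> h x = 0" by (rule testD[OF h])+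
          have g': "0 \<le> ?g x" "?g x \<le> 1" "x \<notin> {x. e < g x} \<Longrightarrow> ?g x = 0"
            by (rule testD[OF gt])+
          show "0 \<le> ?g x + h x" using h' g' by simp
          \<comment> \<open>At most one summand is non-zero: on \<open>V\<close> one has
            \<open>g x < e\<close>, and off \<open>V\<close> the function \<open>h\<close>
            vanishes.\<close>
          show "?g x + h x \<le> 1" using h' g' by (cases "x \<in> V") (auto simp: V_def)
          show "?g x + h x = 0" if "x \<notin> W"
            using that h' g'(3) testD(4)[OF g, of x] e by (auto simp: V_def)
        qed
        have "ennreal (\<Phi> g) + ennreal (\<Phi> h) = ennreal (\<Phi> g + \<Phi> h)"
          using test_bounds(1)[OF g] test_bounds(1)[OF h] by simp
        also have "\<dots> \<le> ennreal (\<Phi> (\<lambda>x. ?g x + h x) + e)"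
          using ge by (subst add[OF testD(1)[OF gt] testD(1)[OF h]]) (auto intro!: ennreal_leI)
        also have "\<dots> \<le> open_mass W + ennreal e"
          using test_bounds(1)[OF t] e open_mass_upper[OF t] by (simp add: add_right_mono)
        finally show "ennreal (\<Phi> g) + ennreal (\<Phi> h) \<le> open_mass W + ennreal e" .
      qed
      finally show "ennreal (\<Phi> g) + outer ((UNIV - U) \<inter> E) \<le> open_mass W + ennreal e" .
    qed
    finally have "open_mass (W \<inter> U) + outer ((UNIV - U) \<inter> E) \<le> open_mass W + ennreal e" .
    with add_right_mono[OF le1]
    show "outer (U \<inter> E) + outer ((UNIV - U) \<inter> E) \<le> open_mass W + ennreal e"
      by (rule order_trans)
  qed
  with sub show "outer (U \<inter> E) + outer ((UNIV - U) \<inter> E) = outer E" by (rule antisym[rotated])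
qed auto

section \<open>The representing measure: regularity and integration\<close>

definition riesz :: "'a measure" where "riesz = measure_of UNIV (sets borel) outer"

lemma sets_riesz [simp, measurable_cong]: "sets riesz = sets borel" and space_riesz [simp]: "space riesz = UNIV"
  using sets.sigma_sets_eq[of borel] by (auto simp: riesz_def)

text \<open>The Caratheodory-measurable sets form a sigma-algebra that contains the open sets, hence
  all Borel sets, and \<open>outer\<close> is countably additive on it.\<close>

lemma emeasure_riesz: assumes "E \<in> sets borel" shows "emeasure riesz E = outer E"
proof (rule emeasure_measure_of[OF riesz_def])
  let ?L = "lambda_system UNIV (Pow UNIV) outer"
  have ms: "measure_space UNIV ?L outer"
    by (rule sigma_algebra.caratheodory_lemma[OF sigma_algebra_Pow outer_measure_space_outer])
  then have sL: "sigma_algebra UNIV ?L" by (simp add: measure_space_def)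
  have "Collect open \<subseteq> ?L" using open_lambda_system by blast
  then have "sigma_sets UNIV (Collect open) \<subseteq> ?L" by (rule sigma_algebra.sigma_sets_subset[OF sL])
  then have "sets borel \<subseteq> ?L"
    by (simp only: borel_def sets_measure_of Pow_UNIV subset_UNIV)
  then show "positive (sets riesz) outer" "countably_additive (sets riesz) outer"
    using ms by (auto simp: measure_space_def positive_def countably_additive_def subset_iff)
qed (use assms in auto)

lemma prob_space_riesz: "prob_space riesz"
  by (rule prob_spaceI) (simp add: emeasure_riesz outer_open open_mass_UNIV)

text \<open>Outer regularity is built into \<open>outer\<close>. Inner regularity follows by
  complements: if an open \<open>U\<close> contains \<open>- A\<close> with little excess, then
  \<open>- U\<close> is a compact subset of \<open>A\<close> with little loss.\<close>

lemma regular_riesz: "regular_on UNIV (emeasure riesz)"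
proof -
  interpret prob_space riesz by (rule prob_space_riesz)
  have out: "emeasure riesz A = (INF U\<in>{U. openin (top_of_set UNIV) U \<and> A \<subseteq> U}. emeasure riesz U)"
    if "A \<in> sets borel" for A
    using that unfolding emeasure_riesz[OF that] outer_def
    by (intro INF_cong) (auto simp: emeasure_riesz outer_open)
  have inn: "emeasure riesz A = (SUP C\<in>{C. compact C \<and> C \<subseteq> A}. emeasure riesz C)"
    if A: "A \<in> sets borel" for A
  proof (rule antisym)
    show "emeasure riesz A \<le> (SUP C\<in>{C. compact C \<and> C \<subseteq> A}. emeasure riesz C)"
    proof (rule ennreal_le_epsilon)
      fix e :: real assume e: "0 < e"
      obtain U where U: "open U" "- A \<subseteq> U" "open_mass U \<le> outer (- A) + ennreal e"
        using outer_approx[OF e] by blast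
      have c: "compact (- U)" using compact_Int_closed[OF compact_UNIV, of "- U"] U by auto
      have mU: "U \<in> sets riesz" "A \<in> sets riesz" using U A by auto
      have "emeasure riesz U \<le> emeasure riesz (- A) + ennreal e"
        using U A by (simp add: emeasure_riesz outer_open)
      then have "ennreal (prob U) \<le> ennreal (prob (- A) + e)"
        using e by (simp add: emeasure_eq_measure ennreal_plus)
      then have "prob U \<le> prob (- A) + e" using e by (subst (asm) ennreal_le_iff) auto
      moreover have "prob (- U) = 1 - prob U" "prob (- A) = 1 - prob A"
        using prob_compl mU by (auto simp: Compl_eq_Diff_UNIV)
      ultimately have "prob A \<le> prob (- U) + e" by simp
      then have "emeasure riesz A \<le> emeasure riesz (- U) + ennreal e"
        using e unfolding emeasure_eq_measure by (intro ennreal_le_plus) simp_all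
      also have "emeasure riesz (- U) \<le> (SUP C\<in>{C. compact C \<and> C \<subseteq> A}. emeasure riesz C)"
        using c U by (intro SUP_upper) auto
      finally show "emeasure riesz A \<le> (SUP C\<in>{C. compact C \<and> C \<subseteq> A}. emeasure riesz C) + ennreal e"
        by (simp add: add_right_mono)
    qed
    show "(SUP C\<in>{C. compact C \<and> C \<subseteq> A}. emeasure riesz C) \<le> emeasure riesz A"
      using A by (intro SUP_least emeasure_mono) auto
  qed
  show ?thesis
    unfolding regular_on_def
  proof (intro ballI conjI)
    fix A assume "A \<in> borel_on (UNIV :: 'a set)"
    then have "A \<in> sets borel" by simp
    then show "emeasure riesz A = (INF U\<in>{U. openin (top_of_set UNIV) U \<and> A \<subseteq> U}. emeasure riesz U)"
      and "emeasure riesz A = (SUP C\<in>{C. compact C \<and> C \<subseteq> A}. emeasure riesz C)"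
      by (rule out, rule inn)
  qed
qed

lemma integrable_continuous:
  fixes g :: "'a \<Rightarrow> 'b::{banach, second_countable_topology}"
  assumes "continuous_on UNIV g" shows "integrable riesz g"
proof -
  interpret prob_space riesz by (rule prob_space_riesz)
  have "compact (range g)" using compact_continuous_image[OF assms compact_UNIV] by simp
  then obtain B where "\<And>x. norm (g x) \<le> B" using compact_imp_bounded bounded_iff by (metis rangeI)
  moreover have "g \<in> borel_measurable riesz"
    using borel_measurable_continuous_onI[OF assms] by (simp add: measurable_cong_sets[OF sets_riesz refl])
  ultimately show ?thesis by (intro integrable_const_bound[of _ B]) auto
qed

text \<open>The layer \<open>l k\<close>, multiplied by \<open>n\<close>, is a test function for the
  open set \<open>V k\<close>, which bounds its value under \<Phi> by the measure of
  \<open>V k\<close>. The resulting step function exceeds \<open>g\<close> by at most 1/n. One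
  inequality is enough, since it can also be applied to \<open>1 - g\<close>.\<close>

lemma state_le_integral:
  assumes g: "continuous_on UNIV g" "\<And>x. 0 \<le> g x" "\<And>x. g x \<le> 1"
  shows "\<Phi> g \<le> integral\<^sup>L riesz g"
proof (rule field_le_epsilon)
  interpret prob_space riesz by (rule prob_space_riesz)
  fix e :: real assume "0 < e"
  then obtain n :: nat where n: "0 < n" "1 / n < e"
    using real_arch_invD[of e] by (auto simp: inverse_eq_divide)
  define l where "l = (\<lambda>k::nat. \<lambda>x. max 0 (min (g x - real k / n) (1 / n)))"
  define V where "V = (\<lambda>k::nat. {x. real k / n < g x})"
  have cl: "continuous_on UNIV (l k)" for k
    unfolding l_def by (intro continuous_intros g(1))
  have oV: "open (V k)" for k unfolding V_def by (intro open_Collect_less continuous_on_const g(1))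
  have le: "\<Phi> (l k) \<le> integral\<^sup>L riesz (\<lambda>x. 1 / n * indicator (V k) x)" for k
  proof -
    have "(\<lambda>x. n * l k x) \<in> test (V k)"
    proof (rule testI)
      show "continuous_on UNIV (\<lambda>x. n * l k x)" by (intro continuous_intros cl)
      show "0 \<le> n * l k x" for x by (simp add: l_def)
      have "l k x \<le> 1 / n" for x by (simp add: l_def)
      then show "n * l k x \<le> 1" for x using n(1) by (simp add: field_simps)
      show "n * l k x = 0" if "x \<notin> V k" for x using that by (simp add: l_def V_def)
    qed
    from open_mass_upper[OF this] have "ennreal (n * \<Phi> (l k)) \<le> emeasure riesz (V k)"
      using cl oV by (simp add: scale emeasure_riesz outer_open)
    then have "n * \<Phi> (l k) \<le> prob (V k)" by (simp add: emeasure_eq_measure)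
    then show ?thesis using n oV by (simp add: field_simps)
  qed
  have "g = (\<lambda>x. \<Sum>k<n. l k x)"
    unfolding l_def using clamp_layers[OF _ _ n(1)] g by auto
  then have "\<Phi> g = (\<Sum>k<n. \<Phi> (l k))" using sum[of "{..<n}" l] cl by simp
  also have "\<dots> \<le> (\<Sum>k<n. integral\<^sup>L riesz (\<lambda>x. 1 / n * indicator (V k) x))"
    by (intro sum_mono le)
  also have "\<dots> = integral\<^sup>L riesz (\<lambda>x. \<Sum>k<n. 1 / n * indicator (V k) x)"
    using oV by (intro Bochner_Integration.integral_sum[symmetric]) (auto simp: less_top[symmetric])
  also have "\<dots> \<le> integral\<^sup>L riesz (\<lambda>x. g x + 1 / n)"
  proof (rule integral_mono)
    show "integrable riesz (\<lambda>x. \<Sum>k<n. 1 / n * indicator (V k) x)"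
      using oV by (intro Bochner_Integration.integrable_sum) (auto simp: less_top[symmetric])
    show "integrable riesz (\<lambda>x. g x + 1 / n)" by (intro integrable_continuous continuous_intros g(1))
    fix x
    \<comment> \<open>If \<open>x\<close> lies in the last set \<open>V m\<close>, then m/n < g x,
      and m + 1 summands of at most 1/n stay below g x + 1/n. Otherwise the last summand is
      0.\<close>
    have "(\<Sum>k<m. 1 / n * indicator (V k) x) \<le> g x + 1 / n" for m
    proof (induction m)
      case 0 then show ?case using g(2)[of x] by simp
    next
      case (Suc m)
      show ?case
      proof (cases "x \<in> V m")
        case True
        have "(\<Sum>k<Suc m. 1 / n * indicator (V k) x) \<le> (\<Sum>k<Suc m. 1 / n :: real)"
          using n by (intro sum_mono) (auto simp: indicator_def)
        also have "\<dots> \<le> g x + 1 / n" using True by (simp add: V_def add_divide_distrib)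
        finally show ?thesis .
      next
        case False then show ?thesis using Suc by simp
      qed
    qed
    then show "(\<Sum>k<n. 1 / n * indicator (V k) x) \<le> g x + 1 / n" .
  qed
  also have "\<dots> = integral\<^sup>L riesz g + 1 / n"
    using g by (subst Bochner_Integration.integral_add) (auto intro: integrable_continuous simp: prob_space[simplified])
  finally show "\<Phi> g \<le> integral\<^sup>L riesz g + e" using n by simp
qed

text \<open>For values in [0, 1] the inequality for \<open>f\<close> and for \<open>1 - f\<close>
  gives equality; an affine change of scale reduces the general case to this one.\<close>

lemma integral_riesz:
  assumes g: "continuous_on UNIV g"
  shows "integral\<^sup>L riesz g = \<Phi> g"
proof -
  interpret prob_space riesz by (rule prob_space_riesz)
  have 01: "integral\<^sup>L riesz f = \<Phi> f" if f: "continuous_on UNIV f" "\<And>x. 0 \<le> f x" "\<And>x. f x \<le> 1" for f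
  proof (rule antisym)
    have "\<Phi> (\<lambda>x. 1 - f x) \<le> integral\<^sup>L riesz (\<lambda>x. 1 - f x)"
      by (intro state_le_integral continuous_intros f(1)) (auto simp: f)
    then show "integral\<^sup>L riesz f \<le> \<Phi> f"
      using integrable_continuous[OF f(1)] prob_space by (simp add: diff[OF continuous_on_const f(1)])
  qed (rule state_le_integral[OF f])
  have "compact (range g)" using compact_continuous_image[OF g compact_UNIV] by simp
  then obtain B where B: "0 < B" "\<And>x. \<bar>g x\<bar> \<le> B"
    using compact_imp_bounded bounded_pos by (metis rangeI real_norm_def)
  define f where "f = (\<lambda>x. (g x + B) / (2 * B))"
  have cf: "continuous_on UNIV f" unfolding f_def using B(1) by (intro continuous_intros g) auto
  have "integral\<^sup>L riesz f = \<Phi> f"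
  proof (rule 01[OF cf])
    fix x show "0 \<le> f x" "f x \<le> 1" using B(1) B(2)[of x] by (auto simp: f_def field_simps abs_le_iff)
  qed
  moreover have "g = (\<lambda>x. 2 * B * f x - B)" using B by (auto simp: f_def fun_eq_iff)
  moreover have "\<Phi> (\<lambda>x. 2 * B * f x - B) = 2 * B * \<Phi> f - B"
    using cf by (subst diff) (auto intro: continuous_on_mult_left simp: scale)
  moreover have "integral\<^sup>L riesz (\<lambda>x. 2 * B * f x - B) = 2 * B * integral\<^sup>L riesz f - B"
    using integrable_continuous[OF cf] prob_space by simp
  ultimately show ?thesis by metis
qed

end

section \<open>Extreme points\<close>

text \<open>Non-empty closed faces for the topology of pointwise convergence, the objects to which
  Zorn's lemma is applied in a Krein-Milman argument.\<close>

definition face :: "('b \<Rightarrow> real) set \<Rightarrow> ('b \<Rightarrow> real) set \<Rightarrow> bool" where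
  "face P F \<longleftrightarrow> F \<subseteq> P \<and> F \<noteq> {} \<and> closed F \<and>
     (\<forall>\<phi>\<in>F. \<forall>a\<in>P. \<forall>b\<in>P. \<forall>t. 0 < t \<longrightarrow> t < 1 \<longrightarrow> (\<forall>x. \<phi> x = t * a x + (1 - t) * b x) \<longrightarrow> a \<in> F \<and> b \<in> F)"

lemma faceD:
  assumes "face P F"
  shows "F \<subseteq> P" "F \<noteq> {}" "closed F"
    and "\<phi> \<in> F \<Longrightarrow> a \<in> P \<Longrightarrow> b \<in> P \<Longrightarrow> 0 < t \<Longrightarrow> t < 1 \<Longrightarrow>
      \<forall>x. \<phi> x = t * a x + (1 - t) * b x \<Longrightarrow> a \<in> F \<and> b \<in> F"
  using assms unfolding face_def by blast+

lemma face_self: "closed P \<Longrightarrow> P \<noteq> {} \<Longrightarrow> face P P"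
  by (auto simp: face_def)

text \<open>A proper convex combination reaches the maximum of an evaluation only if both of its
  ends do. Compactness makes the set of maximisers non-empty.\<close>

lemma face_argmax:
  assumes P: "compact P" and F: "face P F"
  shows "face P {\<phi>\<in>F. \<forall>\<psi>\<in>F. \<psi> g \<le> \<phi> g}"
proof -
  have "compact F" using faceD[OF F] P closed_Int_compact[of F P] by (simp add: inf_absorb1)
  moreover have "continuous_on F (\<lambda>\<phi>. \<phi> g)"
    by (rule continuous_on_subset[OF continuous_on_product_coordinates]) simp
  moreover have "F \<noteq> {}" using faceD[OF F] by simp
  ultimately obtain \<phi> where "\<phi> \<in> F" "\<forall>\<psi>\<in>F. \<psi> g \<le> \<phi> g"
    using continuous_attains_sup by blast
  then have ne: "{\<phi>\<in>F. \<forall>\<psi>\<in>F. \<psi> g \<le> \<phi> g} \<noteq> {}" by blast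
  have "{\<phi>\<in>F. \<forall>\<psi>\<in>F. \<psi> g \<le> \<phi> g} = F \<inter> (\<Inter>\<psi>\<in>F. {\<phi>. \<psi> g \<le> \<phi> g})" by auto
  moreover have "closed (F \<inter> (\<Inter>\<psi>\<in>F. {\<phi>. \<psi> g \<le> \<phi> g}))"
    by (intro closed_Int closed_INT ballI closed_Collect_le continuous_on_const
        continuous_on_product_coordinates faceD[OF F])
  ultimately have cl: "closed {\<phi>\<in>F. \<forall>\<psi>\<in>F. \<psi> g \<le> \<phi> g}" by simp
  have "a \<in> {\<phi>\<in>F. \<forall>\<psi>\<in>F. \<psi> g \<le> \<phi> g} \<and> b \<in> {\<phi>\<in>F. \<forall>\<psi>\<in>F. \<psi> g \<le> \<phi> g}"
    if \<phi>: "\<phi> \<in> F" "\<forall>\<psi>\<in>F. \<psi> g \<le> \<phi> g" and ab: "a \<in> P" "b \<in> P" "0 < t" "t < 1"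
      and eq: "\<forall>x. \<phi> x = t * a x + (1 - t) * b x" for \<phi> a b t
  proof -
    have abF: "a \<in> F" "b \<in> F" using faceD(4)[OF F \<phi>(1) ab eq] by simp_all
    then have le: "a g \<le> \<phi> g" "b g \<le> \<phi> g" using \<phi> by auto
    have e: "t * (\<phi> g - a g) + (1 - t) * (\<phi> g - b g) = 0"
      using spec[OF eq, of g] by (simp add: algebra_simps)
    have "0 \<le> t * (\<phi> g - a g)" "0 \<le> (1 - t) * (\<phi> g - b g)" using le ab by auto
    with e have "t * (\<phi> g - a g) = 0" "(1 - t) * (\<phi> g - b g) = 0" by linarith+
    then have "a g = \<phi> g" "b g = \<phi> g" using ab by auto
    with abF \<phi> show ?thesis by auto
  qed
  with ne cl F show ?thesis unfolding face_def by blast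
qed

text \<open>A finite subchain contains its own intersection, which is therefore a face and
  non-empty; the finite intersection property of the compact set \<open>P\<close> does the
  rest.\<close>

lemma face_chain:
  assumes P: "compact P" and C: "C \<noteq> {}" "\<And>F. F \<in> C \<Longrightarrow> face P F"
    and chain: "\<And>F G. F \<in> C \<Longrightarrow> G \<in> C \<Longrightarrow> F \<subseteq> G \<or> G \<subseteq> F"
  shows "face P (\<Inter>C)"
proof -
  have fin: "\<Inter>D \<noteq> {}" if D: "finite D" "D \<noteq> {}" "D \<subseteq> C" for D
  proof -
    from D have "\<Inter>D \<in> D"
    proof (induction rule: finite_ne_induct)
      case (insert F D)
      then have "F \<subseteq> \<Inter>D \<or> \<Inter>D \<subseteq> F" using chain[of F "\<Inter>D"] by auto
      then have "F \<inter> \<Inter>D = F \<or> F \<inter> \<Inter>D = \<Inter>D" by blast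
      with insert show ?case by auto
    qed simp
    then have "face P (\<Inter>D)" using D(3) C(2) by blast
    then show ?thesis by (rule faceD)
  qed
  have "P \<inter> \<Inter>C \<noteq> {}"
  proof (rule compact_imp_fip[OF P])
    show "closed F" if "F \<in> C" for F using C(2)[OF that] by (rule faceD)
    show "P \<inter> \<Inter>D \<noteq> {}" if "finite D" "D \<subseteq> C" for D
    proof (cases "D = {}")
      case True
      obtain F where "F \<in> C" using C(1) by blast
      with True faceD(1,2)[OF C(2)] show ?thesis by auto
    next
      case False
      then obtain F where F: "F \<in> D" by blast
      then have "F \<subseteq> P" using that(2) faceD(1)[OF C(2)] by blast
      with F have "\<Inter>D \<subseteq> P" by blast
      with fin[OF that(1) False that(2)] show ?thesis by blast
    qed
  qed
  then have "\<Inter>C \<noteq> {}" by blast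
  moreover obtain F where "F \<in> C" using C by blast
  then have "\<Inter>C \<subseteq> P" using faceD(1)[OF C(2)] by blast
  moreover have "closed (\<Inter>C)" by (intro closed_Inter ballI faceD(3)[OF C(2)])
  moreover have "a \<in> \<Inter>C \<and> b \<in> \<Inter>C"
    if "\<phi> \<in> \<Inter>C" "a \<in> P" "b \<in> P" "0 < t" "t < 1" "\<forall>x. \<phi> x = t * a x + (1 - t) * b x" for \<phi> a b t
  proof -
    have "a \<in> F \<and> b \<in> F" if "F \<in> C" for F
      using faceD(4)[OF C(2)[OF that]] that \<open>\<phi> \<in> \<Inter>C\<close> \<open>a \<in> P\<close> \<open>b \<in> P\<close> \<open>0 < t\<close> \<open>t < 1\<close>
        \<open>\<forall>x. \<phi> x = t * a x + (1 - t) * b x\<close> by blast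
    then show ?thesis by blast
  qed
  ultimately show ?thesis unfolding face_def by blast
qed

text \<open>Bauer's maximum principle for an evaluation. Zorn's lemma gives a minimal face among the
  maximisers; cutting it down with \<open>face_argmax\<close> at any coordinate cannot make it
  smaller, so every coordinate is constant on it and it is a single point. The last conclusion,
  stated for \<open>a\<close>, yields the same for \<open>b\<close> on exchanging \<open>t\<close>
  and \<open>1 - t\<close>.\<close>

lemma extreme_maximiser:
  fixes P :: "('b \<Rightarrow> real) set"
  assumes P: "compact P" "closed P" "P \<noteq> {}"
  obtains \<phi> where "\<phi> \<in> P" "\<forall>\<psi>\<in>P. \<psi> g \<le> \<phi> g"
    "\<forall>a\<in>P. \<forall>b\<in>P. \<forall>t. 0 < t \<longrightarrow> t < 1 \<longrightarrow> (\<forall>x. \<phi> x = t * a x + (1 - t) * b x) \<longrightarrow> a = \<phi>"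
proof -
  define F0 where "F0 = {\<phi>\<in>P. \<forall>\<psi>\<in>P. \<psi> g \<le> \<phi> g}"
  have F0: "face P F0" unfolding F0_def by (rule face_argmax[OF P(1) face_self[OF P(2,3)]])
  define \<A> where "\<A> = {F. face P F \<and> F \<subseteq> F0}"
  have "\<exists>M\<in>\<A>. \<forall>F\<in>\<A>. M \<supseteq> F \<longrightarrow> F = M"
  proof (rule predicate_Zorn)
    show "partial_order_on \<A> (relation_of (\<supseteq>) \<A>)"
      by (rule partial_order_on_relation_ofI) auto
    fix C assume C: "C \<in> Chains (relation_of (\<supseteq>) \<A>)"
    show "\<exists>u\<in>\<A>. \<forall>a\<in>C. a \<supseteq> u"
    proof (cases "C = {}")
      case True with F0 show ?thesis by (auto simp: \<A>_def)
    next
      case False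
      have "face P (\<Inter>C)"
        using C False by (intro face_chain[OF P(1)]) (auto simp: Chains_def relation_of_def \<A>_def)
      moreover obtain F where "F \<in> C" "F \<subseteq> F0"
        using C False by (auto simp: Chains_def relation_of_def \<A>_def)
      then have "\<Inter>C \<subseteq> F0" by blast
      ultimately show ?thesis by (intro bexI[of _ "\<Inter>C"]) (auto simp: \<A>_def)
    qed
  qed
  then obtain M where M: "face P M" "M \<subseteq> F0" and min: "\<And>F. face P F \<Longrightarrow> F \<subseteq> M \<Longrightarrow> F = M"
    by (auto simp: \<A>_def)
  have single: "\<phi> = \<psi>" if "\<phi> \<in> M" "\<psi> \<in> M" for \<phi> \<psi>
  proof
    fix h
    have "{\<phi>\<in>M. \<forall>\<psi>\<in>M. \<psi> h \<le> \<phi> h} = M" using min face_argmax[OF P(1) M(1)] by auto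
    with that have "\<phi> \<in> {\<phi>\<in>M. \<forall>\<psi>\<in>M. \<psi> h \<le> \<phi> h}" "\<psi> \<in> {\<phi>\<in>M. \<forall>\<psi>\<in>M. \<psi> h \<le> \<phi> h}"
      by simp_all
    with that have "\<psi> h \<le> \<phi> h" "\<phi> h \<le> \<psi> h" by simp_all
    then show "\<phi> h = \<psi> h" by simp
  qed
  obtain \<phi> where \<phi>: "\<phi> \<in> M" using faceD(2)[OF M(1)] by blast
  show ?thesis
  proof (rule that)
    show "\<phi> \<in> P" "\<forall>\<psi>\<in>P. \<psi> g \<le> \<phi> g" using \<phi> M(2) unfolding F0_def by blast+
    show "\<forall>a\<in>P. \<forall>b\<in>P. \<forall>t. 0 < t \<longrightarrow> t < 1 \<longrightarrow> (\<forall>x. \<phi> x = t * a x + (1 - t) * b x) \<longrightarrow> a = \<phi>"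
      using faceD(4)[OF M(1) \<phi>] single \<phi> by blast
  qed
qed

section \<open>Complex measures\<close>

text \<open>
  If \<open>r\<close> is unbounded on the subsets of \<open>E\<close>, one can split off from \<open>E\<close> a set with \<open>\<bar>r\<bar> \<ge> 1\<close> such that
  \<open>r\<close> is still unbounded on the subsets of the rest. Repeating this gives disjoint sets on
  which \<open>r\<close> does not tend to \<open>0\<close>.
\<close>

lemma countably_additive_bounded:
  fixes r :: "'a set \<Rightarrow> real"
  assumes "sigma_algebra \<Omega> \<M>"
    and ca: "\<And>A :: nat \<Rightarrow> 'a set. range A \<subseteq> \<M> \<Longrightarrow> disjoint_family A \<Longrightarrow> (\<lambda>n. r (A n)) sums r (\<Union>n. A n)"
  shows "\<exists>B. \<forall>A\<in>\<M>. \<bar>r A\<bar> \<le> B"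
proof (rule ccontr)
  interpret sigma_algebra \<Omega> \<M> by fact
  have empty: "r {} = 0"
  proof -
    have "(\<lambda>n::nat. r {}) sums r {}" using ca[of "\<lambda>_. {}"] by (auto simp: disjoint_family_on_def)
    then show ?thesis using summable_const_iff sums_summable by blast
  qed
  have add: "r (A \<union> B) = r A + r B" if "A \<in> \<M>" "B \<in> \<M>" "A \<inter> B = {}" for A B
  proof -
    have "(\<lambda>n. r (binaryset A B n)) sums r (\<Union>n. binaryset A B n)"
      using that by (intro ca) (auto simp: binaryset_def disjoint_family_on_def)
    moreover have "(\<lambda>n. r (binaryset A B n)) sums (\<Sum>n<2. r (binaryset A B n))"
      by (rule sums_finite) (auto simp: binaryset_def empty)
    ultimately show ?thesis
      using sums_unique2[of "\<lambda>n. r (binaryset A B n)"]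
      by (simp add: UN_binaryset_eq numeral_2_eq_2 binaryset_def)
  qed
  define bad where "bad E \<longleftrightarrow> E \<in> \<M> \<and> (\<forall>c. \<exists>A\<in>\<M>. A \<subseteq> E \<and> c < \<bar>r A\<bar>)" for E
  assume "\<not> (\<exists>B. \<forall>A\<in>\<M>. \<bar>r A\<bar> \<le> B)"
  then have bad0: "bad \<Omega>" unfolding bad_def using sets_into_space by (meson not_le top)
  have step: "\<exists>F. bad F \<and> F \<subseteq> E \<and> 1 \<le> \<bar>r (E - F)\<bar>" if E: "bad E" for E
  proof -
    \<comment> \<open>Exceeding |r E| by more than 1 forces the complement \<open>E - A\<close> to
      have |r| at least 1 too, so whichever of the two parts is bad may be kept.\<close>
    obtain A where A: "A \<in> \<M>" "A \<subseteq> E" "1 + \<bar>r E\<bar> < \<bar>r A\<bar>" using E by (auto simp: bad_def)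
    have EM: "E \<in> \<M>" "E - A \<in> \<M>" using E A by (auto simp: bad_def)
    have "r E = r A + r (E - A)" using add[of A "E - A"] A EM by (simp add: Un_absorb1)
    then have ge: "1 \<le> \<bar>r A\<bar>" "1 \<le> \<bar>r (E - A)\<bar>" using A by auto
    have "bad A \<or> bad (E - A)"
    proof (rule ccontr)
      assume "\<not> (bad A \<or> bad (E - A))"
      then obtain c d where c: "\<And>B. B \<in> \<M> \<Longrightarrow> B \<subseteq> A \<Longrightarrow> \<bar>r B\<bar> \<le> c"
        and d: "\<And>B. B \<in> \<M> \<Longrightarrow> B \<subseteq> E - A \<Longrightarrow> \<bar>r B\<bar> \<le> d"
        using A EM unfolding bad_def by (meson not_le)
      obtain B where B: "B \<in> \<M>" "B \<subseteq> E" "c + d < \<bar>r B\<bar>" using E by (auto simp: bad_def)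
      have "r B = r (B \<inter> A) + r (B - A)"
        using add[OF Int[OF B(1) A(1)] Diff[OF B(1) A(1)]] by (simp add: Int_Diff_Un Int_Diff_disjoint)
      moreover have "\<bar>r (B \<inter> A)\<bar> \<le> c" "\<bar>r (B - A)\<bar> \<le> d" using A B by (intro c d; auto)+
      ultimately show False using B by linarith
    qed
    then show ?thesis
    proof
      assume "bad A" then show ?thesis using ge A by blast
    next
      assume "bad (E - A)" moreover have "E - (E - A) = A" using A by blast
      ultimately show ?thesis using ge by (intro exI[of _ "E - A"]) auto
    qed
  qed
  obtain F where F: "\<And>n::nat. bad (F n)" "\<And>n. F (Suc n) \<subseteq> F n" "\<And>n. 1 \<le> \<bar>r (F n - F (Suc n))\<bar>"
    using dependent_nat_choice[of "\<lambda>n E. bad E" "\<lambda>n E G. G \<subseteq> E \<and> 1 \<le> \<bar>r (E - G)\<bar>"] bad0 step by metis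
  have dec: "F m \<subseteq> F n" if "n \<le> m" for m n using that F(2) by (rule lift_Suc_antimono_le[rotated])
  have "disjoint_family (\<lambda>n. F n - F (Suc n))"
    unfolding disjoint_family_on_def
  proof (intro ballI impI)
    fix m n :: nat assume "m \<noteq> n"
    then have "Suc m \<le> n \<or> Suc n \<le> m" by auto
    then show "(F m - F (Suc m)) \<inter> (F n - F (Suc n)) = {}" using dec by blast
  qed
  then have "(\<lambda>n. r (F n - F (Suc n))) sums r (\<Union>n. F n - F (Suc n))"
    using F by (intro ca) (auto simp: bad_def)
  then have "(\<lambda>n. r (F n - F (Suc n))) \<longlonglongrightarrow> 0" using sums_summable summable_LIMSEQ_zero by blast
  then obtain n where "\<bar>r (F n - F (Suc n))\<bar> < 1"
    using LIMSEQ_D[of _ 0 1] by fastforce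
  with F(3)[of n] show False by simp
qed

text \<open>\<open>measure_of\<close> either takes the values of the given supremum or is constantly
  0; in both cases the total mass is bounded by \<open>B\<close>.\<close>

lemma finite_measure_jordan_pos:
  assumes "\<And>A. A \<in> borel_on L \<Longrightarrow> r A \<le> B"
  shows "finite_measure (jordan_pos L r)" "space (jordan_pos L r) = L"
proof -
  have sub: "borel_on L \<subseteq> Pow L" using sets.space_closed[of "restrict_space borel L"] by (simp add: space_restrict_space)
  then show sp: "space (jordan_pos L r) = L" by (simp add: jordan_pos_def)
  have "emeasure (jordan_pos L r) L \<le> ennreal B"
    unfolding jordan_pos_def emeasure_measure_of_conv
    using assms by (auto intro!: SUP_least ennreal_leI)
  then show "finite_measure (jordan_pos L r)"
    by (intro finite_measureI) (metis sp ennreal_less_top infinity_ennreal_def leD top.not_eq_extremum)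
qed

lemma (in finite_measure) norm_integral_le:
  fixes g :: "'a \<Rightarrow> 'b::{banach, second_countable_topology}"
  assumes "\<And>x. x \<in> space M \<Longrightarrow> norm (g x) \<le> d" "0 \<le> d"
  shows "norm (integral\<^sup>L M g) \<le> d * measure M (space M)"
proof (cases "integrable M g")
  case True
  have "norm (integral\<^sup>L M g) \<le> integral\<^sup>L M (\<lambda>x. norm (g x))" by (rule integral_norm_bound)
  also have "\<dots> \<le> integral\<^sup>L M (\<lambda>_. d)" using True assms by (intro integral_mono) auto
  finally show ?thesis by (simp add: mult.commute)
next
  \<comment> \<open>A non-integrable function has integral 0 by default, so the bound holds for
    arbitrary \<open>g\<close>.\<close>
  case False then show ?thesis using assms by (simp add: not_integrable_integral_eq)
qed

text \<open>The real and imaginary parts of a countably additive complex set function are bounded,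
  so the four Jordan parts are finite measures; \<open>C\<close> is the sum of their masses. This is
  the continuity that makes norm convergence on \<open>L\<close> imply weak convergence.\<close>

lemma cintegral_bound:
  assumes "complex_regular_measure L \<nu>"
  obtains C where "0 \<le> C" "\<And>g d. 0 \<le> d \<Longrightarrow> (\<And>x. x \<in> L \<Longrightarrow> norm (g x) \<le> d) \<Longrightarrow> norm (cintegral L \<nu> g) \<le> C * d"
proof -
  have sa: "sigma_algebra L (borel_on L)"
    using sets.sigma_algebra_axioms[of "restrict_space borel L"] by (simp add: space_restrict_space)
  have ca: "(\<lambda>n. \<nu> (A n)) sums \<nu> (\<Union>n. A n)" if "range A \<subseteq> borel_on L" "disjoint_family A" for A :: "nat \<Rightarrow> 'a set"
    using assms that by (auto simp: complex_regular_measure_def)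
  obtain R where R: "\<And>A. A \<in> borel_on L \<Longrightarrow> \<bar>Re (\<nu> A)\<bar> \<le> R"
    using countably_additive_bounded[OF sa, of "\<lambda>A. Re (\<nu> A)"] sums_Re[OF ca] by auto
  obtain I where I: "\<And>A. A \<in> borel_on L \<Longrightarrow> \<bar>Im (\<nu> A)\<bar> \<le> I"
    using countably_additive_bounded[OF sa, of "\<lambda>A. Im (\<nu> A)"] sums_Im[OF ca] by auto
  have rs: "\<And>A. A \<in> borel_on L \<Longrightarrow> Re (\<nu> A) \<le> R" "\<And>A. A \<in> borel_on L \<Longrightarrow> - Re (\<nu> A) \<le> R"
    "\<And>A. A \<in> borel_on L \<Longrightarrow> Im (\<nu> A) \<le> I" "\<And>A. A \<in> borel_on L \<Longrightarrow> - Im (\<nu> A) \<le> I"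
    using R I by (auto simp: abs_le_iff)
  let ?m = "\<lambda>r. measure (jordan_pos L r) L"
  have b: "norm (integral\<^sup>L (jordan_pos L r) g) \<le> d * ?m r"
    if "\<And>A. A \<in> borel_on L \<Longrightarrow> r A \<le> B" "0 \<le> d" "\<And>x. x \<in> L \<Longrightarrow> norm (g x) \<le> d" for r B d and g :: "'a \<Rightarrow> complex"
  proof -
    have sp: "space (jordan_pos L r) = L" by (rule finite_measure_jordan_pos(2)[OF that(1)])
    interpret finite_measure "jordan_pos L r" by (rule finite_measure_jordan_pos(1)[OF that(1)])
    show ?thesis using norm_integral_le[of g d] that sp by simp
  qed
  show ?thesis
  proof (rule that)
    show "0 \<le> ?m (\<lambda>A. Re (\<nu> A)) + ?m (\<lambda>A. - Re (\<nu> A)) + ?m (\<lambda>A. Im (\<nu> A)) + ?m (\<lambda>A. - Im (\<nu> A))" by simp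
    fix g :: "'a \<Rightarrow> complex" and d :: real assume d: "0 \<le> d" and g: "\<And>x. x \<in> L \<Longrightarrow> norm (g x) \<le> d"
    have "norm (cintegral L \<nu> g) \<le> norm (integral\<^sup>L (jordan_pos L (\<lambda>A. Re (\<nu> A))) g) + norm (integral\<^sup>L (jordan_pos L (\<lambda>A. - Re (\<nu> A))) g)
       + (norm (integral\<^sup>L (jordan_pos L (\<lambda>A. Im (\<nu> A))) g) + norm (integral\<^sup>L (jordan_pos L (\<lambda>A. - Im (\<nu> A))) g))"
      unfolding cintegral_def
      by (intro norm_triangle_le add_mono norm_triangle_ineq4) (simp add: norm_mult norm_triangle_ineq4)
    also have "\<dots> \<le> d * ?m (\<lambda>A. Re (\<nu> A)) + d * ?m (\<lambda>A. - Re (\<nu> A)) + (d * ?m (\<lambda>A. Im (\<nu> A)) + d * ?m (\<lambda>A. - Im (\<nu> A)))"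
      by (intro add_mono b[OF rs(1) d g] b[OF rs(2) d g] b[OF rs(3) d g] b[OF rs(4) d g])
    finally show "norm (cintegral L \<nu> g) \<le> (?m (\<lambda>A. Re (\<nu> A)) + ?m (\<lambda>A. - Re (\<nu> A)) + ?m (\<lambda>A. Im (\<nu> A)) + ?m (\<lambda>A. - Im (\<nu> A))) * d"
      by (simp add: algebra_simps)
  qed
qed

section \<open>Regular measures restricted to the support of an ideal\<close>

lemma bcontfun_compact:
  fixes f :: "'a::topological_space \<Rightarrow> 'b::real_normed_vector"
  assumes "compact (UNIV :: 'a set)" "continuous_on UNIV f"
  shows "f \<in> bcontfun"
  using compact_imp_bounded[OF compact_continuous_image[OF assms(2,1)]] assms(2) by (simp add: bcontfun_def)

lemma regular_onD:
  assumes "regular_on L m" "A \<in> borel_on L"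
  shows "m A = (INF U\<in>{U. openin (top_of_set L) U \<and> A \<subseteq> U}. m U)"
    and "m A = (SUP C\<in>{C. compact C \<and> C \<subseteq> A}. m C)"
  using assms unfolding regular_on_def by blast+

lemma total_variation_measure:
  assumes N: "finite_measure N" "sets N = borel_on L" and A: "A \<in> sets N"
  shows "total_variation L (\<lambda>A. complex_of_real (measure N A)) A = emeasure N A"
proof -
  interpret finite_measure N by fact
  let ?P = "{P. finite P \<and> disjoint P \<and> P \<subseteq> borel_on L \<and> \<Union>P = A}"
  have "(\<Sum>B\<in>P. ennreal (norm (complex_of_real (measure N B)))) = emeasure N A" if P: "P \<in> ?P" for P
  proof -
    have "(\<Sum>B\<in>P. ennreal (norm (complex_of_real (measure N B)))) = (\<Sum>B\<in>P. emeasure N B)"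
      by (simp add: emeasure_eq_measure)
    also have "\<dots> = emeasure N (\<Union>B\<in>P. B)"
      using P N(2) by (intro sum_emeasure) (auto simp: disjoint_def disjoint_family_on_def)
    finally show ?thesis using P by simp
  qed
  moreover have "{A} \<in> ?P" using A N(2) by simp
  then have "?P \<noteq> {}" by blast
  ultimately show ?thesis unfolding total_variation_def by (metis (no_types, lifting) SUP_eq_const)
qed

text \<open>This turns an invariant measure on \<open>K\<close> into an element of C(L)' against
  which weak convergence can be tested. Regularity passes to \<open>L\<close> because relatively
  open sets are traces of open sets and compactness does not depend on the ambient space.\<close>

lemma complex_regular_measure_restrict:
  fixes M :: "'a::t2_space measure"
  assumes M: "finite_measure M" "sets M = sets borel" "regular_on UNIV (emeasure M)" and L: "L \<in> sets borel"
  shows "complex_regular_measure L (\<lambda>A. complex_of_real (measure (restrict_space M L) A))"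
proof -
  interpret M: finite_measure M by fact
  let ?N = "restrict_space M L"
  have sp: "space M = UNIV" using sets_eq_imp_space_eq[OF M(2)] by simp
  have LM: "L \<inter> space M \<in> sets M" using L M(2) sp by simp
  have sN: "sets ?N = borel_on L" by (rule sets_restrict_space_cong[OF M(2)])
  have fN: "finite_measure ?N" using L M(2) by (intro finite_measure_restrict_space M) auto
  interpret N: finite_measure ?N by (rule fN)
  have sub: "A \<subseteq> L" "A \<in> sets borel" if "A \<in> borel_on L" for A
    using that L by (auto simp: sets_restrict_space)
  have tv: "total_variation L (\<lambda>A. complex_of_real (measure ?N A)) A = emeasure M A" if "A \<in> borel_on L" for A
  proof -
    have "total_variation L (\<lambda>A. complex_of_real (measure ?N A)) A = emeasure ?N A"
      by (rule total_variation_measure[OF fN sN]) (use that sN in simp)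
    also have "\<dots> = emeasure M A" using sub[OF that] LM by (intro emeasure_restrict_space) auto
    finally show ?thesis .
  qed
  have bL: "A \<in> borel_on L" if "A \<in> sets borel" "A \<subseteq> L" for A
    using that by (auto simp: sets_restrict_space)
  have out: "emeasure M A = (INF U\<in>{U. openin (top_of_set L) U \<and> A \<subseteq> U}.
      total_variation L (\<lambda>A. complex_of_real (measure ?N A)) U)" (is "_ = ?I") if A: "A \<in> borel_on L" for A
  proof (rule antisym)
    show "emeasure M A \<le> ?I"
    proof (rule INF_greatest)
      fix U assume U: "U \<in> {U. openin (top_of_set L) U \<and> A \<subseteq> U}"
      then obtain V where V: "open V" "U = L \<inter> V" by (auto simp: openin_open)
      then have "U \<in> sets borel" using L by auto
      then show "emeasure M A \<le> total_variation L (\<lambda>A. complex_of_real (measure ?N A)) U"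
        using U V by (subst tv[OF bL]) (auto intro: emeasure_mono simp: M(2))
    qed
    have "?I \<le> emeasure M U" if U: "open U" "A \<subseteq> U" for U
    proof -
      have "?I \<le> total_variation L (\<lambda>A. complex_of_real (measure ?N A)) (L \<inter> U)"
        using U sub[OF A] by (intro INF_lower) auto
      also have "\<dots> = emeasure M (L \<inter> U)" using U L by (intro tv bL) auto
      also have "\<dots> \<le> emeasure M U" using U M(2) by (intro emeasure_mono) auto
      finally show ?thesis .
    qed
    then have "?I \<le> (INF U\<in>{U. openin (top_of_set UNIV) U \<and> A \<subseteq> U}. emeasure M U)"
      by (intro INF_greatest) simp
    also have "\<dots> = emeasure M A" using sub[OF A] by (intro regular_onD(1)[OF M(3), symmetric]) simp
    finally show "?I \<le> emeasure M A" .
  qed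
  have inn: "emeasure M A = (SUP C\<in>{C. compact C \<and> C \<subseteq> A}.
      total_variation L (\<lambda>A. complex_of_real (measure ?N A)) C)" if A: "A \<in> borel_on L" for A
  proof -
    have "emeasure M A = (SUP C\<in>{C. compact C \<and> C \<subseteq> A}. emeasure M C)"
      using sub[OF A] by (intro regular_onD(2)[OF M(3)]) simp
    also have "\<dots> = (SUP C\<in>{C. compact C \<and> C \<subseteq> A}. total_variation L (\<lambda>A. complex_of_real (measure ?N A)) C)"
      using sub(1)[OF A] by (intro SUP_cong refl tv[symmetric] bL) (auto intro: borel_closed compact_imp_closed)
    finally show ?thesis .
  qed
  show ?thesis
    unfolding complex_regular_measure_def
  proof (intro conjI allI impI)
    fix A :: "nat \<Rightarrow> 'a set" assume "range A \<subseteq> borel_on L \<and> disjoint_family A"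
    then have "(\<lambda>n. measure ?N (A n)) sums measure ?N (\<Union>n. A n)"
      using sN by (intro N.finite_measure_UNION) auto
    then show "(\<lambda>n. complex_of_real (measure ?N (A n))) sums complex_of_real (measure ?N (\<Union>n. A n))"
      by (rule sums_of_real)
  next
    show "regular_on L (total_variation L (\<lambda>A. complex_of_real (measure ?N A)))"
      unfolding regular_on_def
    proof (intro ballI conjI)
      fix A assume A: "A \<in> borel_on L"
      show "total_variation L (\<lambda>A. complex_of_real (measure ?N A)) A = (INF U\<in>{U. openin (top_of_set L) U \<and> A \<subseteq> U}.
          total_variation L (\<lambda>A. complex_of_real (measure ?N A)) U)"
        unfolding tv[OF A] by (rule out[OF A])
      show "total_variation L (\<lambda>A. complex_of_real (measure ?N A)) A = (SUP C\<in>{C. compact C \<and> C \<subseteq> A}.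
          total_variation L (\<lambda>A. complex_of_real (measure ?N A)) C)"
        unfolding tv[OF A] by (rule inn[OF A])
    qed
  qed
qed

text \<open>A compact set disjoint from \<open>L\<close> is dominated by a Urysohn function in the
  vanishing ideal, hence is null; inner regularity extends this to the whole complement of
  \<open>L\<close>.\<close>

lemma null_off_support:
  fixes M :: "'a::t2_space measure"
  assumes K: "compact (UNIV :: 'a set)" and M: "prob_space M" "sets M = sets borel" "regular_on UNIV (emeasure M)"
    and L: "closed L" "vanishing_ideal L \<subseteq> I_mu M"
  shows "AE x in M. x \<in> L"
proof -
  interpret prob_space M by fact
  have sp: "space M = UNIV" using sets_eq_imp_space_eq[OF M(2)] by simp
  have "emeasure M C = 0" if C: "compact C" "C \<subseteq> - L" for C
  proof -
    obtain h :: "'a \<Rightarrow> real" where h: "continuous_on UNIV h" "\<forall>x. 0 \<le> h x \<and> h x \<le> 1"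
      "\<forall>x\<in>C. h x = 1" "\<forall>x\<in>L. h x = 0"
      by (rule urysohn_compact[OF K, of C L]) (use C L in \<open>auto intro: compact_imp_closed\<close>)
    have "continuous_on UNIV (\<lambda>x. complex_of_real (h x))" using h by (intro continuous_intros)
    then have "(\<lambda>x. complex_of_real (h x)) \<in> bcontfun" by (rule bcontfun_compact[OF K])
    then obtain f where f: "\<And>x. apply_bcontfun f x = complex_of_real (h x)" by (metis Bcontfun_inverse)
    have "f \<in> I_mu M" using L h by (auto simp: vanishing_ideal_def f)
    moreover have "apply_bcontfun (cabs f) = (\<lambda>x. complex_of_real (h x))" using h by (simp add: fun_eq_iff f)
    ultimately have int0: "integral\<^sup>L M h = 0" by (simp add: I_mu_def)
    have "h \<in> borel_measurable M" using borel_measurable_continuous_onI[OF h(1)] M(2) by (simp cong: measurable_cong_sets)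
    then have ih: "integrable M h" using h by (intro integrable_const_bound[of _ 1]) auto
    have Cm: "C \<in> sets M" using C M(2) by (auto intro: borel_closed compact_imp_closed)
    have "prob C = integral\<^sup>L M (indicator C)" using Cm by simp
    also have "\<dots> \<le> integral\<^sup>L M h"
      using Cm ih h by (intro integral_mono) (auto simp: indicator_def less_top[symmetric])
    finally have "prob C = 0" using int0 measure_nonneg[of M C] by linarith
    then show ?thesis by (simp add: emeasure_eq_measure)
  qed
  moreover have "emeasure M (- L) = (SUP C\<in>{C. compact C \<and> C \<subseteq> - L}. emeasure M C)"
    using L by (intro regular_onD(2)[OF M(3)]) (simp add: borel_closed)
  moreover have "\<dots> \<le> 0" using calculation(1) by (intro SUP_least) simp
  ultimately have "emeasure M (- L) = 0" by simp
  then show ?thesis using L M(2) sp by (intro AE_I[of _ _ "- L"]) auto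
qed

section \<open>Fixed functions of an extreme invariant state\<close>

text \<open>Like states, these operators act on plain real functions, and only their effect on
  continuous ones is prescribed.\<close>

definition markov_real :: "(('a::topological_space \<Rightarrow> real) \<Rightarrow> 'a \<Rightarrow> real) \<Rightarrow> bool" where
  "markov_real Q \<longleftrightarrow>
     (\<forall>g. continuous_on UNIV g \<longrightarrow> continuous_on UNIV (Q g)) \<and>
     (\<forall>f g. continuous_on UNIV f \<longrightarrow> continuous_on UNIV g \<longrightarrow> Q (\<lambda>x. f x + g x) = (\<lambda>x. Q f x + Q g x)) \<and>
     (\<forall>c g. continuous_on UNIV g \<longrightarrow> Q (\<lambda>x. c * g x) = (\<lambda>x. c * Q g x)) \<and>
     (\<forall>g. continuous_on UNIV g \<longrightarrow> (\<forall>x. 0 \<le> g x) \<longrightarrow> (\<forall>x. 0 \<le> Q g x)) \<and>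
     Q (\<lambda>_. 1) = (\<lambda>_. 1)"

lemma markov_realD:
  assumes "markov_real Q"
  shows "continuous_on UNIV g \<Longrightarrow> continuous_on UNIV (Q g)"
    and "continuous_on UNIV f \<Longrightarrow> continuous_on UNIV g \<Longrightarrow> Q (\<lambda>x. f x + g x) = (\<lambda>x. Q f x + Q g x)"
    and "continuous_on UNIV g \<Longrightarrow> Q (\<lambda>x. c * g x) = (\<lambda>x. c * Q g x)"
    and "continuous_on UNIV g \<Longrightarrow> (\<And>x. 0 \<le> g x) \<Longrightarrow> 0 \<le> Q g x"
    and "Q (\<lambda>_. 1) = (\<lambda>_. 1)"
  using assms unfolding markov_real_def by blast+

lemma markov_real_diff:
  assumes Q: "markov_real Q" and f: "continuous_on UNIV f" and g: "continuous_on UNIV g"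
  shows "Q (\<lambda>x. f x - g x) = (\<lambda>x. Q f x - Q g x)"
proof -
  have "continuous_on UNIV (\<lambda>x. - 1 * g x)" by (intro continuous_intros g)
  from markov_realD(2)[OF Q f this] markov_realD(3)[OF Q g, of "-1"] show ?thesis by simp
qed

lemma markov_real_mono:
  assumes Q: "markov_real Q" and f: "continuous_on UNIV f" and g: "continuous_on UNIV g"
    and le: "\<And>x. f x \<le> g x"
  shows "Q f x \<le> Q g x"
proof -
  have "continuous_on UNIV (\<lambda>x. g x - f x)" by (intro continuous_intros f g)
  from markov_realD(4)[OF Q this, of x] le show ?thesis by (simp add: markov_real_diff[OF Q g f])
qed

lemma markov_real_const: "markov_real Q \<Longrightarrow> Q (\<lambda>_. c) = (\<lambda>_. c)"
  using markov_realD(3)[of Q "\<lambda>_. 1" c] markov_realD(5)[of Q] by simp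

lemma markov_real_abs_le:
  assumes Q: "markov_real Q" and f: "continuous_on UNIV f" and g: "continuous_on UNIV g"
    and le: "\<And>x. \<bar>f x\<bar> \<le> g x"
  shows "\<bar>Q f x\<bar> \<le> Q g x"
proof -
  have c: "continuous_on UNIV (\<lambda>x. - 1 * f x)" by (intro continuous_intros f)
  have "Q f x \<le> Q g x" using le by (intro markov_real_mono[OF Q f g]) (simp add: abs_le_iff)
  moreover have "Q (\<lambda>x. - 1 * f x) x \<le> Q g x"
    using le by (intro markov_real_mono[OF Q c g]) (simp add: abs_le_iff)
  ultimately show ?thesis using markov_realD(3)[OF Q f, of "-1"] by simp
qed

text \<open>
  The left-hand side is \<open>Q ((u - u x) g) x\<close>, which is estimated with \<open>\<bar>t\<bar> \<le> e + t\<^sup>2 / e\<close>. For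
  \<open>u\<close> almost fixed under \<open>Q\<close>, the last factor is small in the mean.
\<close>

lemma multiplicative_defect:
  assumes Q: "markov_real Q" and u: "continuous_on UNIV u" and g: "continuous_on UNIV g"
    and B: "\<And>x. \<bar>g x\<bar> \<le> B" and e: "0 < e"
  shows "\<bar>Q (\<lambda>y. u y * g y) x - u x * Q g x\<bar>
    \<le> B * e + B / e * (Q (\<lambda>y. u y * u y) x - 2 * u x * Q u x + u x * u x)"
proof -
  note c = continuous_on_mult continuous_on_add continuous_on_diff continuous_on_const u g
  have B0: "0 \<le> B" using B[of x] by linarith
  have b: "\<bar>(u y - u x) * g y\<bar> \<le> B * e + B / e * ((u y - u x) * (u y - u x))" for y
  proof -
    define t where "t = \<bar>u y - u x\<bar>"
    have "t \<le> e + t * t / e"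
    proof (cases "t \<le> e")
      case True then show ?thesis using e by (simp add: t_def add_increasing2)
    next
      case False
      then have "t * e \<le> t * t" by (intro mult_left_mono) (auto simp: t_def)
      then have "t \<le> t * t / e" using e by (simp add: field_simps)
      then show ?thesis using e by simp
    qed
    have "\<bar>(u y - u x) * g y\<bar> = t * \<bar>g y\<bar>" by (simp add: t_def abs_mult)
    also have "\<dots> \<le> t * B" using B[of y] by (intro mult_left_mono) (auto simp: t_def)
    also have "\<dots> \<le> (e + t * t / e) * B" using \<open>t \<le> e + t * t / e\<close> B0 by (intro mult_right_mono)
    also have "t * t = (u y - u x) * (u y - u x)" by (simp add: t_def abs_mult_self_eq)
    finally show ?thesis using e by (simp add: field_simps)
  qed
  have "Q (\<lambda>y. u y * g y - u x * g y) = (\<lambda>y. Q (\<lambda>y. u y * g y) y - u x * Q g y)"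
    by (subst markov_real_diff[OF Q]) (simp_all add: markov_realD(3)[OF Q g] c)
  then have eq: "Q (\<lambda>y. (u y - u x) * g y) x = Q (\<lambda>y. u y * g y) x - u x * Q g x"
    by (simp add: left_diff_distrib)
  have "\<bar>Q (\<lambda>y. (u y - u x) * g y) x\<bar> \<le> Q (\<lambda>y. B * e + B / e * ((u y - u x) * (u y - u x))) x"
    by (rule markov_real_abs_le[OF Q _ _ b]) (intro c)+
  \<comment> \<open>Under \<open>Q\<close> the number \<open>u x\<close> is a constant, so expanding
    the square leaves only \<open>Q\<close> of u^2, of \<open>u\<close> and of constants.\<close>
  also have "(\<lambda>y. B * e + B / e * ((u y - u x) * (u y - u x)))
      = (\<lambda>y. (B * e + B / e * (u x * u x)) + B / e * (u y * u y - 2 * u x * u y))"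
    by (simp add: fun_eq_iff algebra_simps)
  also have "Q \<dots> x = (B * e + B / e * (u x * u x)) + B / e * (Q (\<lambda>y. u y * u y) x - 2 * u x * Q u x)"
  proof -
    have "Q (\<lambda>y. (B * e + B / e * (u x * u x)) + B / e * (u y * u y - 2 * u x * u y))
      = (\<lambda>y. Q (\<lambda>_. B * e + B / e * (u x * u x)) y + Q (\<lambda>y. B / e * (u y * u y - 2 * u x * u y)) y)"
      by (intro markov_realD(2)[OF Q] c)
    moreover have "Q (\<lambda>y. B / e * (u y * u y - 2 * u x * u y)) = (\<lambda>y. B / e * Q (\<lambda>y. u y * u y - 2 * u x * u y) y)"
      by (intro markov_realD(3)[OF Q] c)
    moreover have "Q (\<lambda>y. u y * u y - 2 * u x * u y) = (\<lambda>y. Q (\<lambda>y. u y * u y) y - Q (\<lambda>y. 2 * u x * u y) y)"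
      by (intro markov_real_diff[OF Q] c)
    moreover have "Q (\<lambda>y. 2 * u x * u y) = (\<lambda>y. 2 * u x * Q u y)"
      by (intro markov_realD(3)[OF Q] u)
    ultimately show ?thesis by (simp add: markov_real_const[OF Q])
  qed
  finally show ?thesis unfolding eq by (simp add: algebra_simps)
qed

section \<open>Defects of almost fixed functions\<close>

context state begin

lemma bounded_continuous:
  assumes "continuous_on UNIV (g :: 'a \<Rightarrow> real)" obtains B where "0 < B" "\<And>x. \<bar>g x\<bar> \<le> B"
proof -
  have "compact (range g)" using compact_continuous_image[OF assms compact_UNIV] by simp
  then obtain B where "0 < B" "\<forall>y\<in>range g. norm y \<le> B" using compact_imp_bounded bounded_pos by blast
  then show ?thesis using that by auto
qed

lemma abs_le:
  assumes "continuous_on UNIV g" shows "\<bar>\<Phi> g\<bar> \<le> \<Phi> (\<lambda>x. \<bar>g x\<bar>)"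
proof -
  have c: "continuous_on UNIV (\<lambda>x. - 1 * g x)" "continuous_on UNIV (\<lambda>x. \<bar>g x\<bar>)" by (intro continuous_intros assms)+
  have "\<Phi> g \<le> \<Phi> (\<lambda>x. \<bar>g x\<bar>)" by (intro mono assms c) simp
  moreover have "\<Phi> (\<lambda>x. - 1 * g x) \<le> \<Phi> (\<lambda>x. \<bar>g x\<bar>)" by (intro mono c) simp
  ultimately show ?thesis using scale[OF assms, of "-1"] by simp
qed

context
  fixes Q assumes Q: "markov_real Q" and inv: "\<And>g. continuous_on UNIV g \<Longrightarrow> \<Phi> (Q g) = \<Phi> g"
begin

lemmas cQ = markov_realD(1)[OF Q]

text \<open>By positivity, \<open>Q v\<close> lies below \<open>min (Q u) c\<close>. The distance
  from \<open>v\<close> to \<open>min (Q u) c\<close> is at most |u - Q u|, and the remaining gap is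
  non-negative; since \<Phi> (Q v) = \<Phi> v, the mean of that gap is again at most the defect of
  \<open>u\<close>. This explains the factor 2.\<close>

lemma defect_min:
  assumes u: "continuous_on UNIV u"
  shows "\<Phi> (\<lambda>x. \<bar>min (u x) c - Q (\<lambda>y. min (u y) c) x\<bar>) \<le> 2 * \<Phi> (\<lambda>x. \<bar>u x - Q u x\<bar>)"
proof -
  define v where "v = (\<lambda>y. min (u y) c)"
  have v: "continuous_on UNIV v" unfolding v_def by (intro continuous_intros u)
  have m: "continuous_on UNIV (\<lambda>x. min (Q u x) c)" by (intro continuous_intros cQ u)
  have d: "continuous_on UNIV (\<lambda>x. \<bar>u x - Q u x\<bar>)" by (intro continuous_intros cQ u)
  have le: "Q v x \<le> min (Q u x) c" for x
  proof -
    have "Q v x \<le> Q u x" by (rule markov_real_mono[OF Q v u]) (simp add: v_def)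
    moreover have "Q v x \<le> Q (\<lambda>_. c) x" by (rule markov_real_mono[OF Q v]) (simp_all add: v_def)
    ultimately show ?thesis by (simp add: markov_real_const[OF Q])
  qed
  have "\<Phi> (\<lambda>x. \<bar>v x - Q v x\<bar>) \<le> \<Phi> (\<lambda>x. \<bar>u x - Q u x\<bar> + (min (Q u x) c - Q v x))"
  proof (rule mono)
    fix x show "\<bar>v x - Q v x\<bar> \<le> \<bar>u x - Q u x\<bar> + (min (Q u x) c - Q v x)"
      using le[of x] by (auto simp: v_def)
  qed (intro continuous_intros cQ u v)+
  also have "\<dots> = \<Phi> (\<lambda>x. \<bar>u x - Q u x\<bar>) + (\<Phi> (\<lambda>x. min (Q u x) c) - \<Phi> v)"
    using add[OF d continuous_on_diff[OF m cQ[OF v]]] diff[OF m cQ[OF v]] inv[OF v] by simp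
  also have "\<Phi> (\<lambda>x. min (Q u x) c) - \<Phi> v = \<Phi> (\<lambda>x. min (Q u x) c - v x)" by (rule diff[OF m v, symmetric])
  also have "\<dots> \<le> \<Phi> (\<lambda>x. \<bar>u x - Q u x\<bar>)"
    by (rule mono[OF continuous_on_diff[OF m v] d]) (auto simp: v_def)
  finally show ?thesis by (simp add: v_def)
qed

lemma defect_uminus:
  assumes u: "continuous_on UNIV u"
  shows "\<Phi> (\<lambda>x. \<bar>- u x - Q (\<lambda>y. - u y) x\<bar>) = \<Phi> (\<lambda>x. \<bar>u x - Q u x\<bar>)"
proof -
  have "Q (\<lambda>y. - u y) = (\<lambda>y. - Q u y)" using markov_realD(3)[OF Q u, of "-1"] by simp
  then show ?thesis by (simp add: abs_minus_commute)
qed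

text \<open>Cutting from below is cutting \<open>- v\<close> from above, and a change of sign
  preserves the defect, so each of the two cuts costs a factor 2.\<close>

lemma defect_clamp:
  assumes u: "continuous_on UNIV u"
  shows "\<Phi> (\<lambda>x. \<bar>max (- c) (min (u x) c) - Q (\<lambda>y. max (- c) (min (u y) c)) x\<bar>) \<le> 4 * \<Phi> (\<lambda>x. \<bar>u x - Q u x\<bar>)"
proof -
  define v where "v = (\<lambda>y. min (u y) c)"
  have v: "continuous_on UNIV v" unfolding v_def by (intro continuous_intros u)
  have nv: "continuous_on UNIV (\<lambda>x. - v x)" by (intro continuous_intros v)
  have mv: "continuous_on UNIV (\<lambda>x. min (- v x) c)" by (intro continuous_intros v)
  have "(\<lambda>x. max (- c) (min (u x) c)) = (\<lambda>x. - min (- v x) c)" by (auto simp: v_def fun_eq_iff min_def max_def)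
  then have "\<Phi> (\<lambda>x. \<bar>max (- c) (min (u x) c) - Q (\<lambda>y. max (- c) (min (u y) c)) x\<bar>)
     = \<Phi> (\<lambda>x. \<bar>min (- v x) c - Q (\<lambda>y. min (- v y) c) x\<bar>)"
    using defect_uminus[OF mv] by (simp add: fun_eq_iff)
  also have "\<dots> \<le> 2 * \<Phi> (\<lambda>x. \<bar>- v x - Q (\<lambda>y. - v y) x\<bar>)" by (rule defect_min[OF nv])
  also have "\<dots> = 2 * \<Phi> (\<lambda>x. \<bar>v x - Q v x\<bar>)" using defect_uminus[OF v] by simp
  also have "\<dots> \<le> 4 * \<Phi> (\<lambda>x. \<bar>u x - Q u x\<bar>)" using defect_min[OF u, of c] by (simp add: v_def)
  finally show ?thesis .
qed

text \<open>Invariance replaces \<Phi> (u g) by \<Phi> (Q (u g)), which leaves the mean of the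
  multiplicative defect. The parameter \<open>e\<close> stays free: the first term becomes small
  with \<open>e\<close>, the second for fixed \<open>e\<close> with the defect of
  \<open>u\<close>.\<close>

lemma almost_invariant_density:
  assumes u: "continuous_on UNIV u" "\<And>x. \<bar>u x\<bar> \<le> c" and g: "continuous_on UNIV g" "\<And>x. \<bar>g x\<bar> \<le> B" and e: "0 < e"
  shows "\<bar>\<Phi> (\<lambda>x. u x * g x) - \<Phi> (\<lambda>x. u x * Q g x)\<bar> \<le> B * e + 2 * B * c / e * \<Phi> (\<lambda>x. \<bar>u x - Q u x\<bar>)"
proof -
  note c = continuous_on_mult continuous_on_add continuous_on_diff continuous_on_const continuous_on_rabs u(1) g(1) cQ
  have B0: "0 \<le> B" using g(2)[of undefined] by linarith
  have uu: "continuous_on UNIV (\<lambda>y. u y * u y)" by (intro c)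
  have "\<Phi> (\<lambda>x. u x * g x) - \<Phi> (\<lambda>x. u x * Q g x) = \<Phi> (Q (\<lambda>x. u x * g x)) - \<Phi> (\<lambda>x. u x * Q g x)"
    by (subst inv) (intro c | simp)+
  also have "\<dots> = \<Phi> (\<lambda>x. Q (\<lambda>x. u x * g x) x - u x * Q g x)"
    by (intro diff[symmetric] c)
  finally have "\<bar>\<Phi> (\<lambda>x. u x * g x) - \<Phi> (\<lambda>x. u x * Q g x)\<bar> \<le> \<Phi> (\<lambda>x. \<bar>Q (\<lambda>x. u x * g x) x - u x * Q g x\<bar>)"
    using abs_le[of "\<lambda>x. Q (\<lambda>x. u x * g x) x - u x * Q g x"] by (simp add: c)
  also have "\<dots> \<le> \<Phi> (\<lambda>x. B * e + B / e * (Q (\<lambda>y. u y * u y) x - 2 * u x * Q u x + u x * u x))"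
    by (intro mono multiplicative_defect[OF Q u(1) g e] c)
  also have "\<dots> = \<Phi> (\<lambda>_. B * e) + \<Phi> (\<lambda>x. B / e * (Q (\<lambda>y. u y * u y) x - 2 * u x * Q u x + u x * u x))"
    by (intro add c)
  also have "\<Phi> (\<lambda>x. B / e * (Q (\<lambda>y. u y * u y) x - 2 * u x * Q u x + u x * u x))
     = B / e * \<Phi> (\<lambda>x. Q (\<lambda>y. u y * u y) x - 2 * u x * Q u x + u x * u x)"
    by (intro scale c)
  \<comment> \<open>The regrouping isolates Q(u^2) - u^2, whose mean is 0 by invariance; what is
    left is linear in u - Q u.\<close>
  also have "\<Phi> (\<lambda>x. Q (\<lambda>y. u y * u y) x - 2 * u x * Q u x + u x * u x)
     = \<Phi> (\<lambda>x. (Q (\<lambda>y. u y * u y) x - u x * u x) + 2 * (u x * (u x - Q u x)))"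
    by (intro arg_cong[of _ _ \<Phi>]) (simp add: fun_eq_iff algebra_simps)
  also have "\<dots> = \<Phi> (\<lambda>x. Q (\<lambda>y. u y * u y) x - u x * u x) + \<Phi> (\<lambda>x. 2 * (u x * (u x - Q u x)))"
    by (intro add c)
  also have "\<Phi> (\<lambda>x. Q (\<lambda>y. u y * u y) x - u x * u x) = 0"
    using diff[OF cQ[OF uu] uu] inv[OF uu] by simp
  also have "\<Phi> (\<lambda>x. 2 * (u x * (u x - Q u x))) = 2 * \<Phi> (\<lambda>x. u x * (u x - Q u x))"
    by (intro scale c)
  finally have eq: "\<bar>\<Phi> (\<lambda>x. u x * g x) - \<Phi> (\<lambda>x. u x * Q g x)\<bar>
      \<le> B * e + 2 * B / e * \<Phi> (\<lambda>x. u x * (u x - Q u x))"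
    by (simp add: mult.left_commute[of B 2])
  have "\<Phi> (\<lambda>x. u x * (u x - Q u x)) \<le> \<Phi> (\<lambda>x. c * \<bar>u x - Q u x\<bar>)"
  proof (intro mono c)
    fix x
    have "u x * (u x - Q u x) \<le> \<bar>u x\<bar> * \<bar>u x - Q u x\<bar>" by (metis abs_ge_self abs_mult)
    also have "\<dots> \<le> c * \<bar>u x - Q u x\<bar>" by (intro mult_right_mono u) simp
    finally show "u x * (u x - Q u x) \<le> c * \<bar>u x - Q u x\<bar>" .
  qed
  also have "\<Phi> (\<lambda>x. c * \<bar>u x - Q u x\<bar>) = c * \<Phi> (\<lambda>x. \<bar>u x - Q u x\<bar>)" by (intro scale c)
  finally have "2 * B / e * \<Phi> (\<lambda>x. u x * (u x - Q u x)) \<le> 2 * B / e * (c * \<Phi> (\<lambda>x. \<bar>u x - Q u x\<bar>))"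
    using B0 e by (intro mult_left_mono) auto
  with eq show ?thesis by simp
qed

end
end

section \<open>Truncated fixed functions as invariant densities\<close>

definition trunc :: "real \<Rightarrow> real \<Rightarrow> real" where "trunc c t = max (- c) (min t c)"

lemma abs_trunc_le: "0 \<le> c \<Longrightarrow> \<bar>trunc c t\<bar> \<le> c"
  and trunc_lipschitz: "\<bar>trunc c s - trunc c t\<bar> \<le> \<bar>s - t\<bar>"
  and trunc_eq: "\<bar>t\<bar> \<le> c \<Longrightarrow> trunc c t = t"
  by (auto simp: trunc_def min_def max_def)

lemma borel_measurable_trunc [measurable]: "h \<in> borel_measurable M \<Longrightarrow> (\<lambda>x. trunc c (h x)) \<in> borel_measurable M"
  unfolding trunc_def by (intro borel_measurable_max borel_measurable_min borel_measurable_const)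

lemma continuous_on_trunc [continuous_intros]: "continuous_on A h \<Longrightarrow> continuous_on A (\<lambda>x. trunc c (h x))"
  unfolding trunc_def by (intro continuous_intros)

text \<open>For closed \<open>L\<close> these are the invariant probability measures carried by
  \<open>L\<close>, seen as functionals so that the product topology plays the role of the weak*
  topology.\<close>

definition inv_states :: "(('a::t2_space \<Rightarrow> real) \<Rightarrow> 'a \<Rightarrow> real) set \<Rightarrow> 'a set \<Rightarrow> (('a \<Rightarrow> real) \<Rightarrow> real) set" where
  "inv_states \<Q> L = {\<Phi>. state \<Phi> \<and> (\<forall>g. continuous_on UNIV g \<longrightarrow> (\<forall>x\<in>L. g x = 0) \<longrightarrow> \<Phi> g = 0) \<and>
     (\<forall>Q\<in>\<Q>. \<forall>g. continuous_on UNIV g \<longrightarrow> \<Phi> (Q g) = \<Phi> g)}"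

context state begin

lemma borel_measurable_continuous [measurable]: "continuous_on UNIV g \<Longrightarrow> (g :: 'a \<Rightarrow> real) \<in> borel_measurable riesz"
  using borel_measurable_continuous_onI by (simp cong: measurable_cong_sets)

lemma integrable_mult_continuous:
  fixes g k :: "'a \<Rightarrow> real"
  assumes k: "integrable riesz k" and g: "continuous_on UNIV g"
  shows "integrable riesz (\<lambda>x. k x * g x)"
proof -
  obtain B where B: "0 < B" "\<And>x. \<bar>g x\<bar> \<le> B" by (rule bounded_continuous[OF g]) blast
  show ?thesis
  proof (rule Bochner_Integration.integrable_bound)
    show "integrable riesz (\<lambda>x. B * k x)" using k by simp
    show "(\<lambda>x. k x * g x) \<in> borel_measurable riesz"
      using borel_measurable_integrable[OF k] borel_measurable_continuous[OF g] by (rule borel_measurable_times)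
    have "\<bar>k x\<bar> * \<bar>g x\<bar> \<le> \<bar>k x\<bar> * B" for x by (intro mult_left_mono B) simp
    then show "AE x in riesz. norm (k x * g x) \<le> norm (B * k x)" using B(1) by (simp add: abs_mult mult.commute)
  qed
qed

lemma tendsto_integral_mult:
  fixes g k :: "'a \<Rightarrow> real"
  assumes w: "\<And>n. integrable riesz (w n)" and k: "integrable riesz k" and g: "continuous_on UNIV g"
    and conv: "(\<lambda>n. \<integral>x. \<bar>w n x - k x\<bar> \<partial>riesz) \<longlonglongrightarrow> 0"
  shows "(\<lambda>n. \<integral>x. w n x * g x \<partial>riesz) \<longlonglongrightarrow> (\<integral>x. k x * g x \<partial>riesz)"
proof -
  obtain B where B: "0 < B" "\<And>x. \<bar>g x\<bar> \<le> B" by (rule bounded_continuous[OF g]) blast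
  have le: "\<bar>(\<integral>x. w n x * g x \<partial>riesz) - (\<integral>x. k x * g x \<partial>riesz)\<bar> \<le> B * (\<integral>x. \<bar>w n x - k x\<bar> \<partial>riesz)" for n
  proof -
    have d: "integrable riesz (\<lambda>x. w n x - k x)" using w k by simp
    have "(\<integral>x. w n x * g x \<partial>riesz) - (\<integral>x. k x * g x \<partial>riesz) = (\<integral>x. (w n x - k x) * g x \<partial>riesz)"
      by (simp add: left_diff_distrib Bochner_Integration.integral_diff integrable_mult_continuous[OF w g] integrable_mult_continuous[OF k g])
    also have "\<bar>\<dots>\<bar> \<le> (\<integral>x. \<bar>(w n x - k x) * g x\<bar> \<partial>riesz)" by (rule integral_abs_bound)
    also have "\<dots> \<le> (\<integral>x. B * \<bar>w n x - k x\<bar> \<partial>riesz)"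
    proof (rule integral_mono)
      show "integrable riesz (\<lambda>x. \<bar>(w n x - k x) * g x\<bar>)" by (intro integrable_abs integrable_mult_continuous d g)
      show "integrable riesz (\<lambda>x. B * \<bar>w n x - k x\<bar>)" using d by simp
      have "\<bar>w n x - k x\<bar> * \<bar>g x\<bar> \<le> \<bar>w n x - k x\<bar> * B" for x by (intro mult_left_mono B) simp
      then show "\<bar>(w n x - k x) * g x\<bar> \<le> B * \<bar>w n x - k x\<bar>" for x by (simp add: abs_mult mult.commute)
    qed
    finally show ?thesis by simp
  qed
  have "(\<lambda>n. (\<integral>x. w n x * g x \<partial>riesz) - (\<integral>x. k x * g x \<partial>riesz)) \<longlonglongrightarrow> 0"
    using le by (intro Lim_null_comparison[OF _ tendsto_mult_right_zero[OF conv, of B]]) (simp add: always_eventually)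
  then show ?thesis by (simp add: LIM_zero_iff)
qed

lemma integrable_bounded:
  fixes h :: "'a \<Rightarrow> real"
  assumes "h \<in> borel_measurable riesz" "\<And>x. \<bar>h x\<bar> \<le> c" shows "integrable riesz h"
proof -
  interpret prob_space riesz by (rule prob_space_riesz)
  show ?thesis using assms by (intro integrable_const_bound[of _ c]) auto
qed

lemma trunc_L1:
  assumes "continuous_on UNIV v" "integrable riesz h"
  shows "(\<integral>x. \<bar>trunc c (v x) - trunc c (h x)\<bar> \<partial>riesz) \<le> (\<integral>x. \<bar>v x - h x\<bar> \<partial>riesz)"
proof -
  have d: "integrable riesz (\<lambda>x. \<bar>v x - h x\<bar>)" using integrable_continuous[OF assms(1)] assms(2) by simp
  have m: "v \<in> borel_measurable riesz" "h \<in> borel_measurable riesz" using assms by auto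
  show ?thesis
  proof (rule integral_mono)
    show "integrable riesz (\<lambda>x. \<bar>trunc c (v x) - trunc c (h x)\<bar>)"
      using m by (intro Bochner_Integration.integrable_bound[OF d]) (auto intro!: trunc_lipschitz)
  qed (auto intro: d trunc_lipschitz)
qed

text \<open>Since \<open>v n\<close> and \<open>Q (v n)\<close> have the same L^1 limit, the defect
  of \<open>v n\<close> tends to 0. Truncation keeps this up to the factor 4 and provides the
  uniform bound \<open>c\<close> that \<open>almost_invariant_density\<close> requires. First
  \<open>n\<close> tends to infinity with \<open>e\<close> fixed, leaving the bound
  \<open>B * e\<close>; then \<open>e\<close> tends to 0.\<close>

lemma density_invariant:
  assumes Q: "markov_real Q" and inv: "\<And>g. continuous_on UNIV g \<Longrightarrow> \<Phi> (Q g) = \<Phi> g"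
    and h: "integrable riesz h" and v: "\<And>n. continuous_on UNIV (v n)"
    and c1: "(\<lambda>n. \<integral>x. \<bar>v n x - h x\<bar> \<partial>riesz) \<longlonglongrightarrow> 0" and c2: "(\<lambda>n. \<integral>x. \<bar>Q (v n) x - h x\<bar> \<partial>riesz) \<longlonglongrightarrow> 0"
    and c: "0 \<le> c" and g: "continuous_on UNIV g"
  shows "(\<integral>x. trunc c (h x) * Q g x \<partial>riesz) = (\<integral>x. trunc c (h x) * g x \<partial>riesz)"
proof -
  obtain B where B: "0 < B" "\<And>x. \<bar>g x\<bar> \<le> B" by (rule bounded_continuous[OF g]) blast
  define w where "w n x = trunc c (v n x)" for n x
  define D where "D u = \<Phi> (\<lambda>x. \<bar>u x - Q u x\<bar>)" for u
  have w: "continuous_on UNIV (w n)" "\<bar>w n x\<bar> \<le> c" for n x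
    unfolding w_def using c by (auto intro!: continuous_intros v abs_trunc_le)
  have Qg: "continuous_on UNIV (Q g)" by (rule markov_realD(1)[OF Q g])
  have Dv: "(\<lambda>n. D (v n)) \<longlonglongrightarrow> 0"
  proof (rule Lim_null_comparison[OF always_eventually])
    show "(\<lambda>n. (\<integral>x. \<bar>v n x - h x\<bar> \<partial>riesz) + (\<integral>x. \<bar>Q (v n) x - h x\<bar> \<partial>riesz)) \<longlonglongrightarrow> 0"
      using tendsto_add[OF c1 c2] by simp
    show "\<forall>n. norm (D (v n)) \<le> (\<integral>x. \<bar>v n x - h x\<bar> \<partial>riesz) + (\<integral>x. \<bar>Q (v n) x - h x\<bar> \<partial>riesz)"
    proof
      fix n
      have Qv: "continuous_on UNIV (Q (v n))" by (rule markov_realD(1)[OF Q v])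
      have cd: "continuous_on UNIV (\<lambda>x. \<bar>v n x - Q (v n) x\<bar>)" by (intro continuous_intros v Qv)
      have i: "integrable riesz (\<lambda>x. \<bar>v n x - h x\<bar>)" "integrable riesz (\<lambda>x. \<bar>Q (v n) x - h x\<bar>)"
        using integrable_continuous[OF v[of n]] integrable_continuous[OF Qv] h by simp_all
      have "D (v n) = (\<integral>x. \<bar>v n x - Q (v n) x\<bar> \<partial>riesz)" unfolding D_def by (rule integral_riesz[OF cd, symmetric])
      also have "\<dots> \<le> (\<integral>x. \<bar>v n x - h x\<bar> + \<bar>Q (v n) x - h x\<bar> \<partial>riesz)"
        using i integrable_continuous[OF cd] by (intro integral_mono) auto
      also have "\<dots> = (\<integral>x. \<bar>v n x - h x\<bar> \<partial>riesz) + (\<integral>x. \<bar>Q (v n) x - h x\<bar> \<partial>riesz)" using i by simp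
      finally show "norm (D (v n)) \<le> (\<integral>x. \<bar>v n x - h x\<bar> \<partial>riesz) + (\<integral>x. \<bar>Q (v n) x - h x\<bar> \<partial>riesz)"
        using nonneg[OF cd] by (simp add: D_def)
    qed
  qed
  have ih: "integrable riesz (\<lambda>x. trunc c (h x))"
    using borel_measurable_integrable[OF h] abs_trunc_le[OF c] by (intro integrable_bounded[of _ c]) auto
  have wh: "(\<lambda>n. \<integral>x. \<bar>w n x - trunc c (h x)\<bar> \<partial>riesz) \<longlonglongrightarrow> 0"
    using trunc_L1[OF v h] by (intro Lim_null_comparison[OF always_eventually c1]) (simp add: w_def)
  note conv = tendsto_integral_mult[OF integrable_continuous[OF w(1)] ih _ wh]
  have lim: "(\<lambda>n. \<bar>(\<integral>x. w n x * g x \<partial>riesz) - (\<integral>x. w n x * Q g x \<partial>riesz)\<bar>)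
      \<longlonglongrightarrow> \<bar>(\<integral>x. trunc c (h x) * g x \<partial>riesz) - (\<integral>x. trunc c (h x) * Q g x \<partial>riesz)\<bar>"
    by (intro tendsto_rabs tendsto_diff conv g Qg)
  have bound: "\<bar>(\<integral>x. trunc c (h x) * g x \<partial>riesz) - (\<integral>x. trunc c (h x) * Q g x \<partial>riesz)\<bar> \<le> B * e" if e: "0 < e" for e
  proof (rule LIMSEQ_le[OF lim])
    show "(\<lambda>n. B * e + 2 * B * c / e * (4 * D (v n))) \<longlonglongrightarrow> B * e"
      using tendsto_add[OF tendsto_const[of "B * e"] tendsto_mult_right_zero[OF Dv, of "2 * B * c / e * 4"]]
      by (simp add: mult.assoc)
    have "\<bar>(\<integral>x. w n x * g x \<partial>riesz) - (\<integral>x. w n x * Q g x \<partial>riesz)\<bar> \<le> B * e + 2 * B * c / e * (4 * D (v n))" for n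
    proof -
      have "(\<integral>x. w n x * g x \<partial>riesz) = \<Phi> (\<lambda>x. w n x * g x)" "(\<integral>x. w n x * Q g x \<partial>riesz) = \<Phi> (\<lambda>x. w n x * Q g x)"
        by (intro integral_riesz continuous_on_mult w g Qg)+
      then have "\<bar>(\<integral>x. w n x * g x \<partial>riesz) - (\<integral>x. w n x * Q g x \<partial>riesz)\<bar> \<le> B * e + 2 * B * c / e * D (w n)"
        using almost_invariant_density[OF Q inv w g B(2) e] by (simp add: D_def)
      also have "\<dots> \<le> B * e + 2 * B * c / e * (4 * D (v n))"
      proof (intro add_left_mono mult_left_mono)
        have "w n = (\<lambda>x. max (- c) (min (v n x) c))" by (simp add: fun_eq_iff w_def trunc_def)
        then show "D (w n) \<le> 4 * D (v n)"
          using defect_clamp[OF Q inv v[of n], of c] by (simp add: D_def)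
      qed (use B(1) e c in auto)
      finally show ?thesis .
    qed
    then show "\<exists>N. \<forall>n\<ge>N. \<bar>(\<integral>x. w n x * g x \<partial>riesz) - (\<integral>x. w n x * Q g x \<partial>riesz)\<bar>
      \<le> B * e + 2 * B * c / e * (4 * D (v n))" by blast
  qed
  have "\<bar>(\<integral>x. trunc c (h x) * g x \<partial>riesz) - (\<integral>x. trunc c (h x) * Q g x \<partial>riesz)\<bar> \<le> 0"
  proof (rule field_le_epsilon)
    fix e :: real assume "0 < e"
    then show "\<bar>(\<integral>x. trunc c (h x) * g x \<partial>riesz) - (\<integral>x. trunc c (h x) * Q g x \<partial>riesz)\<bar> \<le> 0 + e"
      using bound[of "e / B"] B(1) by simp
  qed
  then show ?thesis by simp
qed

text \<open>A density between 0 and 1 keeps the functional dominated by \<Phi> |g| up to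
  normalisation, so it still vanishes on functions that are 0 on \<open>L\<close>.\<close>

lemma weighted_state:
  assumes \<Phi>: "\<Phi> \<in> inv_states \<Q> L" and \<Q>: "\<And>Q. Q \<in> \<Q> \<Longrightarrow> markov_real Q"
    and k: "k \<in> borel_measurable riesz" "\<And>x. 0 \<le> k x" "\<And>x. k x \<le> 1" and pos: "0 < integral\<^sup>L riesz k"
    and inv: "\<And>Q g. Q \<in> \<Q> \<Longrightarrow> continuous_on UNIV g \<Longrightarrow> (\<integral>x. k x * Q g x \<partial>riesz) = (\<integral>x. k x * g x \<partial>riesz)"
  shows "(\<lambda>g. if continuous_on UNIV g then (\<integral>x. k x * g x \<partial>riesz) / integral\<^sup>L riesz k else 0) \<in> inv_states \<Q> L"
    (is "?a \<in> _")
proof -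
  have ik: "integrable riesz k" using k by (intro integrable_bounded[of _ 1]) auto
  note i = integrable_mult_continuous[OF ik]
  have "state ?a"
  proof
    show "?a (\<lambda>x. f x + g x) = ?a f + ?a g" if "continuous_on UNIV f" "continuous_on UNIV g" for f g
      using that i by (simp add: distrib_left add_divide_distrib continuous_on_add)
    show "?a (\<lambda>x. c * g x) = c * ?a g" if "continuous_on UNIV g" for c g
      using that continuous_on_mult[OF continuous_on_const[of _ c] that] by (simp add: mult.left_commute[of _ c])
    show "0 \<le> ?a g" if "continuous_on UNIV g" "\<And>x. 0 \<le> g x" for g
      using that k(2) pos by (auto intro!: divide_nonneg_nonneg Bochner_Integration.integral_nonneg)
    show "?a (\<lambda>_. 1) = 1" using pos by simp
  qed (use compact_UNIV in auto)
  moreover have "?a g = 0" if g: "continuous_on UNIV g" "\<forall>x\<in>L. g x = 0" for g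
  proof -
    have ga: "continuous_on UNIV (\<lambda>x. \<bar>g x\<bar>)" by (intro continuous_intros g)
    have "\<bar>\<integral>x. k x * g x \<partial>riesz\<bar> \<le> (\<integral>x. \<bar>k x * g x\<bar> \<partial>riesz)" by (rule integral_abs_bound)
    also have "\<dots> \<le> (\<integral>x. \<bar>g x\<bar> \<partial>riesz)"
    proof (rule integral_mono)
      show "\<bar>k x * g x\<bar> \<le> \<bar>g x\<bar>" for x using k(2,3)[of x] by (simp add: abs_mult mult_left_le_one_le)
    qed (use i[OF g(1)] integrable_continuous[OF ga] in auto)
    also have "\<dots> = \<Phi> (\<lambda>x. \<bar>g x\<bar>)" by (rule integral_riesz[OF ga])
    also have "\<dots> = 0" using \<Phi> ga g by (simp add: inv_states_def)
    finally show ?thesis by simp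
  qed
  moreover have "?a (Q g) = ?a g" if "Q \<in> \<Q>" "continuous_on UNIV g" for Q g
    using inv[OF that] markov_realD(1)[OF \<Q>[OF that(1)] that(2)] that by simp
  ultimately show ?thesis unfolding inv_states_def by blast
qed

context
  fixes \<Q> L
  assumes \<Phi>: "\<Phi> \<in> inv_states \<Q> L" and \<Q>: "\<And>Q. Q \<in> \<Q> \<Longrightarrow> markov_real Q"
    and extreme: "\<And>a b t. a \<in> inv_states \<Q> L \<Longrightarrow> b \<in> inv_states \<Q> L \<Longrightarrow> 0 < t \<Longrightarrow> t < 1 \<Longrightarrow>
      (\<And>g. \<Phi> g = t * a g + (1 - t) * b g) \<Longrightarrow> a = \<Phi>"
begin

text \<open>
  The bounds on \<open>k\<close> ensure that \<open>\<Phi>\<close> is a proper convex combination of the states with densities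
  proportional to \<open>k\<close> and \<open>1 - k\<close>.
\<close>

lemma extreme_density:
  assumes k: "k \<in> borel_measurable riesz" "\<And>x. 1/4 \<le> k x" "\<And>x. k x \<le> 3/4"
    and inv: "\<And>Q g. Q \<in> \<Q> \<Longrightarrow> continuous_on UNIV g \<Longrightarrow> (\<integral>x. k x * Q g x \<partial>riesz) = (\<integral>x. k x * g x \<partial>riesz)"
    and g: "continuous_on UNIV g"
  shows "(\<integral>x. k x * g x \<partial>riesz) = integral\<^sup>L riesz k * \<Phi> g"
proof -
  interpret prob_space riesz by (rule prob_space_riesz)
  define t where "t = integral\<^sup>L riesz k"
  define a where "a = (\<lambda>g. if continuous_on UNIV g then (\<integral>x. k x * g x \<partial>riesz) / integral\<^sup>L riesz k else 0)"
  define b where "b = (\<lambda>g. if continuous_on UNIV g then (\<integral>x. (1 - k x) * g x \<partial>riesz) / (\<integral>x. 1 - k x \<partial>riesz) else 0)"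
  have k01: "0 \<le> k x" "k x \<le> 1" for x using k(2,3)[of x] by auto
  have ik: "integrable riesz k" using k01 k(1) by (intro integrable_bounded[of _ 1]) auto
  note i = integrable_mult_continuous[OF ik]
  have "(\<integral>x. 1/4 \<partial>riesz) \<le> integral\<^sup>L riesz k" using ik k by (intro integral_mono) auto
  moreover have "integral\<^sup>L riesz k \<le> (\<integral>x. 3/4 \<partial>riesz)" using ik k by (intro integral_mono) auto
  ultimately have t: "0 < t" "t < 1" using prob_space by (auto simp: t_def)
  have t': "(\<integral>x. 1 - k x \<partial>riesz) = 1 - t" using ik prob_space by (simp add: t_def)
  have split: "(\<integral>x. (1 - k x) * g x \<partial>riesz) = \<Phi> g - (\<integral>x. k x * g x \<partial>riesz)" if g: "continuous_on UNIV g" for g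
    using i[OF g] integrable_continuous[OF g] by (simp add: left_diff_distrib integral_riesz[OF g])
  have "a \<in> inv_states \<Q> L"
    unfolding a_def using k01 k(1) t inv by (intro weighted_state[OF \<Phi> \<Q>]) (auto simp: t_def)
  moreover have "b \<in> inv_states \<Q> L"
    unfolding b_def
  proof (rule weighted_state[OF \<Phi> \<Q>])
    fix Q and g :: "'a \<Rightarrow> real" assume Qg: "Q \<in> \<Q>" "continuous_on UNIV g"
    have cQ: "continuous_on UNIV (Q g)" by (rule markov_realD(1)[OF \<Q>[OF Qg(1)] Qg(2)])
    have "\<Phi> (Q g) = \<Phi> g" using \<Phi> Qg by (simp add: inv_states_def)
    then show "(\<integral>x. (1 - k x) * Q g x \<partial>riesz) = (\<integral>x. (1 - k x) * g x \<partial>riesz)"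
      by (simp add: split[OF cQ] split[OF Qg(2)] inv[OF Qg])
  qed (use k01 k(1) t t' in auto)
  moreover have "\<Phi> g = t * a g + (1 - t) * b g" for g
  proof (cases "continuous_on UNIV g")
    case True then show ?thesis using t t' by (simp add: a_def b_def split flip: t_def)
  next
    case False then show ?thesis by (simp add: a_def b_def not_continuous)
  qed
  ultimately have "a = \<Phi>" using t by (intro extreme)
  then have "a g = \<Phi> g" by simp
  then show ?thesis using g t by (simp add: a_def field_simps flip: t_def)
qed

text \<open>Extremality makes the integral of \<open>trunc c h\<close> times \<open>g\<close> equal
  to \<open>m * \<Phi> g\<close> for all continuous \<open>g\<close>, with \<open>m\<close> the mean
  of \<open>trunc c h\<close>. Letting \<open>g\<close> approach \<open>trunc c h\<close> itself
  shows that its second moment is m^2. So its variance is 0 and every truncation is constant almost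
  everywhere.\<close>

lemma fixed_function_const:
  assumes h: "integrable riesz h" and ne: "\<Q> \<noteq> {}"
    and fixed: "\<And>Q. Q \<in> \<Q> \<Longrightarrow> \<exists>v. (\<forall>n. continuous_on UNIV (v n)) \<and>
      (\<lambda>n. \<integral>x. \<bar>v n x - h x\<bar> \<partial>riesz) \<longlonglongrightarrow> 0 \<and> (\<lambda>n. \<integral>x. \<bar>Q (v n) x - h x\<bar> \<partial>riesz) \<longlonglongrightarrow> 0"
  shows "\<exists>c. AE x in riesz. h x = (c :: real)"
proof -
  interpret prob_space riesz by (rule prob_space_riesz)
  have inv: "\<Phi> (Q g) = \<Phi> g" if "Q \<in> \<Q>" "continuous_on UNIV g" for Q g
    using \<Phi> that by (simp add: inv_states_def)
  have hm: "h \<in> borel_measurable riesz" using h by simp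
  have const: "AE x in riesz. trunc c (h x) = (\<integral>x. trunc c (h x) \<partial>riesz)" if c: "0 < c" for c
  proof -
    define m where "m = (\<integral>x. trunc c (h x) \<partial>riesz)"
    have le: "\<bar>trunc c (h x)\<bar> \<le> c" for x using abs_trunc_le c by simp
    have ih: "integrable riesz (\<lambda>x. trunc c (h x))" using hm le by (intro integrable_bounded[of _ c]) auto
    \<comment> \<open>The affine map sends [-c, c] onto [1/4, 3/4], as
      \<open>extreme_density\<close> demands, and preserves invariance because \<Phi> itself is
      invariant.\<close>
    define k where "k = (\<lambda>x. (trunc c (h x) + 2 * c) / (4 * c))"
    have kh: "(\<integral>x. k x * g x \<partial>riesz) = ((\<integral>x. trunc c (h x) * g x \<partial>riesz) + 2 * c * \<Phi> g) / (4 * c)"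
      if g: "continuous_on UNIV g" for g
    proof -
      have "(\<integral>x. k x * g x \<partial>riesz) = (\<integral>x. (trunc c (h x) * g x + 2 * c * g x) / (4 * c) \<partial>riesz)"
        by (simp add: k_def algebra_simps)
      also have "\<dots> = ((\<integral>x. trunc c (h x) * g x \<partial>riesz) + 2 * c * \<Phi> g) / (4 * c)"
        using integrable_mult_continuous[OF ih g] integrable_continuous[OF g] by (simp add: integral_riesz[OF g])
      finally show ?thesis .
    qed
    have prod: "(\<integral>x. trunc c (h x) * g x \<partial>riesz) = m * \<Phi> g" if g: "continuous_on UNIV g" for g
    proof -
      have "(\<integral>x. k x * g x \<partial>riesz) = integral\<^sup>L riesz k * \<Phi> g"
      proof (rule extreme_density[OF _ _ _ _ g])
        show "k \<in> borel_measurable riesz" unfolding k_def using hm by measurable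
        show "1/4 \<le> k x" "k x \<le> 3/4" for x using le[of x] c by (auto simp: k_def field_simps abs_le_iff)
        fix Q and g :: "'a \<Rightarrow> real" assume Qg: "Q \<in> \<Q>" "continuous_on UNIV g"
        obtain v where v: "\<And>n. continuous_on UNIV (v n)" "(\<lambda>n. \<integral>x. \<bar>v n x - h x\<bar> \<partial>riesz) \<longlonglongrightarrow> 0"
          "(\<lambda>n. \<integral>x. \<bar>Q (v n) x - h x\<bar> \<partial>riesz) \<longlonglongrightarrow> 0" using fixed[OF Qg(1)] by blast
        have "(\<integral>x. trunc c (h x) * Q g x \<partial>riesz) = (\<integral>x. trunc c (h x) * g x \<partial>riesz)"
          using c by (intro density_invariant[OF \<Q>[OF Qg(1)] inv[OF Qg(1)] h v _ Qg(2)]) auto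
        then show "(\<integral>x. k x * Q g x \<partial>riesz) = (\<integral>x. k x * g x \<partial>riesz)"
          using kh[OF Qg(2)] kh[OF markov_realD(1)[OF \<Q>[OF Qg(1)] Qg(2)]] inv[OF Qg] by simp
      qed
      moreover have "integral\<^sup>L riesz k = (m + 2 * c) / (4 * c)" using kh[of "\<lambda>_. 1"] by (simp add: m_def)
      ultimately show ?thesis using kh[OF g] c by (simp add: field_simps)
    qed
    \<comment> \<open>Any one operator supplies continuous functions that converge to
      \<open>h\<close> in L^1.\<close>
    obtain Q where "Q \<in> \<Q>" using ne by blast
    then obtain v where v: "\<And>n. continuous_on UNIV (v n)" "(\<lambda>n. \<integral>x. \<bar>v n x - h x\<bar> \<partial>riesz) \<longlonglongrightarrow> 0"
      using fixed by blast
    define w where "w n x = trunc c (v n x)" for n x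
    have w: "continuous_on UNIV (w n)" for n unfolding w_def by (intro continuous_intros v)
    have wh: "(\<lambda>n. \<integral>x. \<bar>w n x - trunc c (h x)\<bar> \<partial>riesz) \<longlonglongrightarrow> 0"
      using trunc_L1[OF v(1) h] by (intro Lim_null_comparison[OF always_eventually v(2)]) (simp add: w_def)
    have "(\<lambda>n. \<integral>x. w n x * 1 \<partial>riesz) \<longlonglongrightarrow> (\<integral>x. trunc c (h x) * 1 \<partial>riesz)"
      by (rule tendsto_integral_mult[OF integrable_continuous[OF w] ih _ wh]) simp
    then have l1: "(\<lambda>n. m * \<Phi> (w n)) \<longlonglongrightarrow> m * m"
      using integral_riesz[OF w] by (intro tendsto_mult_left) (simp add: m_def)
    have isq: "integrable riesz (\<lambda>x. trunc c (h x) * trunc c (h x))"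
    proof (rule integrable_bounded[of _ "c * c"])
      show "\<bar>trunc c (h x) * trunc c (h x)\<bar> \<le> c * c" for x
        unfolding abs_mult using le c by (intro mult_mono) auto
    qed (use hm in measurable)
    have l2: "(\<lambda>n. \<integral>x. trunc c (h x) * w n x \<partial>riesz) \<longlonglongrightarrow> (\<integral>x. trunc c (h x) * trunc c (h x) \<partial>riesz)"
    proof -
      have "norm ((\<integral>x. trunc c (h x) * w n x \<partial>riesz) - (\<integral>x. trunc c (h x) * trunc c (h x) \<partial>riesz))
        \<le> c * (\<integral>x. \<bar>w n x - trunc c (h x)\<bar> \<partial>riesz)" for n
      proof -
        have d: "integrable riesz (\<lambda>x. \<bar>w n x - trunc c (h x)\<bar>)" using ih integrable_continuous[OF w[of n]] by simp
        have "(\<integral>x. trunc c (h x) * w n x \<partial>riesz) - (\<integral>x. trunc c (h x) * trunc c (h x) \<partial>riesz)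
          = (\<integral>x. trunc c (h x) * w n x - trunc c (h x) * trunc c (h x) \<partial>riesz)"
          by (rule Bochner_Integration.integral_diff[symmetric, OF integrable_mult_continuous[OF ih w] isq])
        also have "norm \<dots> \<le> (\<integral>x. \<bar>trunc c (h x) * w n x - trunc c (h x) * trunc c (h x)\<bar> \<partial>riesz)"
          unfolding real_norm_def by (rule integral_abs_bound)
        also have "\<dots> \<le> (\<integral>x. c * \<bar>w n x - trunc c (h x)\<bar> \<partial>riesz)"
        proof (rule integral_mono)
          show "integrable riesz (\<lambda>x. \<bar>trunc c (h x) * w n x - trunc c (h x) * trunc c (h x)\<bar>)"
            using isq integrable_mult_continuous[OF ih w] by simp
          show "integrable riesz (\<lambda>x. c * \<bar>w n x - trunc c (h x)\<bar>)" using d by simp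
          fix x
          have "\<bar>trunc c (h x) * w n x - trunc c (h x) * trunc c (h x)\<bar> = \<bar>trunc c (h x)\<bar> * \<bar>w n x - trunc c (h x)\<bar>"
            by (simp add: abs_mult flip: right_diff_distrib)
          also have "\<dots> \<le> c * \<bar>w n x - trunc c (h x)\<bar>" by (intro mult_right_mono le) simp
          finally show "\<bar>trunc c (h x) * w n x - trunc c (h x) * trunc c (h x)\<bar> \<le> c * \<bar>w n x - trunc c (h x)\<bar>" .
        qed
        finally show ?thesis by simp
      qed
      then have "(\<lambda>n. (\<integral>x. trunc c (h x) * w n x \<partial>riesz) - (\<integral>x. trunc c (h x) * trunc c (h x) \<partial>riesz)) \<longlonglongrightarrow> 0"
        by (intro Lim_null_comparison[OF always_eventually tendsto_mult_right_zero[OF wh]]) blast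
      then show ?thesis by (simp add: LIM_zero_iff)
    qed
    have eq: "(\<integral>x. trunc c (h x) * trunc c (h x) \<partial>riesz) = m * m"
      using LIMSEQ_unique[OF l2[unfolded prod[OF w]] l1] .
    have "(\<integral>x. (trunc c (h x) - m) * (trunc c (h x) - m) \<partial>riesz)
      = (\<integral>x. trunc c (h x) * trunc c (h x) - 2 * m * trunc c (h x) + m * m \<partial>riesz)"
      by (simp add: algebra_simps)
    also have "\<dots> = 0" using isq ih prob_space eq by (simp flip: m_def)
    finally have z: "(\<integral>x. (trunc c (h x) - m) * (trunc c (h x) - m) \<partial>riesz) = 0" .
    have "integrable riesz (\<lambda>x. trunc c (h x) * trunc c (h x) - 2 * m * trunc c (h x) + m * m)" using isq ih by simp
    then have "integrable riesz (\<lambda>x. (trunc c (h x) - m) * (trunc c (h x) - m))" by (simp add: algebra_simps)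
    then have "AE x in riesz. (trunc c (h x) - m) * (trunc c (h x) - m) = 0"
      using z by (subst (asm) integral_nonneg_eq_0_iff_AE) auto
    then show ?thesis by (simp add: m_def)
  qed
  \<comment> \<open>\<open>Suc n\<close> keeps the level positive. Countably many levels share one
    null set, and off it a sufficiently high level determines \<open>h x\<close>.\<close>
  define m where "m n = (\<integral>x. trunc (real (Suc n)) (h x) \<partial>riesz)" for n
  have ae: "AE x in riesz. \<forall>n. trunc (real (Suc n)) (h x) = m n"
    unfolding AE_all_countable m_def using const by simp
  have "\<exists>x. \<forall>n. trunc (real (Suc n)) (h x) = m n"
  proof (rule ccontr)
    assume *: "\<nexists>x. \<forall>n. trunc (real (Suc n)) (h x) = m n"
    from ae have "AE x in riesz. False" by eventually_elim (use * in blast)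
    then show False by simp
  qed
  then obtain x0 where x0: "\<And>n. trunc (real (Suc n)) (h x0) = m n" by blast
  have "AE x in riesz. h x = h x0"
    using ae
  proof eventually_elim
    fix x assume x: "\<forall>n. trunc (real (Suc n)) (h x) = m n"
    obtain n where "max \<bar>h x\<bar> \<bar>h x0\<bar> \<le> real n" using real_arch_simple by blast
    then have "\<bar>h x\<bar> \<le> real (Suc n)" "\<bar>h x0\<bar> \<le> real (Suc n)" by auto
    then show "h x = h x0" using spec[OF x, of n] x0[of n] by (simp add: trunc_eq)
  qed
  then show ?thesis by blast
qed

end
end

section \<open>Operators on \<open>C(K)\<close>\<close>

definition cx :: "('a::topological_space \<Rightarrow> real) \<Rightarrow> 'a CK" where
  "cx g = Bcontfun (\<lambda>x. complex_of_real (g x))"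

text \<open>For a positive operator the real part loses nothing, as real functions are mapped to
  real functions (\<open>op_cx\<close>).\<close>

definition re_op :: "('a::topological_space) CKop \<Rightarrow> ('a \<Rightarrow> real) \<Rightarrow> 'a \<Rightarrow> real" where
  "re_op T g = (\<lambda>x. Re (apply_bcontfun (T (cx g)) x))"

lemma continuous_re_op: "continuous_on UNIV (re_op T g)"
  unfolding re_op_def by (intro continuous_intros continuous_on_apply_bcontfun)

lemma continuous_Re_bcontfun: "continuous_on UNIV (\<lambda>x. Re (apply_bcontfun f x))"
  and continuous_Im_bcontfun: "continuous_on UNIV (\<lambda>x. Im (apply_bcontfun f x))"
  by (intro continuous_intros continuous_on_apply_bcontfun)+

lemma bounded_linear_apply_bcontfun:
  "bounded_linear (\<lambda>f :: 'a::topological_space \<Rightarrow>\<^sub>C 'b::real_normed_vector. apply_bcontfun f x)"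
  by (rule bounded_linear_intro[of _ 1]) (simp_all add: norm_bounded)

lemma continuous_on_eval: "continuous_on A (\<lambda>f :: 'a::topological_space \<Rightarrow>\<^sub>C 'b::real_normed_vector. apply_bcontfun f x)"
  by (rule bounded_linear.continuous_on[OF bounded_linear_apply_bcontfun continuous_on_id])

context
  assumes K: "compact (UNIV :: 'a::t2_space set)"
begin

lemma apply_cx: "continuous_on UNIV g \<Longrightarrow> apply_bcontfun (cx g) (x :: 'a) = complex_of_real (g x)"
  unfolding cx_def by (subst Bcontfun_inverse) (auto intro!: bcontfun_compact[OF K] continuous_intros)

lemma cx_add:
  assumes "continuous_on UNIV f" "continuous_on UNIV g"
  shows "cx (\<lambda>x :: 'a. f x + g x) = cx f + cx g"
  using assms by (intro bcontfun_eqI) (simp add: apply_cx continuous_on_add)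

lemma cx_scale:
  assumes "continuous_on UNIV g"
  shows "cx (\<lambda>x :: 'a. c * g x) = c *\<^sub>R cx g"
  using assms by (intro bcontfun_eqI) (simp add: apply_cx continuous_on_mult_left scaleR_conv_of_real)

lemma cx_one: "cx (\<lambda>_ :: 'a. 1) = const_bcontfun 1"
  by (intro bcontfun_eqI) (simp add: apply_cx)

lemma cabs_eq_cx: "cabs f = cx (\<lambda>x :: 'a. norm (apply_bcontfun f x))"
  by (intro bcontfun_eqI) (simp add: apply_cx continuous_on_norm)

lemma bcontfun_decompose:
  "f = cx (\<lambda>x :: 'a. Re (apply_bcontfun f x)) + cmul \<i> (cx (\<lambda>x. Im (apply_bcontfun f x)))"
  by (intro bcontfun_eqI) (simp add: apply_cx continuous_Re_bcontfun continuous_Im_bcontfun complex_eq)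

context
  fixes T :: "'a CKop"
  assumes pos: "positive_op T"
begin

lemma positive_op_cx:
  assumes "continuous_on UNIV g" "\<And>x. 0 \<le> g x"
  shows "apply_bcontfun (T (cx g)) x \<in> \<real>\<^sub>\<ge>\<^sub>0"
  using pos assms unfolding positive_op_def by (simp add: apply_cx)

text \<open>Adding a constant \<open>B\<close> makes \<open>g\<close> non-negative. Positivity then
  makes the images of both \<open>g + B\<close> and \<open>B\<close> real, and hence their
  difference.\<close>

lemma op_cx:
  assumes g: "continuous_on UNIV g"
  shows "T (cx g) = cx (re_op T g)"
proof (rule bcontfun_eqI)
  fix x
  have "compact (range g)" using compact_continuous_image[OF g K] by simp
  then obtain B where B: "0 < B" "\<forall>y\<in>range g. norm y \<le> B" using compact_imp_bounded bounded_pos by blast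
  have gB: "continuous_on UNIV (\<lambda>x. g x + B)" by (intro continuous_intros g)
  have "0 \<le> g x + B" for x
  proof -
    have "norm (g x) \<le> B" using B(2) by blast
    then show ?thesis by simp
  qed
  then have 1: "apply_bcontfun (T (cx (\<lambda>x. g x + B))) x \<in> \<real>\<^sub>\<ge>\<^sub>0" by (rule positive_op_cx[OF gB])
  have 2: "apply_bcontfun (T (cx (\<lambda>_. B))) x \<in> \<real>\<^sub>\<ge>\<^sub>0" using B(1) by (intro positive_op_cx) auto
  have "cx (\<lambda>x. g x + B) = cx g + cx (\<lambda>_. B)" by (rule cx_add[OF g continuous_on_const])
  then have "apply_bcontfun (T (cx (\<lambda>x. g x + B))) x = apply_bcontfun (T (cx g)) x + apply_bcontfun (T (cx (\<lambda>_. B))) x"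
    by (simp add: blinfun.add_right)
  then have "Im (apply_bcontfun (T (cx g)) x) = 0"
    using 1 2 by (auto simp: complex_nonneg_Reals_iff)
  then show "apply_bcontfun (T (cx g)) x = apply_bcontfun (cx (re_op T g)) x"
    unfolding apply_cx[OF continuous_re_op] by (simp add: re_op_def complex_eq_iff)
qed

lemma re_op_add:
  assumes "continuous_on UNIV f" "continuous_on UNIV g"
  shows "re_op T (\<lambda>x. f x + g x) = (\<lambda>x. re_op T f x + re_op T g x)"
  unfolding re_op_def cx_add[OF assms] by (simp add: blinfun.add_right)

lemma re_op_scale:
  assumes "continuous_on UNIV g"
  shows "re_op T (\<lambda>x. c * g x) = (\<lambda>x. c * re_op T g x)"
  unfolding re_op_def cx_scale[OF assms] by (simp add: blinfun.scaleR_right)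

lemma re_op_nonneg:
  assumes "continuous_on UNIV g" "\<And>x. 0 \<le> g x"
  shows "0 \<le> re_op T g x"
  using positive_op_cx[OF assms] by (simp add: re_op_def complex_nonneg_Reals_iff)

lemma re_op_one: "T (const_bcontfun 1) = const_bcontfun 1 \<Longrightarrow> re_op T (\<lambda>_. 1) = (\<lambda>_. 1)"
  by (simp add: re_op_def cx_one)

lemma markov_real_re_op: "T (const_bcontfun 1) = const_bcontfun 1 \<Longrightarrow> markov_real (re_op T)"
  unfolding markov_real_def by (simp add: continuous_re_op re_op_add re_op_scale re_op_nonneg re_op_one)

lemma state_eval:
  assumes "T (const_bcontfun 1) = const_bcontfun 1"
  shows "state (\<lambda>g. if continuous_on UNIV g then re_op T g x else 0)"
  by unfold_locales
    (auto simp: K re_op_add re_op_scale re_op_nonneg re_op_one[OF assms] continuous_on_add continuous_on_mult_left)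

lemma Re_Im_op:
  assumes "complex_linear T"
  shows "Re (apply_bcontfun (T f) x) = re_op T (\<lambda>x. Re (apply_bcontfun f x)) x"
    and "Im (apply_bcontfun (T f) x) = re_op T (\<lambda>x. Im (apply_bcontfun f x)) x"
proof -
  have "T f = T (cx (\<lambda>x. Re (apply_bcontfun f x)) + cmul \<i> (cx (\<lambda>x. Im (apply_bcontfun f x))))"
    by (subst bcontfun_decompose[of f]) (rule refl)
  also have "\<dots> = cx (re_op T (\<lambda>x. Re (apply_bcontfun f x))) + cmul \<i> (cx (re_op T (\<lambda>x. Im (apply_bcontfun f x))))"
    using assms by (simp add: blinfun.add_right complex_linear_def op_cx continuous_Re_bcontfun continuous_Im_bcontfun)
  finally have eq: "T f = cx (re_op T (\<lambda>x. Re (apply_bcontfun f x))) + cmul \<i> (cx (re_op T (\<lambda>x. Im (apply_bcontfun f x))))" .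
  show "Re (apply_bcontfun (T f) x) = re_op T (\<lambda>x. Re (apply_bcontfun f x)) x"
    and "Im (apply_bcontfun (T f) x) = re_op T (\<lambda>x. Im (apply_bcontfun f x)) x"
    unfolding eq by (simp_all add: apply_cx continuous_re_op)
qed

end
end

text \<open>Evaluation at \<open>g\<close> is linear and continuous for the strong operator
  topology, so closed convex conditions on single images pass from \<S> to its closed convex hull.
  Every property of the net members is obtained in this way.\<close>

lemma strong_closure_convex_hull_apply:
  fixes \<S> :: "('a::real_normed_vector \<Rightarrow>\<^sub>L 'b::real_normed_vector) set"
  assumes T: "T \<in> strong_operator_topology closure_of (convex hull \<S>)"
    and W: "closed W" "convex W" and S: "\<And>S. S \<in> \<S> \<Longrightarrow> blinfun_apply S g \<in> W"
  shows "blinfun_apply T g \<in> W"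
proof -
  have "convex {U. blinfun_apply U g \<in> W}"
    using W(2) by (auto simp: convex_def blinfun.add_left blinfun.scaleR_left)
  then have "convex hull \<S> \<subseteq> {U. blinfun_apply U g \<in> W}" using S by (intro hull_minimal) auto
  then have sub: "(\<lambda>U. blinfun_apply U g) ` (convex hull \<S>) \<subseteq> W" by auto
  have "(\<lambda>U. blinfun_apply U g) ` (strong_operator_topology closure_of (convex hull \<S>))
      \<subseteq> euclidean closure_of ((\<lambda>U. blinfun_apply U g) ` (convex hull \<S>))"
    by (rule continuous_map_image_closure_subset[OF strong_operator_topology_continuous_evaluation])
  also have "\<dots> \<subseteq> W" using sub W(1) by (simp add: closure_minimal)
  finally show ?thesis using T by auto
qed

lemma strong_limit_apply:
  assumes "limitin strong_operator_topology U V F"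
  shows "((\<lambda>i. blinfun_apply (U i) g) \<longlongrightarrow> blinfun_apply V g) F"
  using continuous_map_limit[OF strong_operator_topology_continuous_evaluation[of g] assms]
  by (simp add: o_def)

section \<open>Extreme invariant states and primitive ideals\<close>

lemma closed_Collect_imp_const: "(P \<Longrightarrow> closed {x. Q x}) \<Longrightarrow> closed {x. P \<longrightarrow> Q x}"
  by (cases P) auto

lemma compact_box:
  fixes B :: "'b \<Rightarrow> real"
  shows "compact {\<phi>. \<forall>g. \<phi> g \<in> {- B g..B g}}"
proof -
  have "compactin (product_topology (\<lambda>_::'b. euclidean) UNIV) (Pi\<^sub>E UNIV (\<lambda>g. {- B g..B g}))"
    by (simp add: compactin_PiE)
  moreover have "Pi\<^sub>E UNIV (\<lambda>g. {- B g..B g}) = {\<phi>. \<forall>g. \<phi> g \<in> {- B g..B g}}"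
    by (auto simp: PiE_UNIV_domain)
  ultimately show ?thesis by (simp add: euclidean_product_topology)
qed

lemma cluster_point_closed:
  assumes "inf (nhds x) F \<noteq> bot" "eventually (\<lambda>y. y \<in> C) F" "closed C"
  shows "x \<in> C"
proof (rule ccontr)
  assume "x \<notin> C"
  then have "eventually (\<lambda>y. y \<in> - C) (nhds x)" using assms(3) by (intro eventually_nhds_in_open) auto
  with assms(2) have "eventually (\<lambda>y. False) (inf (nhds x) F)"
    unfolding eventually_inf by (intro exI[of _ "\<lambda>y. y \<in> - C"] exI[of _ "\<lambda>y. y \<in> C"]) auto
  then show False using assms(1) by (simp add: trivial_limit_def)
qed

section \<open>Compactness of the set of invariant states\<close>

context
  assumes K: "compact (UNIV :: 'a::t2_space set)"
begin

lemma closed_states: "closed {\<Phi> :: ('a \<Rightarrow> real) \<Rightarrow> real. state \<Phi>}"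
  unfolding state_def
  by (intro closed_Collect_conj closed_Collect_all closed_Collect_imp_const closed_Collect_eq closed_Collect_le
      continuous_on_add continuous_on_mult continuous_on_const continuous_on_product_coordinates closed_Collect_const)

text \<open>Banach-Alaoglu by Tychonoff: the value at a continuous \<open>g\<close> is bounded by a
  bound of |g|. At discontinuous \<open>g\<close> the default value 0 keeps the coordinate
  bounded.\<close>

lemma compact_states: "compact {\<Phi> :: ('a \<Rightarrow> real) \<Rightarrow> real. state \<Phi>}"
proof -
  have "\<exists>B. \<forall>\<Phi>. state \<Phi> \<longrightarrow> \<bar>\<Phi> g\<bar> \<le> B" for g :: "'a \<Rightarrow> real"
  proof (cases "continuous_on UNIV g")
    case True
    then have "compact (range g)" using compact_continuous_image K by blast
    then obtain B where B: "\<forall>y\<in>range g. norm y \<le> B" using compact_imp_bounded bounded_iff by blast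
    have "\<bar>\<Phi> g\<bar> \<le> B" if "state \<Phi>" for \<Phi>
    proof -
      interpret state \<Phi> by fact
      have "\<bar>\<Phi> g\<bar> \<le> \<Phi> (\<lambda>x. \<bar>g x\<bar>)" by (rule abs_le[OF True])
      also have "\<dots> \<le> \<Phi> (\<lambda>_. B)" using B by (intro mono continuous_on_rabs True continuous_on_const) simp
      finally show ?thesis by simp
    qed
    then show ?thesis by blast
  next
    case False
    have "\<bar>\<Phi> g\<bar> \<le> 0" if "state \<Phi>" for \<Phi> using state.not_continuous[OF that False] by simp
    then show ?thesis by blast
  qed
  then obtain B where B: "\<And>\<Phi> g :: 'a \<Rightarrow> real. state \<Phi> \<Longrightarrow> \<bar>\<Phi> g\<bar> \<le> B g" by metis
  have sub: "Collect state \<subseteq> {\<Phi> :: ('a \<Rightarrow> real) \<Rightarrow> real. \<forall>g. \<Phi> g \<in> {- B g..B g}}"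
  proof (intro subsetI CollectI allI)
    fix \<Phi> :: "('a \<Rightarrow> real) \<Rightarrow> real" and g assume "\<Phi> \<in> Collect state"
    then have "\<bar>\<Phi> g\<bar> \<le> B g" by (intro B) simp
    then show "\<Phi> g \<in> {- B g..B g}" by (simp add: abs_le_iff)
  qed
  show ?thesis using closed_Int_compact[OF closed_states compact_box[of B]] unfolding Int_absorb2[OF sub] .
qed

lemma closed_inv_states: "closed (inv_states \<Q> (L :: 'a set))"
  unfolding inv_states_def Ball_def
  by (intro closed_Collect_conj closed_states closed_Collect_all closed_Collect_imp_const closed_Collect_eq
      continuous_on_const continuous_on_product_coordinates)

lemma compact_inv_states: "compact (inv_states \<Q> (L :: 'a set))"
proof -
  have sub: "inv_states \<Q> L \<subseteq> Collect state" by (simp add: inv_states_def Collect_mono)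
  show ?thesis using closed_Int_compact[OF closed_inv_states[of \<Q> L] compact_states] unfolding Int_absorb2[OF sub] .
qed

end

lemma integral_complex_eqI:
  assumes f: "integrable M f" and g: "integrable M g"
    and re: "(\<integral>x. Re (f x) \<partial>M) = (\<integral>x. Re (g x) \<partial>M)" and im: "(\<integral>x. Im (f x) \<partial>M) = (\<integral>x. Im (g x) \<partial>M)"
  shows "integral\<^sup>L M f = integral\<^sup>L M g"
  using re im unfolding integral_Re[OF f] integral_Re[OF g] integral_Im[OF f] integral_Im[OF g]
  by (rule complex_eqI)

text \<open>The ideal is \<open>I_mu\<close> of the Riesz measure of \<phi>. The constant 1 is
  always fixed, so ergodicity means that a fixed \<open>f\<close> is constant almost everywhere,
  which is checked on its real and imaginary parts.\<close>

lemma extreme_state_Prim: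
  fixes L :: "'a::t2_space set"
  assumes K: "compact (UNIV :: 'a set)" and markov: "\<And>S. S \<in> \<S> \<Longrightarrow> markov S" and ne: "\<S> \<noteq> {}"
    and \<phi>: "\<phi> \<in> inv_states (re_op ` \<S>) L"
    and extreme: "\<And>a b t. a \<in> inv_states (re_op ` \<S>) L \<Longrightarrow> b \<in> inv_states (re_op ` \<S>) L \<Longrightarrow> 0 < t \<Longrightarrow> t < 1 \<Longrightarrow>
      (\<And>g. \<phi> g = t * a g + (1 - t) * b g) \<Longrightarrow> a = \<phi>"
  shows "{f. \<phi> (\<lambda>x. norm (apply_bcontfun f x)) = 0} \<in> Prim \<S>"
proof -
  interpret state \<phi> using \<phi> by (simp add: inv_states_def)
  interpret prob_space riesz by (rule prob_space_riesz)
  have pos: "positive_op S" and lin: "complex_linear S" and one: "S (const_bcontfun 1) = const_bcontfun 1"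
    if "S \<in> \<S>" for S using markov[OF that] by (simp_all add: markov_def)
  have mr: "markov_real Q" if "Q \<in> re_op ` \<S>" for Q
    using that by (auto intro!: markov_real_re_op[OF K] pos one)
  have inv: "\<phi> (re_op S g) = \<phi> g" if "S \<in> \<S>" "continuous_on UNIV g" for S g
    using \<phi> that by (simp add: inv_states_def)
  have ib: "integrable riesz (apply_bcontfun f)" for f :: "'a CK"
    by (intro integrable_continuous continuous_on_apply_bcontfun)
  have "riesz \<in> invariant_probs \<S>"
    unfolding invariant_probs_def
  proof (intro CollectI conjI ballI allI sets_riesz prob_space_riesz regular_riesz)
    fix S f assume S: "S \<in> \<S>"
    show "integral\<^sup>L riesz (apply_bcontfun (S f)) = integral\<^sup>L riesz (apply_bcontfun f)"
    proof (rule integral_complex_eqI[OF ib ib])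
      show "(\<integral>x. Re (apply_bcontfun (S f) x) \<partial>riesz) = (\<integral>x. Re (apply_bcontfun f x) \<partial>riesz)"
        unfolding Re_Im_op[OF K pos[OF S] lin[OF S]]
        by (simp add: integral_riesz continuous_re_op continuous_Re_bcontfun inv[OF S])
      show "(\<integral>x. Im (apply_bcontfun (S f) x) \<partial>riesz) = (\<integral>x. Im (apply_bcontfun f x) \<partial>riesz)"
        unfolding Re_Im_op[OF K pos[OF S] lin[OF S]]
        by (simp add: integral_riesz continuous_re_op continuous_Im_bcontfun inv[OF S])
    qed
  qed
  moreover have "ergodic \<S> riesz"
    unfolding ergodic_def
  proof (intro bexI[of _ "\<lambda>_. 1"] conjI ballI)
    show "\<not> (AE x in riesz. (1 :: complex) = 0)" by simp
    show "(\<lambda>_. 1) \<in> L1_fixed_space \<S> riesz"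
      unfolding L1_fixed_space_def L1_extension_def
    proof (intro CollectI conjI ballI)
      fix S assume S: "S \<in> \<S>"
      show "\<exists>u. (\<lambda>n. \<integral>x. cmod (apply_bcontfun (u n) x - 1) \<partial>riesz) \<longlonglongrightarrow> 0 \<and>
         (\<lambda>n. \<integral>x. cmod (apply_bcontfun (S (u n)) x - 1) \<partial>riesz) \<longlonglongrightarrow> 0"
        by (intro exI[of _ "\<lambda>_. const_bcontfun 1"]) (simp add: one[OF S])
    qed simp_all
    fix f assume f: "f \<in> L1_fixed_space \<S> riesz"
    then have fi: "integrable riesz f" by (simp add: L1_fixed_space_def)
    \<comment> \<open>\<open>P\<close> stands for \<open>Re\<close> and \<open>Im\<close>. Both are
      contractive, so the L^1 approximations survive, and both commute with a complex linear
      positive operator.\<close>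
    have key: "\<exists>c. AE x in riesz. P (f x) = c"
      if P: "bounded_linear P" "\<And>z. \<bar>P z\<bar> \<le> cmod z"
        and PS: "\<And>S g x. S \<in> \<S> \<Longrightarrow> P (apply_bcontfun (S g) x) = re_op S (\<lambda>x. P (apply_bcontfun g x)) x"
      for P :: "complex \<Rightarrow> real"
    proof (rule fixed_function_const[OF \<phi> mr extreme])
      interpret P: bounded_linear P by fact
      have cP: "continuous_on UNIV (\<lambda>x. P (apply_bcontfun g x))" for g :: "'a CK"
        by (intro P.continuous_on continuous_on_apply_bcontfun)
      show iP: "integrable riesz (\<lambda>x. P (f x))" by (rule integrable_bounded_linear[OF P(1) fi])
      show "re_op ` \<S> \<noteq> {}" using ne by simp
      fix Q assume "Q \<in> re_op ` \<S>"
      then obtain S where S: "S \<in> \<S>" "Q = re_op S" by blast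
      then obtain u :: "nat \<Rightarrow> 'a CK" where u: "(\<lambda>n. \<integral>x. norm (apply_bcontfun (u n) x - f x) \<partial>riesz) \<longlonglongrightarrow> 0"
          "(\<lambda>n. \<integral>x. norm (apply_bcontfun (S (u n)) x - f x) \<partial>riesz) \<longlonglongrightarrow> 0"
        using f unfolding L1_fixed_space_def L1_extension_def by blast
      have le: "norm (\<integral>x. \<bar>P (apply_bcontfun g x) - P (f x)\<bar> \<partial>riesz) \<le> (\<integral>x. norm (apply_bcontfun g x - f x) \<partial>riesz)" for g :: "'a CK"
      proof -
        have "(\<integral>x. \<bar>P (apply_bcontfun g x) - P (f x)\<bar> \<partial>riesz) \<le> (\<integral>x. norm (apply_bcontfun g x - f x) \<partial>riesz)"
        proof (rule integral_mono)
          show "integrable riesz (\<lambda>x. \<bar>P (apply_bcontfun g x) - P (f x)\<bar>)" using integrable_continuous[OF cP] iP by simp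
          show "integrable riesz (\<lambda>x. norm (apply_bcontfun g x - f x))" using ib fi by simp
          show "\<bar>P (apply_bcontfun g x) - P (f x)\<bar> \<le> norm (apply_bcontfun g x - f x)" for x
            using P(2)[of "apply_bcontfun g x - f x"] by (simp add: P.diff)
        qed
        then show ?thesis by simp
      qed
      show "\<exists>v. (\<forall>n. continuous_on UNIV (v n)) \<and> (\<lambda>n. \<integral>x. \<bar>v n x - P (f x)\<bar> \<partial>riesz) \<longlonglongrightarrow> 0 \<and>
          (\<lambda>n. \<integral>x. \<bar>Q (v n) x - P (f x)\<bar> \<partial>riesz) \<longlonglongrightarrow> 0"
      proof (intro exI[of _ "\<lambda>n x. P (apply_bcontfun (u n) x)"] conjI allI cP)
        show "(\<lambda>n. \<integral>x. \<bar>P (apply_bcontfun (u n) x) - P (f x)\<bar> \<partial>riesz) \<longlonglongrightarrow> 0"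
          by (rule Lim_null_comparison[OF always_eventually u(1)]) (use le in blast)
        show "(\<lambda>n. \<integral>x. \<bar>Q (\<lambda>x. P (apply_bcontfun (u n) x)) x - P (f x)\<bar> \<partial>riesz) \<longlonglongrightarrow> 0"
          unfolding S(2) PS[OF S(1), symmetric]
          by (rule Lim_null_comparison[OF always_eventually u(2)]) (use le in blast)
      qed
    qed
    obtain a where a: "AE x in riesz. Re (f x) = a"
      using key[OF bounded_linear_Re abs_Re_le_cmod] Re_Im_op(1)[OF K pos lin] by blast
    obtain b where b: "AE x in riesz. Im (f x) = b"
      using key[OF bounded_linear_Im abs_Im_le_cmod] Re_Im_op(2)[OF K pos lin] by blast
    have "AE x in riesz. f x = Complex a b * 1"
      using a b by eventually_elim (simp add: complex_eq_iff)
    then show "\<exists>c. AE x in riesz. f x = c * 1" by blast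
  qed
  moreover have "{f. \<phi> (\<lambda>x. norm (apply_bcontfun f x)) = 0} = I_mu riesz"
  proof -
    have "integral\<^sup>L riesz (apply_bcontfun (cabs f)) = complex_of_real (\<phi> (\<lambda>x. norm (apply_bcontfun f x)))" for f
    proof -
      have "apply_bcontfun (cabs f) = (\<lambda>x. complex_of_real (norm (apply_bcontfun f x)))"
        by (simp add: fun_eq_iff)
      moreover have "continuous_on UNIV (\<lambda>x. norm (apply_bcontfun f x))"
        by (intro continuous_on_norm continuous_on_apply_bcontfun)
      ultimately show ?thesis by (simp add: integral_riesz)
    qed
    then show ?thesis by (simp add: I_mu_def)
  qed
  ultimately show ?thesis unfolding Prim_def by blast
qed

section \<open>Right ergodic nets\<close>

lemma tails_eventually_in:
  assumes "directed_set A le" shows "eventually (\<lambda>i. i \<in> A) (tails A le)"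
  using assms unfolding eventually_tails[OF assms] directed_set_def by blast

lemma tails_neq_bot:
  assumes "directed_set A le" shows "tails A le \<noteq> bot"
proof
  assume "tails A le = bot"
  then have "eventually (\<lambda>_. False) (tails A le)" by simp
  then show False using assms unfolding eventually_tails[OF assms] directed_set_def by blast
qed

lemma closed_vanishing_ideal: "closed (vanishing_ideal L)"
  unfolding vanishing_ideal_def Ball_def
  by (intro closed_Collect_all closed_Collect_imp_const closed_Collect_eq continuous_on_eval continuous_on_const)

lemma convex_vanishing_ideal: "convex (vanishing_ideal L)"
  by (auto simp: convex_def vanishing_ideal_def)

lemma norm_le_norm_CL:
  assumes "x \<in> L" shows "norm (apply_bcontfun g x) \<le> norm_CL L (apply_bcontfun g)"
proof -
  have "bdd_above ((\<lambda>x. norm (apply_bcontfun g x)) ` L)"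
    using norm_bounded[of g] by (intro bdd_aboveI[of _ "norm g"]) auto
  then show ?thesis unfolding norm_CL_def using assms by (rule cSUP_upper[rotated])
qed

section \<open>The net on the support and the three inclusions\<close>

context
  fixes \<S> :: "('a::t2_space) CKop set" and L :: "'a set" and A :: "'i set" and le and T :: "'i \<Rightarrow> 'a CKop"
  assumes K: "compact (UNIV :: 'a set)" and markov: "\<And>S. S \<in> \<S> \<Longrightarrow> markov S"
    and L: "closed L" "S_ideal \<S> (vanishing_ideal L)" and net: "right_ergodic_net \<S> A le T"
begin

lemma directed: "directed_set A le"
  and net_closure: "i \<in> A \<Longrightarrow> T i \<in> strong_operator_topology closure_of (convex hull \<S>)"
  and net_limit: "S \<in> \<S> \<Longrightarrow> limitin strong_operator_topology (\<lambda>i. T i o\<^sub>L (id_blinfun - S)) 0 (tails A le)"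
  using net unfolding right_ergodic_net_def by blast+

lemma support_nonempty: "L \<noteq> {}"
proof
  assume "L = {}"
  then have "vanishing_ideal L = UNIV" by (simp add: vanishing_ideal_def)
  with L(2) show False by (simp add: S_ideal_def)
qed

text \<open>A directed index set has an element, and the closed convex hull of the empty set
  contains no operator. This feeds the requirement of \<open>extreme_state_Prim\<close>.\<close>

lemma semigroup_nonempty: "\<S> \<noteq> {}"
proof -
  obtain i where i: "i \<in> A" using directed by (auto simp: directed_set_def)
  show ?thesis using net_closure[OF i] by auto
qed

lemma net_positive:
  assumes i: "i \<in> A" shows "positive_op (T i)"
  unfolding positive_op_def
proof (rule allI, rule impI)
  fix f :: "'a CK" assume f: "\<forall>x. apply_bcontfun f x \<in> \<real>\<^sub>\<ge>\<^sub>0"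
  let ?W = "{g :: 'a CK. \<forall>x. 0 \<le> Re (apply_bcontfun g x) \<and> Im (apply_bcontfun g x) = 0}"
  have "T i f \<in> ?W"
  proof (rule strong_closure_convex_hull_apply[OF net_closure[OF i]])
    show "closed ?W"
      by (intro closed_Collect_all closed_Collect_conj closed_Collect_le closed_Collect_eq
          continuous_on_const continuous_on_Re continuous_on_Im continuous_on_eval)
    show "convex ?W" by (auto simp: convex_def)
    show "S f \<in> ?W" if "S \<in> \<S>" for S
      using markov[OF that] f by (auto simp: markov_def positive_op_def complex_nonneg_Reals_iff)
  qed
  then show "\<forall>x. apply_bcontfun (T i f) x \<in> \<real>\<^sub>\<ge>\<^sub>0" by (auto simp: complex_nonneg_Reals_iff)
qed

lemma net_one:
  assumes i: "i \<in> A" shows "T i (const_bcontfun 1) = const_bcontfun 1"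
proof -
  have "T i (const_bcontfun 1) \<in> {const_bcontfun 1}"
    by (rule strong_closure_convex_hull_apply[OF net_closure[OF i]]) (use markov in \<open>auto simp: markov_def\<close>)
  then show ?thesis by simp
qed

lemma net_vanishing_ideal:
  assumes i: "i \<in> A" and f: "f \<in> vanishing_ideal L" shows "T i f \<in> vanishing_ideal L"
proof (rule strong_closure_convex_hull_apply[OF net_closure[OF i] closed_vanishing_ideal convex_vanishing_ideal])
  show "S f \<in> vanishing_ideal L" if "S \<in> \<S>" for S
    using L(2) f that unfolding S_ideal_def by blast
qed

text \<open>Integration against \<mu> is a bounded linear functional, so its level sets are closed
  and convex; the level of \<open>f\<close> contains \<open>S f\<close> for every \<open>S\<close>
  in \<S>.\<close>

lemma net_invariant:
  assumes i: "i \<in> A" and \<mu>: "\<mu> \<in> invariant_probs \<S>"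
  shows "integral\<^sup>L \<mu> (apply_bcontfun (T i f)) = integral\<^sup>L \<mu> (apply_bcontfun f)"
proof -
  interpret prob_space \<mu> using \<mu> by (simp add: invariant_probs_def)
  have s: "sets \<mu> = sets borel" using \<mu> by (simp add: invariant_probs_def)
  have ib: "integrable \<mu> (apply_bcontfun g)" for g :: "'a CK"
  proof (rule integrable_const_bound)
    show "AE x in \<mu>. norm (apply_bcontfun g x) \<le> norm g" by (simp add: norm_bounded)
    show "apply_bcontfun g \<in> borel_measurable \<mu>"
      using borel_measurable_continuous_onI[OF continuous_on_apply_bcontfun[of UNIV g]] s by (simp cong: measurable_cong_sets)
  qed
  have bl: "bounded_linear (\<lambda>g :: 'a CK. integral\<^sup>L \<mu> (apply_bcontfun g))"
  proof (rule bounded_linear_intro[of _ 1])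
    show "integral\<^sup>L \<mu> (apply_bcontfun (g + h)) = integral\<^sup>L \<mu> (apply_bcontfun g) + integral\<^sup>L \<mu> (apply_bcontfun h)" for g h :: "'a CK"
      using ib by (simp flip: Bochner_Integration.integral_add)
    show "integral\<^sup>L \<mu> (apply_bcontfun (r *\<^sub>R g)) = r *\<^sub>R integral\<^sup>L \<mu> (apply_bcontfun g)" for r and g :: "'a CK"
      by (simp add: scaleR_bcontfun.rep_eq)
    show "norm (integral\<^sup>L \<mu> (apply_bcontfun g)) \<le> norm g * 1" for g :: "'a CK"
      using norm_integral_le[of "apply_bcontfun g" "norm g"] prob_space by (simp add: norm_bounded)
  qed
  have "T i f \<in> (\<lambda>g. integral\<^sup>L \<mu> (apply_bcontfun g)) -` {integral\<^sup>L \<mu> (apply_bcontfun f)}"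
  proof (rule strong_closure_convex_hull_apply[OF net_closure[OF i]])
    show "closed ((\<lambda>g. integral\<^sup>L \<mu> (apply_bcontfun g)) -` {integral\<^sup>L \<mu> (apply_bcontfun f)})"
      by (intro closed_vimage closed_singleton bounded_linear.continuous_on[OF bl] continuous_on_id)
    show "convex ((\<lambda>g. integral\<^sup>L \<mu> (apply_bcontfun g)) -` {integral\<^sup>L \<mu> (apply_bcontfun f)})"
      by (intro convex_linear_vimage bounded_linear.linear[OF bl] convex_singleton)
    show "S f \<in> (\<lambda>g. integral\<^sup>L \<mu> (apply_bcontfun g)) -` {integral\<^sup>L \<mu> (apply_bcontfun f)}" if "S \<in> \<S>" for S
      using \<mu> that by (simp add: invariant_probs_def)
  qed
  then show ?thesis by simp
qed

lemma norm_limit_imp_weak_limit: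
  assumes lim: "((\<lambda>i. norm_CL L (apply_bcontfun (T i f))) \<longlongrightarrow> 0) (tails A le)" and \<nu>: "complex_regular_measure L \<nu>"
  shows "((\<lambda>i. cintegral L \<nu> (apply_bcontfun (T i f))) \<longlongrightarrow> 0) (tails A le)"
proof -
  obtain C where C: "0 \<le> C" "\<And>g d. 0 \<le> d \<Longrightarrow> (\<And>x. x \<in> L \<Longrightarrow> norm (g x) \<le> d) \<Longrightarrow> norm (cintegral L \<nu> g) \<le> C * d"
    by (rule cintegral_bound[OF \<nu>]) blast
  \<comment> \<open>A point of \<open>L\<close> is what makes the supremum \<open>norm_CL\<close>
    non-negative.\<close>
  obtain x where x: "x \<in> L" using support_nonempty by blast
  have le: "norm (cintegral L \<nu> (apply_bcontfun g)) \<le> C * norm_CL L (apply_bcontfun g)" for g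
    using norm_le_norm_CL order_trans[OF norm_ge_zero norm_le_norm_CL[OF x]] by (intro C(2)) auto
  show ?thesis
    by (rule Lim_null_comparison[OF always_eventually tendsto_mult_right_zero[OF lim]]) (use le in blast)
qed

lemma weak_limit_imp_radical:
  assumes f: "\<forall>\<nu>. complex_regular_measure L \<nu> \<longrightarrow>
    ((\<lambda>i. cintegral L \<nu> (apply_bcontfun (T i (cabs f)))) \<longlongrightarrow> 0) (tails A le)"
  shows "f \<in> S_radical \<S> (vanishing_ideal L)"
  unfolding S_radical_def
proof (rule InterI)
  fix p assume "p \<in> {p \<in> Prim \<S>. vanishing_ideal L \<subseteq> p}"
  then obtain \<mu> where \<mu>: "p = I_mu \<mu>" "\<mu> \<in> invariant_probs \<S>" "vanishing_ideal L \<subseteq> I_mu \<mu>"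
    by (auto simp: Prim_def)
  have prob: "prob_space \<mu>" and s: "sets \<mu> = sets borel" and reg: "regular_on UNIV (emeasure \<mu>)"
    using \<mu>(2) by (auto simp: invariant_probs_def)
  have fin: "finite_measure \<mu>" using prob by (simp add: prob_space_def)
  have sp: "space \<mu> = UNIV" using sets_eq_imp_space_eq[OF s] by simp
  have Lb: "L \<in> sets borel" by (rule borel_closed[OF L(1)])
  \<comment> \<open>Since the ideal of \<open>L\<close> lies in \<open>I_mu \<mu>\<close>, the
    measure \<mu> is carried by \<open>L\<close>, and its restriction integrates functions on
    \<open>K\<close> exactly as \<mu> does.\<close>
  define \<nu> where "\<nu> = (\<lambda>A. complex_of_real (measure (restrict_space \<mu> L) A))"
  have ae: "AE x in \<mu>. x \<in> L" by (rule null_off_support[OF K prob s reg L(1) \<mu>(3)])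
  have int: "cintegral L \<nu> (apply_bcontfun g) = integral\<^sup>L \<mu> (apply_bcontfun g)" for g
  proof -
    have "cintegral L \<nu> (apply_bcontfun g) = integral\<^sup>L (restrict_space \<mu> L) (apply_bcontfun g)"
      unfolding \<nu>_def
    proof (rule cintegral_measure)
      show "finite_measure (restrict_space \<mu> L)" using fin Lb s by (intro finite_measure_restrict_space) auto
      show "space (restrict_space \<mu> L) = L" by (simp add: space_restrict_space sp)
      show "sets (restrict_space \<mu> L) = borel_on L" by (rule sets_restrict_space_cong[OF s])
    qed
    also have "\<dots> = (\<integral>x. indicator L x *\<^sub>R apply_bcontfun g x \<partial>\<mu>)"
      using Lb s sp by (intro integral_restrict_space) auto
    also have "\<dots> = integral\<^sup>L \<mu> (apply_bcontfun g)"
    proof (rule integral_cong_AE)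
      have gm: "apply_bcontfun g \<in> borel_measurable \<mu>"
        using borel_measurable_continuous_onI[OF continuous_on_apply_bcontfun[of UNIV g]] s by (simp cong: measurable_cong_sets)
      then show "apply_bcontfun g \<in> borel_measurable \<mu>" .
      show "(\<lambda>x. indicator L x *\<^sub>R apply_bcontfun g x) \<in> borel_measurable \<mu>"
        using gm Lb s by (intro borel_measurable_scaleR borel_measurable_indicator) auto
      show "AE x in \<mu>. indicator L x *\<^sub>R apply_bcontfun g x = apply_bcontfun g x"
        using ae by eventually_elim simp
    qed
    finally show ?thesis .
  qed
  have "complex_regular_measure L \<nu>"
    unfolding \<nu>_def by (rule complex_regular_measure_restrict[OF fin s reg Lb])
  with f have lim: "((\<lambda>i. cintegral L \<nu> (apply_bcontfun (T i (cabs f)))) \<longlongrightarrow> 0) (tails A le)" by blast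
  have "eventually (\<lambda>i. cintegral L \<nu> (apply_bcontfun (T i (cabs f))) = integral\<^sup>L \<mu> (apply_bcontfun (cabs f))) (tails A le)"
    using tails_eventually_in[OF directed] unfolding int by eventually_elim (rule net_invariant[OF _ \<mu>(2)])
  with lim have "((\<lambda>i. integral\<^sup>L \<mu> (apply_bcontfun (cabs f))) \<longlongrightarrow> 0) (tails A le)"
    by (rule Lim_transform_eventually)
  then have "integral\<^sup>L \<mu> (apply_bcontfun (cabs f)) = 0"
    using tails_neq_bot[OF directed] by (simp add: tendsto_const_iff)
  then show "f \<in> p" by (simp add: \<mu>(1) I_mu_def)
qed

lemma radical_imp_norm_limit:
  assumes f: "f \<in> S_radical \<S> (vanishing_ideal L)"
  shows "((\<lambda>i. norm_CL L (apply_bcontfun (T i (cabs f)))) \<longlongrightarrow> 0) (tails A le)"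
proof (rule ccontr)
  define g where "g = (\<lambda>x. norm (apply_bcontfun f x))"
  have g: "continuous_on UNIV g" unfolding g_def by (intro continuous_on_norm continuous_on_apply_bcontfun)
  have fg: "cabs f = cx g" unfolding g_def by (rule cabs_eq_cx[OF K])
  define N where "N i = norm_CL L (apply_bcontfun (T i (cabs f)))" for i
  obtain x0 where x0: "x0 \<in> L" using support_nonempty by blast
  have N0: "0 \<le> N i" for i unfolding N_def using norm_le_norm_CL[OF x0] norm_ge_zero order_trans by blast
  assume "\<not> ((\<lambda>i. norm_CL L (apply_bcontfun (T i (cabs f)))) \<longlongrightarrow> 0) (tails A le)"
  then obtain e where e: "0 < e" "\<not> eventually (\<lambda>i. N i < e) (tails A le)"
    using N0 unfolding tendsto_iff N_def by (auto simp: dist_real_def)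
  \<comment> \<open>This filter replaces a subnet along which the norm stays at least
    \<open>e\<close>; it is proper because such indices occur in every tail.\<close>
  define F where "F = inf (tails A le) (principal {i. e \<le> N i})"
  have F: "F \<noteq> bot"
    using e(2) unfolding F_def trivial_limit_def eventually_inf_principal by (simp add: not_le)
  have F_le: "F \<le> tails A le" by (simp add: F_def)
  have evF: "eventually (\<lambda>i. i \<in> A \<and> e \<le> N i) F"
    using tails_eventually_in[OF directed] unfolding F_def eventually_inf_principal by eventually_elim simp
  \<comment> \<open>Lowering \<open>e\<close> to \<open>e / 2\<close> turns the bound on a supremum
    into a bound at an actual point.\<close>
  have "\<exists>x\<in>L. e / 2 \<le> re_op (T i) g x" if i: "i \<in> A" "e \<le> N i" for i
  proof -
    have "e / 2 < (SUP x\<in>L. norm (apply_bcontfun (T i (cabs f)) x))"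
      using i(2) e(1) unfolding N_def norm_CL_def by linarith
    moreover have "bdd_above ((\<lambda>x. norm (apply_bcontfun (T i (cabs f)) x)) ` L)"
      by (intro bdd_aboveI[of _ "norm (T i (cabs f))"]) (auto simp: norm_bounded)
    ultimately obtain x where x: "x \<in> L" "e / 2 < norm (apply_bcontfun (T i (cabs f)) x)"
      using less_cSUP_iff[of L "\<lambda>x. norm (apply_bcontfun (T i (cabs f)) x)"] support_nonempty by blast
    have "T i (cabs f) = cx (re_op (T i) g)" unfolding fg by (rule op_cx[OF K net_positive[OF i(1)] g])
    then have "norm (apply_bcontfun (T i (cabs f)) x) = \<bar>re_op (T i) g x\<bar>"
      by (simp add: apply_cx[OF K continuous_re_op])
    moreover have "0 \<le> re_op (T i) g x"
      by (rule re_op_nonneg[OF K net_positive[OF i(1)] g]) (simp add: g_def)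
    ultimately show ?thesis using x by (intro bexI[of _ x]) auto
  qed
  then obtain x where x: "\<And>i. i \<in> A \<Longrightarrow> e \<le> N i \<Longrightarrow> x i \<in> L \<and> e / 2 \<le> re_op (T i) g (x i)" by metis
  define \<Psi> where "\<Psi> i = (\<lambda>h. if continuous_on UNIV h then re_op (T i) h (x i) else 0)" for i
  have st: "state (\<Psi> i)" if "i \<in> A" for i
    unfolding \<Psi>_def by (rule state_eval[OF K net_positive[OF that] net_one[OF that]])
  have "filtermap \<Psi> F \<noteq> bot" "eventually (\<lambda>\<Phi>. \<Phi> \<in> {\<Phi>. state \<Phi>}) (filtermap \<Psi> F)"
    using F evF st by (auto simp: filtermap_bot_iff eventually_filtermap elim: eventually_mono)
  then obtain \<Phi> where \<Phi>: "state \<Phi>" "inf (nhds \<Phi>) (filtermap \<Psi> F) \<noteq> bot"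
    using compact_states[OF K] unfolding compact_filter by blast
  have cluster: "\<Phi> \<in> C" if "closed C" "eventually (\<lambda>i. \<Psi> i \<in> C) F" for C
    using cluster_point_closed[OF \<Phi>(2) _ that(1)] that(2) by (simp add: eventually_filtermap)
  have "\<Phi> \<in> inv_states (re_op ` \<S>) L"
    unfolding inv_states_def
  proof (intro CollectI conjI \<Phi>(1) allI impI ballI)
    fix h assume h: "continuous_on UNIV h" "\<forall>x\<in>L. h x = (0::real)"
    have "\<Phi> \<in> {\<Phi>. \<Phi> h = 0}"
    proof (rule cluster)
      show "closed {\<Phi>. \<Phi> h = (0::real)}"
        by (intro closed_Collect_eq continuous_on_product_coordinates continuous_on_const)
      show "eventually (\<lambda>i. \<Psi> i \<in> {\<Phi>. \<Phi> h = 0}) F"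
        using evF
      proof eventually_elim
        fix i assume i: "i \<in> A \<and> e \<le> N i"
        have "cx h \<in> vanishing_ideal L" using h by (simp add: vanishing_ideal_def apply_cx[OF K])
        then have "T i (cx h) \<in> vanishing_ideal L" using i by (intro net_vanishing_ideal) auto
        then show "\<Psi> i \<in> {\<Phi>. \<Phi> h = 0}" using x[of i] i by (simp add: \<Psi>_def re_op_def vanishing_ideal_def)
      qed
    qed
    then show "\<Phi> h = 0" by simp
  next
    fix Q and h :: "'a \<Rightarrow> real" assume Q: "Q \<in> re_op ` \<S>" and h: "continuous_on UNIV h"
    then obtain S where S: "S \<in> \<S>" "Q = re_op S" by blast
    have pS: "positive_op S" using markov[OF S(1)] by (simp add: markov_def)
    \<comment> \<open>Along the net, invariance holds only up to an error tending to 0. For each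
      \<open>d\<close> the non-strict bound is a closed condition that eventually holds, so it
      passes to the cluster point.\<close>
    have "\<bar>\<Phi> h - \<Phi> (Q h)\<bar> \<le> 0 + d" if d: "0 < d" for d
    proof -
      have "\<Phi> \<in> {\<Phi>. \<bar>\<Phi> h - \<Phi> (Q h)\<bar> \<le> d}"
      proof (rule cluster)
        show "closed {\<Phi>. \<bar>\<Phi> h - \<Phi> (Q h)\<bar> \<le> d}"
          by (intro closed_Collect_le continuous_on_rabs continuous_on_diff continuous_on_product_coordinates continuous_on_const)
        have "((\<lambda>i. (T i o\<^sub>L (id_blinfun - S)) (cx h)) \<longlongrightarrow> (0 :: 'a CKop) (cx h)) (tails A le)"
          by (rule strong_limit_apply[OF net_limit[OF S(1)]])
        then have "eventually (\<lambda>i. norm (T i (cx h - S (cx h))) < d) (tails A le)"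
          using d unfolding tendsto_iff by (simp add: dist_norm blinfun.diff_left)
        then have "eventually (\<lambda>i. norm (T i (cx h - S (cx h))) < d) F" using F_le by (simp add: le_filter_def)
        then show "eventually (\<lambda>i. \<Psi> i \<in> {\<Phi>. \<bar>\<Phi> h - \<Phi> (Q h)\<bar> \<le> d}) F"
        proof eventually_elim
          fix i assume i: "norm (T i (cx h - S (cx h))) < d"
          have "\<Psi> i h - \<Psi> i (Q h) = Re (apply_bcontfun (T i (cx h - S (cx h))) (x i))"
            unfolding S(2) \<Psi>_def op_cx[OF K pS h]
            by (simp add: h continuous_re_op re_op_def[of "T i"] blinfun.diff_right)
          also have "\<bar>\<dots>\<bar> \<le> norm (T i (cx h - S (cx h)))"
            using abs_Re_le_cmod norm_bounded order_trans by blast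
          finally show "\<Psi> i \<in> {\<Phi>. \<bar>\<Phi> h - \<Phi> (Q h)\<bar> \<le> d}" using i by simp
        qed
      qed
      then show ?thesis by simp
    qed
    then have "\<bar>\<Phi> h - \<Phi> (Q h)\<bar> \<le> 0" by (rule field_le_epsilon)
    then show "\<Phi> (Q h) = \<Phi> h" by simp
  qed
  then have ne: "inv_states (re_op ` \<S>) L \<noteq> {}" and \<Phi>_inv: "\<Phi> \<in> inv_states (re_op ` \<S>) L" by auto
  have \<Phi>_g: "e / 2 \<le> \<Phi> g"
  proof -
    have "\<Phi> \<in> {\<Phi>. e / 2 \<le> \<Phi> g}"
    proof (rule cluster)
      show "closed {\<Phi>. e / 2 \<le> \<Phi> g}"
        by (intro closed_Collect_le continuous_on_product_coordinates continuous_on_const)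
      show "eventually (\<lambda>i. \<Psi> i \<in> {\<Phi>. e / 2 \<le> \<Phi> g}) F"
        using evF by eventually_elim (use x g in \<open>simp add: \<Psi>_def\<close>)
    qed
    then show ?thesis by simp
  qed
  \<comment> \<open>Maximality at \<open>g\<close> carries the lower bound \<open>e / 2\<close> over
    from \<Phi> to the extreme state, which contradicts that \<open>f\<close> lies in its primitive
    ideal.\<close>
  obtain \<phi> where \<phi>: "\<phi> \<in> inv_states (re_op ` \<S>) L" "\<forall>\<psi>\<in>inv_states (re_op ` \<S>) L. \<psi> g \<le> \<phi> g"
    and ext: "\<forall>a\<in>inv_states (re_op ` \<S>) L. \<forall>b\<in>inv_states (re_op ` \<S>) L. \<forall>t. 0 < t \<longrightarrow> t < 1 \<longrightarrow>
      (\<forall>x. \<phi> x = t * a x + (1 - t) * b x) \<longrightarrow> a = \<phi>"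
    by (rule extreme_maximiser[OF compact_inv_states[OF K] closed_inv_states[OF K] ne, of g])
  have "{f. \<phi> (\<lambda>x. norm (apply_bcontfun f x)) = 0} \<in> Prim \<S>" (is "?p \<in> _")
    by (rule extreme_state_Prim[OF K markov semigroup_nonempty \<phi>(1)]) (use ext in blast)+
  moreover have "vanishing_ideal L \<subseteq> ?p"
    using \<phi>(1) by (auto simp: vanishing_ideal_def inv_states_def continuous_on_norm)
  ultimately have "f \<in> ?p" using f unfolding S_radical_def by blast
  then have "\<phi> g = 0" by (simp add: g_def)
  then show False using bspec[OF \<phi>(2) \<Phi>_inv] \<Phi>_g e(1) by simp
qed

end

theorem theorem4p2:
  fixes \<S> :: "('a::t2_space) CKop set"
    and L :: "'a set"
    and A :: "'i set" and le :: "'i \<Rightarrow> 'i \<Rightarrow> bool" and T :: "'i \<Rightarrow> 'a CKop"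
  assumes "compact (UNIV :: 'a set)"
    and "op_semigroup \<S>" and "\<forall>S\<in>\<S>. markov S" and "right_amenable \<S>"
    and "closed L" and "S_ideal \<S> (vanishing_ideal L)"
    and "right_ergodic_net \<S> A le T"
  shows "S_radical \<S> (vanishing_ideal L) =
           {f. \<forall>\<mu>. complex_regular_measure L \<mu> \<longrightarrow>
                 ((\<lambda>i. cintegral L \<mu> (apply_bcontfun (T i (cabs f)))) \<longlongrightarrow> 0) (tails A le)} \<and>
         {f. \<forall>\<mu>. complex_regular_measure L \<mu> \<longrightarrow>
                 ((\<lambda>i. cintegral L \<mu> (apply_bcontfun (T i (cabs f)))) \<longlongrightarrow> 0) (tails A le)} =
           {f. ((\<lambda>i. norm_CL L (apply_bcontfun (T i (cabs f)))) \<longlongrightarrow> 0) (tails A le)} \<and>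
         (radical_S_ideal \<S> (vanishing_ideal L) \<longleftrightarrow>
           (\<forall>f. ((\<lambda>i. norm_CL L (apply_bcontfun (T i (cabs f)))) \<longlongrightarrow> 0) (tails A le)
                \<longrightarrow> (\<forall>x\<in>L. apply_bcontfun f x = 0)))"
proof -
  let ?B = "{f. \<forall>\<mu>. complex_regular_measure L \<mu> \<longrightarrow>
                 ((\<lambda>i. cintegral L \<mu> (apply_bcontfun (T i (cabs f)))) \<longlongrightarrow> 0) (tails A le)}"
  let ?C = "{f. ((\<lambda>i. norm_CL L (apply_bcontfun (T i (cabs f)))) \<longlongrightarrow> 0) (tails A le)}"
  have markov: "markov S" if "S \<in> \<S>" for S using assms(3) that by blast
  note hyps = assms(1) markov assms(5-7)
  \<comment> \<open>The three inclusions close a cycle, so both equalities follow at once.\<close>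
  have 1: "?C \<subseteq> ?B" using norm_limit_imp_weak_limit[OF hyps] by blast
  have 2: "?B \<subseteq> S_radical \<S> (vanishing_ideal L)" using weak_limit_imp_radical[OF hyps] by blast
  have 3: "S_radical \<S> (vanishing_ideal L) \<subseteq> ?C" using radical_imp_norm_limit[OF hyps] by blast
  have 4: "vanishing_ideal L \<subseteq> S_radical \<S> (vanishing_ideal L)" by (auto simp: S_radical_def)
  have eqs: "S_radical \<S> (vanishing_ideal L) = ?B" "?B = ?C"
    by (rule equalityI[OF subset_trans[OF 3 1] 2], rule equalityI[OF subset_trans[OF 2 3] 1])
  have "radical_S_ideal \<S> (vanishing_ideal L) \<longleftrightarrow> S_radical \<S> (vanishing_ideal L) \<subseteq> vanishing_ideal L"
    using 4 assms(6) unfolding radical_S_ideal_def by blast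
  also have "\<dots> \<longleftrightarrow> ?C \<subseteq> vanishing_ideal L" unfolding eqs ..
  also have "\<dots> \<longleftrightarrow> (\<forall>f. ((\<lambda>i. norm_CL L (apply_bcontfun (T i (cabs f)))) \<longlongrightarrow> 0) (tails A le)
                \<longrightarrow> (\<forall>x\<in>L. apply_bcontfun f x = 0))"
    by (auto simp: vanishing_ideal_def)
  finally show ?thesis by (intro conjI eqs)
qed

end
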